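(* The decision problem CFSubsetIntervals has a quasipolynomial time deterministic algorithm; that is, there is a deterministic algorithm that decides CFSubsetIntervals in time $2^{(\log N)^{O(1)}}$, where $N$ is the input size.
   Context: Notation: $\mathbb{N}$ is the set of non-negative integers, $\mathbb{Z}^+$ the set of positive integers, $[n]=\{1,\dots,n\}$, and for $s\le t$ in $[n]$, $[s,t]=\{i\in[n] : s\le i\le t\}$. $\mathcal{I}_n=\{[s,t] : s\le t,\ s,t\in[n]\}$; the discrete interval hypergraph is $H_n=([n],\mathcal{I}_n)$, and its subhypergraphs considered here are $([n],I)$ with $I\subseteq\mathcal{I}_n$. For a hypergraph $H=(V,\mathcal{E})$ ($V$ finite, $\mathcal{E}$ a family of non-empty subsets of $V$), a function $C\colon V\to\mathbb{N}$ is a conflict-free coloring if for every $S\in\mathcal{E}$ there is a color $i\in\mathbb{Z}^+$ with $|S\cap C^{-1}(i)|=1$. $\chi_{\mathrm{cf}}(H)$ is the minimum $k\in\mathbb{N}$ such that $H$ has a conflict-free coloring with colors in $\{0,\dots,k\}$. CFSubsetIntervals: given a subhypergraph $H=([n],I)$ of the discrete interval hypergraph $H_n$ (vertices and hyperedges listed explicitly, so the input size is at least $n$) and a natural number $k$, decide whether $\chi_{\mathrm{cf}}(H)\le k$. *)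

theory Defs
  imports Complex_Main
begin

section \<open>Conflict-free colorings of interval hypergraphs\<close>

definition intervals :: "nat \<Rightarrow> nat set set" where
  "intervals n = {{s..t} | s t. 1 \<le> s \<and> s \<le> t \<and> t \<le> n}"

text \<open>A hypergraph is given by its vertex set \<open>V\<close> and its family \<open>E\<close> of hyperedges. The color \<open>0\<close>
  plays the role of "uncolored": it never witnesses conflict-freeness.\<close>

definition cf_coloring :: "'v set \<Rightarrow> 'v set set \<Rightarrow> ('v \<Rightarrow> nat) \<Rightarrow> bool" where
  "cf_coloring V E C \<longleftrightarrow> (\<forall>S\<in>E. \<exists>i>0. card (S \<inter> {v \<in> V. C v = i}) = 1)"

definition chi_cf :: "'v set \<Rightarrow> 'v set set \<Rightarrow> nat" where
  "chi_cf V E = (LEAST k. \<exists>C. cf_coloring V E C \<and> C ` V \<subseteq> {0..k})"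


section \<open>The decision problem as a formal language\<close>

datatype letter = Bit bool | Comma | Semicolon

text \<open>Binary numerals, most significant bit first, without leading zeros (\<open>0\<close> is written as a single
  zero bit).\<close>

fun binary :: "nat \<Rightarrow> letter list" where
  "binary m = (if m < 2 then [Bit (m = 1)] else binary (m div 2) @ [Bit (odd m)])"

declare binary.simps [simp del]

definition encode_vertices :: "nat list \<Rightarrow> letter list" where
  "encode_vertices vs = concat (map (\<lambda>v. binary v @ [Comma]) vs) @ [Semicolon]"

text \<open>The hyperedges are listed in an arbitrary order, each one by all of its vertices in increasing
  order. Every vertex of \<open>[n]\<close> contributes at least one letter, so an encoding has length at least
  \<open>n\<close>.\<close>

definition encode :: "nat \<Rightarrow> nat set list \<Rightarrow> nat \<Rightarrow> letter list" where
  "encode n Is k =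
     binary k @ [Semicolon] @ encode_vertices [1..<Suc n] @
     concat (map (\<lambda>S. encode_vertices (sorted_list_of_set S)) Is)"

definition CFSubsetIntervals :: "letter list set" where
  "CFSubsetIntervals =
     {encode n Is k | n Is k. set Is \<subseteq> intervals n \<and> chi_cf {1..n} (set Is) \<le> k}"


section \<open>Deterministic multi-tape Turing machines\<close>

text \<open>Besides the blank and the letters of the input alphabet \<open>'a\<close>, a machine may use auxiliary
  work symbols; only finitely many of them, by \<open>wf_tm\<close> below.\<close>

datatype 'a cell = Blank | Input 'a | Work nat

datatype move = MoveLeft | Stay | MoveRight

record 'a tm =
  tapes :: nat
  states :: "nat set"
  alphabet :: "'a cell set"
  start :: nat
  accept :: nat
  reject :: nat
  trans :: "nat \<Rightarrow> 'a cell list \<Rightarrow> nat \<times> ('a cell \<times> move) list"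

definition wf_tm :: "'a tm \<Rightarrow> bool" where
  "wf_tm M \<longleftrightarrow>
     tapes M \<ge> 1 \<and>
     finite (states M) \<and> {start M, accept M, reject M} \<subseteq> states M \<and> accept M \<noteq> reject M \<and>
     finite (alphabet M) \<and> Blank \<in> alphabet M \<and> range Input \<subseteq> alphabet M \<and>
     (\<forall>q \<in> states M - {accept M, reject M}. \<forall>xs. length xs = tapes M \<and> set xs \<subseteq> alphabet M \<longrightarrow>
        fst (trans M q xs) \<in> states M \<and>
        length (snd (trans M q xs)) = tapes M \<and>
        fst ` set (snd (trans M q xs)) \<subseteq> alphabet M)"

text \<open>A tape is infinite in both directions; it is given by its contents and its head position.\<close>

type_synonym 'a tape = "(int \<Rightarrow> 'a cell) \<times> int"
type_synonym 'a config = "nat \<times> 'a tape list"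

fun read_tape :: "'a tape \<Rightarrow> 'a cell" where
  "read_tape (f, h) = f h"

fun move_head :: "move \<Rightarrow> int \<Rightarrow> int" where
  "move_head MoveLeft h = h - 1"
| "move_head Stay h = h"
| "move_head MoveRight h = h + 1"

fun act_tape :: "'a cell \<times> move \<Rightarrow> 'a tape \<Rightarrow> 'a tape" where
  "act_tape (x, d) (f, h) = (f(h := x), move_head d h)"

fun step :: "'a tm \<Rightarrow> 'a config \<Rightarrow> 'a config" where
  "step M (q, ts) =
     (if q \<in> {accept M, reject M} then (q, ts)
      else let (q', as) = trans M q (map read_tape ts) in (q', map2 act_tape as ts))"

definition blank_tape :: "'a tape" where
  "blank_tape = ((\<lambda>_. Blank), 0)"

definition input_tape :: "'a list \<Rightarrow> 'a tape" where
  "input_tape w = ((\<lambda>i. if 0 \<le> i \<and> i < int (length w) then Input (w ! nat i) else Blank), 0)"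

definition init_config :: "'a tm \<Rightarrow> 'a list \<Rightarrow> 'a config" where
  "init_config M w = (start M, input_tape w # replicate (tapes M - 1) blank_tape)"

text \<open>Since \<open>step\<close> does not change halted configurations, the state after \<open>T (length w)\<close> steps is
  the verdict exactly if the machine halts with it within that many steps.\<close>

definition decides_in_time :: "'a tm \<Rightarrow> 'a list set \<Rightarrow> (nat \<Rightarrow> nat) \<Rightarrow> bool" where
  "decides_in_time M L T \<longleftrightarrow>
     (\<forall>w. fst ((step M ^^ T (length w)) (init_config M w)) =
            (if w \<in> L then accept M else reject M))"

definition quasipolynomial :: "(nat \<Rightarrow> nat) \<Rightarrow> bool" where
  "quasipolynomial T \<longleftrightarrow>
     (\<exists>c::nat. \<forall>\<^sub>F N in sequentially. real (T N) \<le> 2 powr (log 2 (real N) ^ c))"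

end

theory Submission imports Defs begin

text \<open>A coloring of the points can be searched from left to right. Whether color \<open>i\<close> occurs exactly once
in \<open>{s..t}\<close> is decided by the last two occurrences of \<open>i\<close> up to \<open>t\<close>: the last one must lie in the
interval and the one before must not (\<open>unique_occ_iff\<close>). So the search only has to remember two positions
for every color. Moreover \<open>log n + 1\<close> colors always suffice, because the ruler sequence, which colors \<open>v\<close>
by one plus the exponent of two in \<open>v\<close>, is conflict-free for all intervals (\<open>ruler_unique\<close>). The search
therefore walks through a layered graph whose nodes are numbers with about \<open>2 log n\<close> digits in a base
slightly above the input length; there are only quasipolynomially many of them, and the reachable nodes
are found layer by layer in a table of bits (\<open>layer_coloring\<close>).

The Turing machine is obtained without writing a transition table. Structured programs over tapes are
compiled into machines whose control states are the continuations of the program (\<open>run_decides\<close>). On top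
of them, a function of a store of natural numbers is called feasible if a program computes it, every number
being kept in unary as a head position, with time and result at most \<open>2 ^ (r ^ e)\<close> whenever the numbers in
the store and the input length are at most \<open>2 ^ r\<close>. Unary numbers are affordable since every
number occurring in the algorithm has quasipolynomial size, and bounds of this form compose, since a power
of a power of \<open>r\<close> is a power of \<open>r\<close>.

Feasible functions are closed under bounded primitive recursion (\<open>feasible_rec\<close>) and under filling a table of
bits (\<open>feasible_table\<close>), hence under arithmetic, bounded quantifiers and reachability in layered graphs
(\<open>feasible_layer\<close>). It remains to describe the language by a formula built from these constructs: the formula
\<open>decision\<close> parses the word and searches for a coloring. Its correctness (\<open>decision_iff\<close>) is pure
combinatorics of words and colorings, and its feasibility (\<open>feasible_decision\<close>) can be read off its shape.\<close>


section \<open>Structured tape programs and their compilation\<close>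

text \<open>A program acts on infinitely many tapes indexed by natural numbers; being finite, it touches only
those below its \<open>tape_bound\<close>. Tests are arbitrary predicates on the symbol under one head, since a
transition function can evaluate them in a single step.\<close>

datatype 'a com =
    Mv nat move
  | Wr nat "'a cell"
  | Seq "'a com" "'a com"
  | If nat "'a cell \<Rightarrow> bool" "'a com" "'a com"
  | While nat "'a cell \<Rightarrow> bool" "'a com"

text \<open>The third argument counts the steps of the compiled machine, including one step for every control
decision, so that the simulation below is step for step.\<close>

inductive run :: "'a com \<Rightarrow> (nat \<Rightarrow> 'a tape) \<Rightarrow> nat \<Rightarrow> (nat \<Rightarrow> 'a tape) \<Rightarrow> bool" where
  Mv: "run (Mv i d) \<sigma> 1 (\<sigma>(i := act_tape (read_tape (\<sigma> i), d) (\<sigma> i)))"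
| Wr: "run (Wr i x) \<sigma> 1 (\<sigma>(i := act_tape (x, Stay) (\<sigma> i)))"
| Seq: "run a \<sigma> t \<sigma>' \<Longrightarrow> run b \<sigma>' u \<sigma>'' \<Longrightarrow> run (Seq a b) \<sigma> (Suc (t + u)) \<sigma>''"
| IfT: "P (read_tape (\<sigma> i)) \<Longrightarrow> run a \<sigma> t \<sigma>' \<Longrightarrow> run (If i P a b) \<sigma> (Suc t) \<sigma>'"
| IfF: "\<not> P (read_tape (\<sigma> i)) \<Longrightarrow> run b \<sigma> t \<sigma>' \<Longrightarrow> run (If i P a b) \<sigma> (Suc t) \<sigma>'"
| WhileF: "\<not> P (read_tape (\<sigma> i)) \<Longrightarrow> run (While i P a) \<sigma> 1 \<sigma>"
| WhileT: "P (read_tape (\<sigma> i)) \<Longrightarrow> run a \<sigma> t \<sigma>' \<Longrightarrow> run (While i P a) \<sigma>' u \<sigma>'' \<Longrightarrow>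
     run (While i P a) \<sigma> (Suc (t + u)) \<sigma>''"

primrec tape_bound :: "'a com \<Rightarrow> nat" where
  "tape_bound (Mv i d) = Suc i"
| "tape_bound (Wr i x) = Suc i"
| "tape_bound (Seq a b) = max (tape_bound a) (tape_bound b)"
| "tape_bound (If i P a b) = max (Suc i) (max (tape_bound a) (tape_bound b))"
| "tape_bound (While i P a) = max (Suc i) (tape_bound a)"

primrec symbols :: "'a com \<Rightarrow> 'a cell set" where
  "symbols (Mv i d) = {}"
| "symbols (Wr i x) = {x}"
| "symbols (Seq a b) = symbols a \<union> symbols b"
| "symbols (If i P a b) = symbols a \<union> symbols b"
| "symbols (While i P a) = symbols a"

lemma finite_symbols: "finite (symbols c)"
  by (induction c) auto

text \<open>A running machine is in the state \<open>Inl k\<close>, where the list \<open>k\<close> is the continuation: the programs that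
remain to be executed. The states \<open>Inr True\<close> and \<open>Inr False\<close> are the two verdicts.\<close>

type_synonym 'a control = "'a com list + bool"

text \<open>The continuations that can arise while \<open>c\<close> is executed with \<open>k\<close> to follow. A loop pushes itself
back onto the continuation instead of being unfolded, which is why there are only finitely many.\<close>

primrec conts :: "'a com \<Rightarrow> 'a com list \<Rightarrow> 'a com list set" where
  "conts (Mv i d) k = {Mv i d # k}"
| "conts (Wr i x) k = {Wr i x # k}"
| "conts (Seq a b) k = insert (Seq a b # k) (conts a (b # k) \<union> conts b k)"
| "conts (If i P a b) k = insert (If i P a b # k) (conts a k \<union> conts b k)"
| "conts (While i P a) k = insert (While i P a # k) (conts a (While i P a # k))"

lemma finite_conts: "finite (conts c k)"
  by (induction c arbitrary: k) auto

lemma conts_self: "c # k \<in> conts c k"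
  by (cases c) auto

definition idle :: "'a cell list \<Rightarrow> ('a cell \<times> move) list" where
  "idle xs = map (\<lambda>x. (x, Stay)) xs"

text \<open>The transition function on continuations; when the program is finished, the verdict is read off
the symbol on tape \<open>i0\<close> by the predicate \<open>P0\<close>.\<close>

fun next_control :: "nat \<Rightarrow> ('a cell \<Rightarrow> bool) \<Rightarrow> 'a control \<Rightarrow> 'a cell list \<Rightarrow>
    'a control \<times> ('a cell \<times> move) list" where
  "next_control i0 P0 (Inl []) xs = (Inr (P0 (xs ! i0)), idle xs)"
| "next_control i0 P0 (Inl (Mv i d # k)) xs = (Inl k, (idle xs)[i := (xs ! i, d)])"
| "next_control i0 P0 (Inl (Wr i x # k)) xs = (Inl k, (idle xs)[i := (x, Stay)])"
| "next_control i0 P0 (Inl (Seq a b # k)) xs = (Inl (a # b # k), idle xs)"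
| "next_control i0 P0 (Inl (If i P a b # k)) xs = (Inl ((if P (xs ! i) then a else b) # k), idle xs)"
| "next_control i0 P0 (Inl (While i P a # k)) xs =
     (Inl (if P (xs ! i) then a # While i P a # k else k), idle xs)"
| "next_control i0 P0 (Inr b) xs = (Inr b, idle xs)"

definition controls :: "'a com \<Rightarrow> 'a control set" where
  "controls c = insert (Inl []) (Inl ` conts c [] \<union> range Inr)"

lemma finite_controls: "finite (controls c)"
  by (simp add: controls_def finite_conts)

lemma next_control_conts:
  assumes "l \<in> conts c k"
  shows "fst (next_control i0 P0 (Inl l) xs) \<in> Inl ` (insert k (conts c k))"
  using assms
proof (induction c arbitrary: k)
  case (Seq a b)
  from Seq.prems consider "l = Seq a b # k" | "l \<in> conts a (b # k)" | "l \<in> conts b k" by auto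
  then show ?case
  proof cases
    case 1 then show ?thesis by (auto simp: conts_self)
  next
    case 2 from Seq.IH(1)[OF this] show ?thesis by (auto simp: conts_self)
  next
    case 3 from Seq.IH(2)[OF this] show ?thesis by auto
  qed
next
  case (If i P a b)
  from If.prems consider "l = If i P a b # k" | "l \<in> conts a k" | "l \<in> conts b k" by auto
  then show ?case
  proof cases
    case 1 then show ?thesis by (auto simp: conts_self)
  next
    case 2 from If.IH(1)[OF this] show ?thesis by auto
  next
    case 3 from If.IH(2)[OF this] show ?thesis by auto
  qed
next
  case (While i P a)
  from While.prems consider "l = While i P a # k" | "l \<in> conts a (While i P a # k)" by auto
  then show ?case
  proof cases
    case 1 then show ?thesis by (auto simp: conts_self)
  next
    case 2 from While.IH[OF this] show ?thesis by auto
  qed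
qed auto

lemma next_control_closed:
  assumes "q \<in> controls c"
  shows "fst (next_control i0 P0 q xs) \<in> controls c"
proof -
  consider "q = Inl []" | l where "q = Inl l" "l \<in> conts c []" | b where "q = Inr b"
    using assms by (auto simp: controls_def)
  then show ?thesis
  proof cases
    case 2 with next_control_conts[OF 2(2), of i0 P0 xs] show ?thesis by (auto simp: controls_def)
  qed (auto simp: controls_def)
qed

lemma set_idle_update: "fst ` set ((idle xs)[i := (x, d)]) \<subseteq> insert x (set xs)"
  using set_update_subset_insert[of "idle xs" i "(x, d)"] by (auto simp: idle_def)

lemma next_control_actions:
  assumes "q \<in> controls c" "length xs = K" "tape_bound c \<le> K" "symbols c \<subseteq> A" "set xs \<subseteq> A"
  shows "length (snd (next_control i0 P0 q xs)) = K \<and> fst ` set (snd (next_control i0 P0 q xs)) \<subseteq> A"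
proof -
  have id: "fst ` set (idle xs) \<subseteq> A" using assms by (auto simp: idle_def)
  have *: "length (snd (next_control i0 P0 (Inl l) xs)) = K \<and>
      fst ` set (snd (next_control i0 P0 (Inl l) xs)) \<subseteq> A"
    if "l \<in> conts c k" "tape_bound c \<le> K" "symbols c \<subseteq> A" for l c k
    using that
  proof (induction c arbitrary: k)
    case (Mv i d)
    then have "xs ! i \<in> A" using assms(2,5) by auto
    then have "fst ` set ((idle xs)[i := (xs ! i, d)]) \<subseteq> A"
      using assms(5) by (intro order_trans[OF set_idle_update]) simp
    then show ?case using Mv assms by (simp add: idle_def)
  next
    case (Wr i x)
    then have "fst ` set ((idle xs)[i := (x, Stay)]) \<subseteq> A"
      using assms(5) Wr by (intro order_trans[OF set_idle_update]) simp
    then show ?case using Wr assms by (simp add: idle_def)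
  next
    case (Seq a b)
    show ?case
    proof (cases "l = Seq a b # k")
      case True then show ?thesis using id assms by (simp add: idle_def)
    next
      case False
      then consider "l \<in> conts a (b # k)" | "l \<in> conts b k" using Seq.prems by auto
      then show ?thesis
      proof cases
        case 1 then show ?thesis using Seq.prems by (intro Seq.IH(1)) auto
      next
        case 2 then show ?thesis using Seq.prems by (intro Seq.IH(2)) auto
      qed
    qed
  next
    case (If i P a b)
    show ?case
    proof (cases "l = If i P a b # k")
      case True then show ?thesis using id assms by (simp add: idle_def)
    next
      case False
      then consider "l \<in> conts a k" | "l \<in> conts b k" using If.prems by auto
      then show ?thesis
      proof cases
        case 1 then show ?thesis using If.prems by (intro If.IH(1)) auto
      next
        case 2 then show ?thesis using If.prems by (intro If.IH(2)) auto
      qed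
    qed
  next
    case (While i P a)
    show ?case
    proof (cases "l = While i P a # k")
      case True then show ?thesis using id assms by (simp add: idle_def)
    next
      case False
      then have "l \<in> conts a (While i P a # k)" using While.prems by auto
      then show ?thesis using While.prems by (intro While.IH) auto
    qed
  qed
  consider "q = Inl []" | l where "q = Inl l" "l \<in> conts c []" | b where "q = Inr b"
    using assms(1) by (auto simp: controls_def)
  then show ?thesis
    by cases (use * id assms in \<open>auto simp: idle_def\<close>)
qed

text \<open>States of a machine must be natural numbers, so the finitely many controls are coded by an
injection \<open>g\<close>.\<close>

definition compile :: "nat \<Rightarrow> nat \<Rightarrow> ('a cell \<Rightarrow> bool) \<Rightarrow> 'a com \<Rightarrow> ('a control \<Rightarrow> nat) \<Rightarrow> 'a tm" where
  "compile K i0 P0 c g =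
     \<lparr>tapes = K, states = g ` controls c, alphabet = symbols c \<union> {Blank} \<union> range Input,
      start = g (Inl [c]), accept = g (Inr True), reject = g (Inr False),
      trans = (\<lambda>q xs. let (q', as) = next_control i0 P0 (inv_into (controls c) g q) xs in (g q', as))\<rparr>"

locale compiled =
  fixes K i0 :: nat and P0 :: "'a::finite cell \<Rightarrow> bool" and c :: "'a com" and g :: "'a control \<Rightarrow> nat"
  assumes K: "tape_bound c \<le> K" "i0 < K"
    and inj: "inj_on g (controls c)"
begin

abbreviation "M \<equiv> compile K i0 P0 c g"

lemma in_controls: "Inl [] \<in> controls c" "Inr b \<in> controls c" "Inl [c] \<in> controls c"
  by (auto simp: controls_def conts_self)

lemma wf_tm_compile: "wf_tm M"
  unfolding wf_tm_def
proof (intro conjI ballI allI impI)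
  show "1 \<le> tapes M" using K(2) by (simp add: compile_def)
  show "finite (states M)" by (simp add: compile_def finite_controls)
  show "{start M, accept M, reject M} \<subseteq> states M" using in_controls by (auto simp: compile_def)
  show "accept M \<noteq> reject M" using inj_onD[OF inj, of "Inr True" "Inr False"] in_controls
    by (auto simp: compile_def)
  show "finite (alphabet M)" by (simp add: compile_def finite_symbols)
  show "Blank \<in> alphabet M" "range Input \<subseteq> alphabet M" by (auto simp: compile_def)
next
  fix q xs assume q: "q \<in> states M - {accept M, reject M}" and xs: "length xs = tapes M \<and> set xs \<subseteq> alphabet M"
  from q have q': "inv_into (controls c) g q \<in> controls c"
    by (auto simp: compile_def inv_into_into)
  have sub: "symbols c \<subseteq> alphabet M" by (auto simp: compile_def)
  have xs': "length xs = K" "set xs \<subseteq> alphabet M" using xs by (auto simp: compile_def)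
  show "fst (trans M q xs) \<in> states M"
    using next_control_closed[OF q', of i0 P0 xs] by (simp add: compile_def case_prod_beta)
  show "length (snd (trans M q xs)) = tapes M" "fst ` set (snd (trans M q xs)) \<subseteq> alphabet M"
    using next_control_actions[OF q' xs'(1) K(1) sub xs'(2), of i0 P0]
    by (simp_all add: compile_def case_prod_beta)
qed

definition tape_list :: "(nat \<Rightarrow> 'a tape) \<Rightarrow> 'a tape list" where
  "tape_list \<sigma> = map \<sigma> [0..<K]"

lemma act_idle: "act_tape (read_tape tp, Stay) tp = tp"
  by (cases tp) simp

lemma map2_idle: "map2 act_tape (idle (map read_tape ts)) ts = ts"
  by (rule nth_equalityI) (auto simp: idle_def act_idle)

lemma map2_idle_update:
  assumes "i < K"
  shows "map2 act_tape ((idle (map read_tape (tape_list \<sigma>)))[i := a]) (tape_list \<sigma>) =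
    tape_list (\<sigma>(i := act_tape a (\<sigma> i)))"
  using assms by (intro nth_equalityI) (auto simp: idle_def act_idle tape_list_def nth_list_update)

lemma nth_read: "i < K \<Longrightarrow> map read_tape (tape_list \<sigma>) ! i = read_tape (\<sigma> i)"
  by (simp add: tape_list_def)

lemma step_compile:
  assumes "Inl l \<in> controls c"
  shows "step M (g (Inl l), ts) = (let (q', as) = next_control i0 P0 (Inl l) (map read_tape ts)
     in (g q', map2 act_tape as ts))"
proof -
  have "g (Inl l) \<notin> {g (Inr True), g (Inr False)}"
    using inj_onD[OF inj, of "Inl l"] assms in_controls by blast
  then show ?thesis using assms inj by (simp add: compile_def case_prod_beta Let_def)
qed

declare step.simps [simp del]

text \<open>The simulation: a run of \<open>a\<close> in \<open>t\<close> steps is followed by the machine in exactly \<open>t\<close> steps, for any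
continuation \<open>k\<close>, because the transitions look only at the head of the list.\<close>

lemma run_step:
  assumes "run a \<sigma> t \<sigma>'" "Inl ` conts a k \<subseteq> controls c" "Inl k \<in> controls c" "tape_bound a \<le> K"
  shows "(step M ^^ t) (g (Inl (a # k)), tape_list \<sigma>) = (g (Inl k), tape_list \<sigma>')"
  using assms
proof (induction arbitrary: k rule: run.induct)
  case (Mv i d \<sigma>)
  have "Inl (com.Mv i d # k) \<in> controls c" using Mv by auto
  then show ?case using Mv by (simp add: step_compile map2_idle_update nth_read fun_upd_def)
next
  case (Wr i x \<sigma>)
  have "Inl (com.Wr i x # k) \<in> controls c" using Wr by auto
  then show ?case using Wr by (simp add: step_compile map2_idle_update fun_upd_def)
next
  case (Seq a \<sigma> t \<sigma>' b u \<sigma>'')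
  have "Inl (com.Seq a b # k) \<in> controls c" using Seq.prems by auto
  then have 1: "step M (g (Inl (com.Seq a b # k)), tape_list \<sigma>) = (g (Inl (a # b # k)), tape_list \<sigma>)"
    by (simp add: step_compile map2_idle)
  have bk: "Inl (b # k) \<in> controls c" using Seq.prems conts_self[of b k] by auto
  have 2: "(step M ^^ t) (g (Inl (a # b # k)), tape_list \<sigma>) = (g (Inl (b # k)), tape_list \<sigma>')"
    using Seq.prems bk by (intro Seq.IH(1)) auto
  have 3: "(step M ^^ u) (g (Inl (b # k)), tape_list \<sigma>') = (g (Inl k), tape_list \<sigma>'')"
    using Seq.prems by (intro Seq.IH(2)) auto
  have "step M ^^ Suc (t + u) = (step M ^^ u) \<circ> (step M ^^ t) \<circ> step M"
    by (simp add: funpow_add funpow_swap1 add.commute[of t] fun_eq_iff)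
  then show ?case using 1 2 3 by simp
next
  case (IfT P \<sigma> i a t \<sigma>' b)
  have "Inl (com.If i P a b # k) \<in> controls c" using IfT.prems by auto
  then have 1: "step M (g (Inl (com.If i P a b # k)), tape_list \<sigma>) = (g (Inl (a # k)), tape_list \<sigma>)"
    using IfT by (simp add: step_compile map2_idle nth_read)
  have 2: "(step M ^^ t) (g (Inl (a # k)), tape_list \<sigma>) = (g (Inl k), tape_list \<sigma>')"
    using IfT.prems by (intro IfT.IH) auto
  show ?case using 1 2 by (simp add: funpow_swap1)
next
  case (IfF P \<sigma> i b t \<sigma>' a)
  have "Inl (com.If i P a b # k) \<in> controls c" using IfF.prems by auto
  then have 1: "step M (g (Inl (com.If i P a b # k)), tape_list \<sigma>) = (g (Inl (b # k)), tape_list \<sigma>)"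
    using IfF by (simp add: step_compile map2_idle nth_read)
  have 2: "(step M ^^ t) (g (Inl (b # k)), tape_list \<sigma>) = (g (Inl k), tape_list \<sigma>')"
    using IfF.prems by (intro IfF.IH) auto
  show ?case using 1 2 by (simp add: funpow_swap1)
next
  case (WhileF P \<sigma> i a)
  have "Inl (com.While i P a # k) \<in> controls c" using WhileF.prems by auto
  then show ?case using WhileF by (simp add: step_compile map2_idle nth_read)
next
  case (WhileT P \<sigma> i a t \<sigma>' u \<sigma>'')
  have w: "Inl (com.While i P a # k) \<in> controls c" using WhileT.prems by auto
  then have 1: "step M (g (Inl (com.While i P a # k)), tape_list \<sigma>) =
      (g (Inl (a # com.While i P a # k)), tape_list \<sigma>)"
    using WhileT by (simp add: step_compile map2_idle nth_read)
  have 2: "(step M ^^ t) (g (Inl (a # com.While i P a # k)), tape_list \<sigma>) =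
      (g (Inl (com.While i P a # k)), tape_list \<sigma>')"
    using WhileT.prems w by (intro WhileT.IH(1)) auto
  have 3: "(step M ^^ u) (g (Inl (com.While i P a # k)), tape_list \<sigma>') = (g (Inl k), tape_list \<sigma>'')"
    using WhileT.prems by (intro WhileT.IH(2)) auto
  have "step M ^^ Suc (t + u) = (step M ^^ u) \<circ> (step M ^^ t) \<circ> step M"
    by (simp add: funpow_add funpow_swap1 add.commute[of t] fun_eq_iff)
  then show ?case using 1 2 3 by simp
qed

lemma step_halted: "(step M ^^ t) (g (Inr b), ts) = (g (Inr b), ts)"
  proof (induction t)
  case (Suc t)
  have "g (Inr b) \<in> {accept M, reject M}" by (cases b) (auto simp: compile_def)
  then show ?case using Suc by (simp add: step.simps)
qed simp

lemma run_verdict: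
  assumes "run c \<sigma> t \<sigma>'" "Suc t \<le> T"
  shows "fst ((step M ^^ T) (g (Inl [c]), tape_list \<sigma>)) =
    (if P0 (read_tape (\<sigma>' i0)) then accept M else reject M)"
proof -
  have "(step M ^^ t) (g (Inl [c]), tape_list \<sigma>) = (g (Inl []), tape_list \<sigma>')"
    using assms K in_controls by (intro run_step) (auto simp: controls_def)
  then have "(step M ^^ Suc t) (g (Inl [c]), tape_list \<sigma>) = (g (Inr (P0 (read_tape (\<sigma>' i0)))), tape_list \<sigma>')"
    using in_controls K by (simp add: step_compile map2_idle nth_read)
  moreover have "step M ^^ T = (step M ^^ (T - Suc t)) \<circ> (step M ^^ Suc t)"
    using assms(2) by (metis funpow_add le_add_diff_inverse2)
  ultimately have "(step M ^^ T) (g (Inl [c]), tape_list \<sigma>) = (g (Inr (P0 (read_tape (\<sigma>' i0)))), tape_list \<sigma>')"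
    by (simp only: o_apply step_halted)
  then show ?thesis by (simp add: compile_def)
qed

lemma init_config_compile:
  "init_config M w = (g (Inl [c]), tape_list (\<lambda>i. if i = 0 then input_tape w else blank_tape))"
proof -
  have "input_tape w # replicate (K - 1) blank_tape =
      tape_list (\<lambda>i. if i = 0 then input_tape w else blank_tape)"
    using K(2) by (intro nth_equalityI) (auto simp: tape_list_def nth_Cons split: nat.splits)
  then show ?thesis by (simp add: init_config_def compile_def)
qed

end

text \<open>The bridge from programs to machines. The strict inequality leaves room for the final step that turns
the symbol on tape \<open>i\<close> into a verdict.\<close>

theorem run_decides:
  fixes c :: "'a::finite com"
  assumes "\<And>w. \<exists>t \<sigma>. t < T (length w) \<and>
      run c (\<lambda>i. if i = 0 then input_tape w else blank_tape) t \<sigma> \<and> (P (read_tape (\<sigma> i)) \<longleftrightarrow> w \<in> L)"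
  shows "\<exists>M :: 'a tm. wf_tm M \<and> decides_in_time M L T"
proof -
  obtain g :: "'a control \<Rightarrow> nat" where g: "inj_on g (controls c)"
    using finite_imp_inj_to_nat_seg[OF finite_controls[of c]] by blast
  interpret compiled "max (tape_bound c) (Suc i)" i P c g
    by unfold_locales (use g in auto)
  have "decides_in_time M L T"
    unfolding decides_in_time_def
  proof
    fix w
    obtain t \<sigma> where t: "t < T (length w)" "P (read_tape (\<sigma> i)) \<longleftrightarrow> w \<in> L"
      and r: "run c (\<lambda>i. if i = 0 then input_tape w else blank_tape) t \<sigma>" using assms by blast
    have "Suc t \<le> T (length w)" using t by simp
    from run_verdict[OF r this] show "fst ((step M ^^ T (length w)) (init_config M w)) =
        (if w \<in> L then accept M else reject M)"
      unfolding init_config_compile using t(2) by simp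
  qed
  then show ?thesis using wf_tm_compile by blast
qed


section \<open>Tapes as unary counters and as bit arrays\<close>

text \<open>An upper bound on the number of steps suffices from here on.\<close>

definition runs :: "'a com \<Rightarrow> (nat \<Rightarrow> 'a tape) \<Rightarrow> nat \<Rightarrow> (nat \<Rightarrow> 'a tape) \<Rightarrow> bool" where
  "runs c \<sigma> T \<sigma>' \<longleftrightarrow> (\<exists>t\<le>T. run c \<sigma> t \<sigma>')"

lemma runs_mono: "runs c \<sigma> T \<sigma>' \<Longrightarrow> T \<le> U \<Longrightarrow> runs c \<sigma> U \<sigma>'"
  unfolding runs_def using le_trans by blast

lemma runs_Mv: "\<sigma> i = (f, h) \<Longrightarrow> runs (Mv i d) \<sigma> 1 (\<sigma>(i := (f, move_head d h)))"
  unfolding runs_def using run.Mv[of i d \<sigma>] by auto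

lemma runs_Wr: "\<sigma> i = (f, h) \<Longrightarrow> runs (Wr i x) \<sigma> 1 (\<sigma>(i := (f(h := x), h)))"
  unfolding runs_def using run.Wr[of i x \<sigma>] by auto

lemma runs_skip: "runs (Mv 0 Stay) \<sigma> 1 \<sigma>"
proof -
  obtain f h where s: "\<sigma> 0 = (f, h)" by fastforce
  then have "\<sigma>(0 := (f, h)) = \<sigma>" by auto
  with runs_Mv[of \<sigma> 0 f h Stay] s show ?thesis by simp
qed

lemma runs_Seq: "runs a \<sigma> T \<sigma>1 \<Longrightarrow> runs b \<sigma>1 U \<sigma>2 \<Longrightarrow> runs (Seq a b) \<sigma> (T + U + 1) \<sigma>2"
  unfolding runs_def by (elim exE conjE, rule exI, rule conjI[OF _ run.Seq]) auto

lemma runs_If: "runs (if P (read_tape (\<sigma> i)) then a else b) \<sigma> T \<sigma>' \<Longrightarrow> runs (If i P a b) \<sigma> (T + 1) \<sigma>'"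
  unfolding runs_def by (cases "P (read_tape (\<sigma> i))") (auto intro: run.IfT run.IfF)

text \<open>Loops are verified along an explicitly given trajectory \<open>\<sigma> 0, ..., \<sigma> n\<close> of tape contents.\<close>

lemma runs_While:
  assumes "\<And>j. j < n \<Longrightarrow> P (read_tape (\<sigma> j i))" "\<And>j. j < n \<Longrightarrow> runs a (\<sigma> j) T (\<sigma> (Suc j))"
    and "\<not> P (read_tape (\<sigma> n i))"
  shows "runs (While i P a) (\<sigma> 0) (n * (T + 1) + 1) (\<sigma> n)"
proof -
  have "runs (While i P a) (\<sigma> j) ((n - j) * (T + 1) + 1) (\<sigma> n)" if "j \<le> n" for j
    using that
  proof (induction rule: inc_induct)
    case base
    show ?case using run.WhileF[of P "\<sigma> n" i a] assms(3) by (auto simp: runs_def)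
  next
    case (step j)
    obtain t u where "t \<le> T" "run a (\<sigma> j) t (\<sigma> (Suc j))"
      "u \<le> (n - Suc j) * (T + 1) + 1" "run (While i P a) (\<sigma> (Suc j)) u (\<sigma> n)"
      using assms(2)[OF step(2)] step(3) unfolding runs_def by blast
    moreover have "(n - j) * (T + 1) = (n - Suc j) * (T + 1) + (T + 1)"
      using step(2) by (metis Suc_diff_Suc add.commute mult_Suc)
    ultimately show ?case using run.WhileT[of P "\<sigma> j" i a t, OF assms(1)[OF step(2)]] unfolding runs_def
      by (intro exI[of _ "Suc (t + u)"]) auto
  qed
  from this[of 0] show ?thesis by simp
qed

text \<open>A counter is a blank tape with a marker on cell 0; its value is the position of its head, so that
counting is moving and testing for zero is reading. A finite set is stored as the characteristic
sequence of its elements, with the head resting on cell 0. In particular the empty set is a blank tape.\<close>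

definition numtape :: "nat \<Rightarrow> 'a tape" where
  "numtape v = ((\<lambda>_. Blank)(0 := Work 0), int v)"

definition settape :: "nat set \<Rightarrow> 'a tape" where
  "settape A = ((\<lambda>j. if 0 \<le> j \<and> nat j \<in> A then Work 1 else Blank), 0)"

abbreviation (input) positive :: "'a cell \<Rightarrow> bool" where
  "positive x \<equiv> x \<noteq> Work 0"

lemma read_numtape: "read_tape (numtape v) \<noteq> Work 0 \<longleftrightarrow> v > 0"
  by (auto simp: numtape_def)

lemma runs_inc: "\<sigma> i = numtape v \<Longrightarrow> runs (Mv i MoveRight) \<sigma> 1 (\<sigma>(i := numtape (Suc v)))"
  using runs_Mv[of \<sigma> i _ _ MoveRight] by (fastforce simp: numtape_def add.commute)

lemma runs_dec: "\<sigma> i = numtape (Suc v) \<Longrightarrow> runs (Mv i MoveLeft) \<sigma> 1 (\<sigma>(i := numtape v))"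
  using runs_Mv[of \<sigma> i _ _ MoveLeft] by (fastforce simp: numtape_def)

definition countdown :: "nat \<Rightarrow> 'a com \<Rightarrow> 'a com" where
  "countdown i a = While i positive (Seq (Mv i MoveLeft) a)"

lemma runs_countdown:
  assumes "\<And>j. j \<le> n \<Longrightarrow> \<sigma> j i = numtape (n - j)"
    and "\<And>j. j < n \<Longrightarrow> runs a ((\<sigma> j)(i := numtape (n - Suc j))) T (\<sigma> (Suc j))"
  shows "runs (countdown i a) (\<sigma> 0) (n * (T + 3) + 1) (\<sigma> n)"
proof -
  have "runs (While i positive (Seq (Mv i MoveLeft) a)) (\<sigma> 0) (n * ((1 + T + 1) + 1) + 1) (\<sigma> n)"
  proof (rule runs_While)
    fix j assume "j < n"
    then have *: "\<sigma> j i = numtape (Suc (n - Suc j))" using assms(1)[of j] by (simp add: Suc_diff_Suc)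
    show "positive (read_tape (\<sigma> j i))" unfolding * read_numtape by simp
    show "runs (Seq (Mv i MoveLeft) a) (\<sigma> j) (1 + T + 1) (\<sigma> (Suc j))"
      by (rule runs_Seq[OF runs_dec[of "\<sigma> j" i, OF *] assms(2)[OF \<open>j < n\<close>]])
  next
    show "\<not> positive (read_tape (\<sigma> n i))" using assms(1)[of n] read_numtape[of 0] by simp
  qed
  then show ?thesis unfolding countdown_def by (rule runs_mono) (simp add: algebra_simps)
qed

lemma runs_clear:
  assumes "\<sigma> i = numtape v"
  shows "runs (countdown i (Mv 0 Stay)) \<sigma> (4 * v + 1) (\<sigma>(i := numtape 0))"
proof -
  have "runs (countdown i (Mv 0 Stay)) (\<sigma>(i := numtape (v - 0))) (v * (1 + 3) + 1) (\<sigma>(i := numtape (v - v)))"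
    by (rule runs_countdown[where \<sigma> = "\<lambda>j. \<sigma>(i := numtape (v - j))"]) (use runs_skip in auto)
  then show ?thesis using assms by (simp add: mult.commute fun_upd_idem)
qed

lemma runs_move:
  assumes "\<sigma> i = numtape v" "\<sigma> d = numtape u" "i \<noteq> d"
  shows "runs (countdown i (Mv d MoveRight)) \<sigma> (4 * v + 1) (\<sigma>(i := numtape 0, d := numtape (u + v)))"
proof -
  let ?s = "\<lambda>j. \<sigma>(i := numtape (v - j), d := numtape (u + j))"
  have "runs (countdown i (Mv d MoveRight)) (?s 0) (v * (1 + 3) + 1) (?s v)"
  proof (rule runs_countdown)
    fix j assume "j < v"
    have "runs (Mv d MoveRight) ((?s j)(i := numtape (v - Suc j))) 1
        ((?s j)(i := numtape (v - Suc j), d := numtape (Suc (u + j))))"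
      by (rule runs_inc) (use assms in auto)
    then show "runs (Mv d MoveRight) ((?s j)(i := numtape (v - Suc j))) 1 (?s (Suc j))"
      using assms(3) by (simp add: fun_upd_twist)
  qed (use assms in auto)
  then show ?thesis using assms by (simp add: mult.commute fun_upd_idem)
qed

lemma runs_transfer:
  assumes "\<sigma> i = numtape v" "\<sigma> e = numtape u" "\<sigma> q = (f, h)" "i \<noteq> e" "i \<noteq> q" "e \<noteq> q"
    and "\<And>k. move_head m k = k + \<delta>"
  shows "runs (countdown i (Seq (Mv q m) (Mv e MoveRight))) \<sigma> (6 * v + 1)
    (\<sigma>(i := numtape 0, e := numtape (u + v), q := (f, h + \<delta> * int v)))"
proof -
  let ?s = "\<lambda>j. \<sigma>(i := numtape (v - j), e := numtape (u + j), q := (f, h + \<delta> * int j))"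
  have "runs (countdown i (Seq (Mv q m) (Mv e MoveRight))) (?s 0) (v * ((1 + 1 + 1) + 3) + 1) (?s v)"
  proof (rule runs_countdown)
    fix j assume "j < v"
    let ?a = "(?s j)(i := numtape (v - Suc j))"
    let ?b = "?a(q := (f, h + \<delta> * int j + \<delta>))"
    have "runs (Mv q m) ?a 1 (?a(q := (f, move_head m (h + \<delta> * int j))))"
      by (rule runs_Mv) (use assms in auto)
    then have 1: "runs (Mv q m) ?a 1 ?b" by (simp add: assms)
    have 2: "runs (Mv e MoveRight) ?b 1 (?b(e := numtape (Suc (u + j))))"
      by (rule runs_inc) (use assms in auto)
    have "?b(e := numtape (Suc (u + j))) = ?s (Suc j)"
      using assms by (auto simp: fun_eq_iff algebra_simps)
    with runs_Seq[OF 1 2] show "runs (Seq (Mv q m) (Mv e MoveRight)) ?a (1 + 1 + 1) (?s (Suc j))" by simp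
  qed (use assms in auto)
  moreover have "?s 0 = \<sigma>" using assms by (auto simp: fun_eq_iff)
  ultimately show ?thesis by (simp add: mult.commute)
qed

definition seek :: "nat \<Rightarrow> nat \<Rightarrow> nat \<Rightarrow> 'a com" where
  "seek q i e = countdown i (Seq (Mv q MoveRight) (Mv e MoveRight))"

definition rewind :: "nat \<Rightarrow> nat \<Rightarrow> nat \<Rightarrow> 'a com" where
  "rewind q i e = countdown e (Seq (Mv q MoveLeft) (Mv i MoveRight))"

text \<open>An array tape has no marker, so it cannot tell where its head is. To visit the cell whose index is
the value of counter \<open>i\<close>, the head of \<open>q\<close> moves along while \<open>i\<close> is counted down and \<open>e\<close> is counted up,
and the counter \<open>e\<close> afterwards leads it back.\<close>

definition at_index :: "nat \<Rightarrow> nat \<Rightarrow> nat \<Rightarrow> 'a com \<Rightarrow> 'a com" where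
  "at_index q i e a = Seq (seek q i e) (Seq a (rewind q i e))"

lemma runs_at_index:
  assumes "\<sigma> i = numtape v" "\<sigma> e = numtape 0" "\<sigma> q = (f, 0)" "i \<noteq> e" "i \<noteq> q" "e \<noteq> q"
    and "runs a (\<sigma>(i := numtape 0, e := numtape v, q := (f, int v))) T
           (\<sigma>'(i := numtape 0, e := numtape v, q := (g, int v)))"
  shows "runs (at_index q i e a) \<sigma> (12 * v + T + 4)
           (\<sigma>'(i := numtape v, e := numtape 0, q := (g, 0)))"
proof -
  have 1: "runs (seek q i e) \<sigma> (6 * v + 1) (\<sigma>(i := numtape 0, e := numtape v, q := (f, int v)))"
    unfolding seek_def using runs_transfer[OF assms(1-6), of MoveRight 1] by simp
  have 2: "runs (rewind q i e) (\<sigma>'(i := numtape 0, e := numtape v, q := (g, int v))) (6 * v + 1)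
      (\<sigma>'(i := numtape v, e := numtape 0, q := (g, 0)))"
  proof -
    let ?t = "\<sigma>'(i := numtape 0, e := numtape v, q := (g, int v))"
    have "runs (rewind q i e) ?t (6 * v + 1) (?t(e := numtape 0, i := numtape (0 + v), q := (g, int v + (-1) * int v)))"
      unfolding rewind_def by (rule runs_transfer) (use assms in auto)
    moreover have "?t(e := numtape 0, i := numtape (0 + v), q := (g, int v + (-1) * int v)) =
        \<sigma>'(i := numtape v, e := numtape 0, q := (g, 0))" using assms by (auto simp: fun_eq_iff)
    ultimately show ?thesis by simp
  qed
  from runs_Seq[OF 1 runs_Seq[OF assms(7) 2]] show ?thesis
    unfolding at_index_def by (rule runs_mono) simp
qed

definition test_at :: "nat \<Rightarrow> nat \<Rightarrow> nat \<Rightarrow> ('a cell \<Rightarrow> bool) \<Rightarrow> nat \<Rightarrow> 'a com" where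
  "test_at q i e P d = at_index q i e (If q P (Mv d MoveRight) (Mv 0 Stay))"

lemma runs_test_at:
  assumes "\<sigma> i = numtape v" "\<sigma> e = numtape 0" "\<sigma> q = (f, 0)" "\<sigma> d = numtape 0"
    and "distinct [i, e, q, d]"
  shows "runs (test_at q i e P d) \<sigma> (12 * v + 6) (\<sigma>(d := numtape (of_bool (P (f (int v))))))"
proof -
  let ?a = "\<sigma>(i := numtape 0, e := numtape v, q := (f, int v))"
  let ?x = "numtape (of_bool (P (f (int v))))"
  have "runs (if P (f (int v)) then Mv d MoveRight else Mv 0 Stay) ?a 1 (?a(d := ?x))"
  proof (cases "P (f (int v))")
    case True
    have "runs (Mv d MoveRight) ?a 1 (?a(d := numtape (Suc 0)))" by (rule runs_inc) (use assms in auto)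
    with True show ?thesis by simp
  next
    case False
    have "?a(d := numtape 0) = ?a" using assms by (auto simp: fun_eq_iff)
    with False show ?thesis using runs_skip[of ?a] by simp
  qed
  then have "runs (If q P (Mv d MoveRight) (Mv 0 Stay)) ?a (1 + 1) (?a(d := ?x))"
    using runs_If[of P ?a q "Mv d MoveRight" "Mv 0 Stay" 1] by simp
  moreover have "?a(d := ?x) = (\<sigma>(d := ?x))(i := numtape 0, e := numtape v, q := (f, int v))"
    using assms(5) by (auto simp: fun_eq_iff)
  ultimately have "runs (If q P (Mv d MoveRight) (Mv 0 Stay)) ?a 2
      ((\<sigma>(d := ?x))(i := numtape 0, e := numtape v, q := (f, int v)))"
    by (simp only: one_add_one)
  then have "runs (test_at q i e P d) \<sigma> (12 * v + 2 + 4)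
      ((\<sigma>(d := ?x))(i := numtape v, e := numtape 0, q := (f, 0)))"
    unfolding test_at_def using assms by (intro runs_at_index) auto
  moreover have "(\<sigma>(d := ?x))(i := numtape v, e := numtape 0, q := (f, 0)) = \<sigma>(d := ?x)"
    using assms by (auto simp: fun_eq_iff)
  ultimately have "runs (test_at q i e P d) \<sigma> (12 * v + 2 + 4) (\<sigma>(d := ?x))"
    by (simp only:)
  then show ?thesis by (rule runs_mono) simp
qed

definition write_at :: "nat \<Rightarrow> nat \<Rightarrow> nat \<Rightarrow> 'a cell \<Rightarrow> 'a com" where
  "write_at q i e x = at_index q i e (Wr q x)"

lemma runs_write_at:
  assumes "\<sigma> i = numtape v" "\<sigma> e = numtape 0" "\<sigma> q = (f, 0)" "distinct [i, e, q]"
  shows "runs (write_at q i e x) \<sigma> (12 * v + 5) (\<sigma>(q := (f(int v := x), 0)))"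
proof -
  let ?a = "\<sigma>(i := numtape 0, e := numtape v, q := (f, int v))"
  have "runs (Wr q x) ?a 1 (?a(q := (f(int v := x), int v)))"
    by (rule runs_Wr) (use assms in auto)
  then have "runs (Wr q x) ?a 1 (\<sigma>(i := numtape 0, e := numtape v, q := (f(int v := x), int v)))"
    by simp
  then have "runs (write_at q i e x) \<sigma> (12 * v + 1 + 4) (\<sigma>(i := numtape v, e := numtape 0, q := (f(int v := x), 0)))"
    unfolding write_at_def using assms by (intro runs_at_index) auto
  moreover have "\<sigma>(i := numtape v, e := numtape 0, q := (f(int v := x), 0)) = \<sigma>(q := (f(int v := x), 0))"
    using assms by (auto simp: fun_eq_iff)
  ultimately have "runs (write_at q i e x) \<sigma> (12 * v + 1 + 4) (\<sigma>(q := (f(int v := x), 0)))"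
    by (simp only:)
  then show ?thesis by (rule runs_mono) simp
qed

lemma settape_insert: "settape (insert y A) = ((fst (settape A))(int y := Work 1), 0)"
  by (auto simp: settape_def fun_eq_iff)

lemma settape_remove: "settape (A - {y}) = ((fst (settape A))(int y := Blank), 0)"
  by (auto simp: settape_def fun_eq_iff)

section \<open>Quasipolynomial bounds\<close>

text \<open>The argument \<open>r\<close> stands for the binary length of the quantities in question, so that these are
functions of \<open>2 ^ r\<close> with quasipolynomial growth.\<close>

definition quasi :: "(nat \<Rightarrow> nat) \<Rightarrow> bool" where
  "quasi B \<longleftrightarrow> (\<exists>e. \<forall>r\<ge>2. B r \<le> 2 ^ (r ^ e))"

lemma quasi_mono: "quasi B \<Longrightarrow> (\<And>r. r \<ge> 2 \<Longrightarrow> A r \<le> B r) \<Longrightarrow> quasi A"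
  unfolding quasi_def using le_trans by blast

text \<open>Exponents can be taken positive, so that \<open>r ^ Suc e\<close> is again at least 2 and may serve as the
argument of another bound.\<close>

lemma quasi_Suc: assumes "quasi B" shows "\<exists>e. \<forall>r\<ge>2. B r \<le> 2 ^ (r ^ Suc e)"
proof -
  obtain e where "\<forall>r\<ge>2. B r \<le> 2 ^ (r ^ e)" using assms unfolding quasi_def by blast
  moreover have "(2::nat) ^ (r ^ e) \<le> 2 ^ (r ^ Suc e)" if "r \<ge> 2" for r :: nat
    using that by (intro power_increasing) auto
  ultimately show ?thesis using le_trans by blast
qed

lemma quasi_pow: "quasi (\<lambda>r. 2 ^ (r ^ e))"
  unfolding quasi_def by blast

lemma quasi_exp: "quasi (\<lambda>r. 2 ^ r)"
  using quasi_pow[of 1] by simp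

text \<open>Closure under composition: a number up to \<open>2 ^ (r ^ Suc e)\<close> has binary length about \<open>r ^ Suc e\<close>, and a power
of a power is a power.\<close>

lemma quasi_comp: assumes "quasi B" shows "quasi (\<lambda>r. B (r ^ Suc e))"
proof -
  obtain a where a: "\<forall>r\<ge>2. B r \<le> 2 ^ (r ^ a)" using assms unfolding quasi_def by blast
  have "B (r ^ Suc e) \<le> 2 ^ (r ^ (Suc e * a))" if "r \<ge> 2" for r
  proof -
    have "r ^ 1 \<le> r ^ Suc e" using that by (intro power_increasing) auto
    then have "2 \<le> r ^ Suc e" using that by (simp only: power_one_right)
    then show ?thesis using a by (metis power_mult)
  qed
  then show ?thesis unfolding quasi_def by blast
qed

lemma quasi_mult: assumes "quasi A" "quasi B" shows "quasi (\<lambda>r. A r * B r)"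
proof -
  obtain a b where ab: "\<forall>r\<ge>2. A r \<le> 2 ^ (r ^ a)" "\<forall>r\<ge>2. B r \<le> 2 ^ (r ^ b)"
    using assms unfolding quasi_def by blast
  have "A r * B r \<le> 2 ^ (r ^ Suc (max a b))" if "r \<ge> 2" for r
  proof -
    have "r ^ a \<le> r ^ max a b" "r ^ b \<le> r ^ max a b" using that by (auto intro: power_increasing)
    moreover have "2 * r ^ max a b \<le> r ^ Suc (max a b)" using that by simp
    ultimately have "r ^ a + r ^ b \<le> r ^ Suc (max a b)" by linarith
    then have "(2::nat) ^ (r ^ a + r ^ b) \<le> 2 ^ (r ^ Suc (max a b))" by (rule power_increasing) simp
    moreover have "A r * B r \<le> 2 ^ (r ^ a) * 2 ^ (r ^ b)" using ab that by (intro mult_le_mono) auto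
    ultimately show ?thesis by (simp add: power_add)
  qed
  then show ?thesis unfolding quasi_def by blast
qed

lemma quasi_const: "quasi (\<lambda>r. k)"
proof -
  have "k \<le> 2 ^ (r ^ k)" if "r \<ge> 2" for r
  proof -
    have "k < 2 ^ k" by (rule less_exp)
    also have "2 ^ k \<le> r ^ k" using that by (rule power_mono) simp
    also have "r ^ k < 2 ^ (r ^ k)" by (rule less_exp)
    finally show ?thesis by simp
  qed
  then show ?thesis unfolding quasi_def by blast
qed

lemma quasi_add: assumes "quasi A" "quasi B" shows "quasi (\<lambda>r. A r + B r)"
proof -
  have "quasi (\<lambda>r. (A r + 1) * (B r + 1))" if "quasi (\<lambda>r. A r + 1)" "quasi (\<lambda>r. B r + 1)"
    using quasi_mult[OF that] .
  moreover have S: "quasi (\<lambda>r. C r + 1)" if C: "quasi C" for C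
  proof -
    obtain a where a: "\<forall>r\<ge>2. C r \<le> 2 ^ (r ^ a)" using C unfolding quasi_def by blast
    have "C r + 1 \<le> 2 * 2 ^ (r ^ a)" if "r \<ge> 2" for r
      using a that one_le_power[of "2::nat" "r ^ a"] by (metis add_mono mult_2 one_le_numeral)
    then show ?thesis by (rule quasi_mono[OF quasi_mult[OF quasi_const quasi_pow]])
  qed
  ultimately have "quasi (\<lambda>r. (A r + 1) * (B r + 1))" using assms by blast
  then show ?thesis by (rule quasi_mono) auto
qed

lemmas quasi_intros = quasi_add quasi_mult quasi_const quasi_exp


section \<open>Feasible functions\<close>

text \<open>The abstract view of the tapes: the input word, the values of the counters, and the sets stored in
the arrays.\<close>

record store =
  inp :: "letter list"
  var :: "nat \<Rightarrow> nat"
  arr :: "nat \<Rightarrow> nat set"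

definition setv :: "nat \<Rightarrow> nat \<Rightarrow> store \<Rightarrow> store" where
  "setv i x s = s\<lparr>var := (var s)(i := x)\<rparr>"

definition seta :: "nat \<Rightarrow> nat set \<Rightarrow> store \<Rightarrow> store" where
  "seta i A s = s\<lparr>arr := (arr s)(i := A)\<rparr>"

lemma set_simps [simp]:
  "inp (setv i x s) = inp s" "var (setv i x s) = (var s)(i := x)" "arr (setv i x s) = arr s"
  "inp (seta i A s) = inp s" "var (seta i A s) = var s" "arr (seta i A s) = (arr s)(i := A)"
  by (simp_all add: setv_def seta_def)

lemma store_eqI: "inp s = inp t \<Longrightarrow> var s = var t \<Longrightarrow> arr s = arr t \<Longrightarrow> s = (t :: store)"
  by (cases s; cases t) simp

lemma setv_setv [simp]: "setv i x (setv i y s) = setv i x s"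
  by (rule store_eqI) auto

text \<open>Tape 0 holds the input; counters and arrays occupy the odd and the positive even tapes.\<close>

definition vtape :: "nat \<Rightarrow> nat" where "vtape i = 2 * i + 1"
definition atape :: "nat \<Rightarrow> nat" where "atape i = 2 * i + 2"

lemma tape_indices [simp]: "vtape i = vtape j \<longleftrightarrow> i = j" "atape i = atape j \<longleftrightarrow> i = j" "vtape i \<noteq> atape j" "atape j \<noteq> vtape i"
    "vtape i \<noteq> 0" "0 < vtape i" "atape i \<noteq> 0" "0 < atape i"
  by (auto simp: vtape_def atape_def) presburger+

definition layout :: "store \<Rightarrow> nat \<Rightarrow> letter tape" where
  "layout s k = (if k = 0 then input_tape (inp s) else if odd k then numtape (var s (k div 2))
     else settape (arr s (k div 2 - 1)))"

lemma layout_simps [simp]: "layout s 0 = input_tape (inp s)" "layout s (vtape i) = numtape (var s i)"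
    "layout s (atape i) = settape (arr s i)"
  by (simp_all add: layout_def vtape_def atape_def)

lemma layout_setv: "(layout s)(vtape i := numtape x) = layout (setv i x s)"
  by (auto simp: fun_eq_iff layout_def vtape_def)

lemma layout_seta: "(layout s)(atape i := settape A) = layout (seta i A s)"
proof
  fix k
  show "((layout s)(atape i := settape A)) k = layout (seta i A s) k"
  proof (cases "k = 0 \<or> odd k \<or> k = atape i")
    case True then show ?thesis by (auto simp: layout_def atape_def)
  next
    case False
    then have "k div 2 - 1 \<noteq> i" by (auto simp: atape_def elim!: evenE)
    with False show ?thesis by (simp add: layout_def)
  qed
qed

lemma runs_clear_var: "runs (countdown (vtape i) (Mv 0 Stay)) (layout s) (4 * var s i + 1) (layout (setv i 0 s))"
  using runs_clear[of "layout s" "vtape i" "var s i"] by (simp add: layout_setv)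

lemma runs_inc_var: "runs (Mv (vtape i) MoveRight) (layout s) 1 (layout (setv i (Suc (var s i)) s))"
  using runs_inc[of "layout s" "vtape i" "var s i"] by (simp add: layout_setv)

lemma runs_dec_var: "var s i = Suc x \<Longrightarrow> runs (Mv (vtape i) MoveLeft) (layout s) 1 (layout (setv i x s))"
  using runs_dec[of "layout s" "vtape i" x] by (simp add: layout_setv)

lemma runs_move_var: "i \<noteq> d \<Longrightarrow> runs (countdown (vtape i) (Mv (vtape d) MoveRight)) (layout s) (4 * var s i + 1)
    (layout (setv d (var s d + var s i) (setv i 0 s)))"
  using runs_move[of "layout s" "vtape i" "var s i" "vtape d" "var s d"] by (simp add: layout_setv)

text \<open>The variables with index below \<open>d\<close> are in use and have binary length at most \<open>r\<close>; those from \<open>d\<close> on are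
free and cleared. Variables are thus allocated like a stack.\<close>

definition ok :: "nat \<Rightarrow> nat \<Rightarrow> store \<Rightarrow> bool" where
  "ok r d s \<longleftrightarrow> 2 \<le> r \<and> length (inp s) \<le> 2 ^ r \<and> (\<forall>i<d. var s i \<le> 2 ^ r) \<and>
     (\<forall>i\<ge>d. var s i = 0 \<and> arr s i = {})"

definition restrict :: "nat \<Rightarrow> store \<Rightarrow> store" where
  "restrict m s = s\<lparr>var := (\<lambda>i. if i < m then var s i else 0), arr := (\<lambda>i. if i < m then arr s i else {})\<rparr>"

lemma restrict_simps [simp]:
  "inp (restrict m s) = inp s" "i < m \<Longrightarrow> var (restrict m s) i = var s i" "i < m \<Longrightarrow> arr (restrict m s) i = arr s i"
  "m \<le> i \<Longrightarrow> restrict m (setv i x s) = restrict m s" "m \<le> i \<Longrightarrow> restrict m (seta i A s) = restrict m s"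
  "m \<le> d \<Longrightarrow> restrict m (restrict d s) = restrict m s"
  by (auto simp: restrict_def fun_eq_iff intro!: store_eqI)

lemma ok_restrict: "ok r d s \<Longrightarrow> m \<le> d \<Longrightarrow> ok r m (restrict m s)"
  by (auto simp: ok_def restrict_def)

definition depends :: "nat \<Rightarrow> (store \<Rightarrow> 'b) \<Rightarrow> bool" where
  "depends m f \<longleftrightarrow> (\<forall>s. f (restrict m s) = f s)"

lemma dependsD: "depends m f \<Longrightarrow> restrict m s = restrict m s' \<Longrightarrow> f s = f s'"
  unfolding depends_def by metis

lemma depends_mono: assumes "depends m f" "m \<le> d" shows "depends d f"
  unfolding depends_def using dependsD[OF assms(1)] assms(2) by (metis restrict_simps(6))

text \<open>The program has to work for every stack height \<open>d \<ge> m\<close>, leaving its result in variable \<open>d\<close> and everything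
else as it was. Programs for subterms can then be run with further variables already in use, without
relocating code. The dependence condition says that \<open>f\<close> is a function of the input and the variables
below \<open>m\<close> only.\<close>

definition feasible :: "nat \<Rightarrow> (store \<Rightarrow> nat) \<Rightarrow> bool" where
  "feasible m f \<longleftrightarrow> depends m f \<and> (\<forall>d\<ge>m. \<exists>c B. quasi B \<and>
     (\<forall>r s. ok r d s \<longrightarrow> f s \<le> B r \<and> runs c (layout s) (B r) (layout (setv d (f s) s))))"

text \<open>Recursion requires a bound on the intermediate values, but nothing about how that bound is computed.\<close>

definition qbounded :: "nat \<Rightarrow> (store \<Rightarrow> nat) \<Rightarrow> bool" where
  "qbounded m f \<longleftrightarrow> (\<exists>B. quasi B \<and> (\<forall>r s. ok r m (restrict m s) \<longrightarrow> f s \<le> B r))"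

lemma feasible_dep: "feasible m f \<Longrightarrow> depends m f"
  by (simp add: feasible_def)

lemma feasible_restrict: "feasible m f \<Longrightarrow> m \<le> d \<Longrightarrow> f (restrict d s) = f s"
  using depends_mono[OF feasible_dep] by (auto simp: depends_def)

lemma feasible_mono: "feasible m f \<Longrightarrow> m \<le> d \<Longrightarrow> feasible d f"
  using depends_mono by (fastforce simp: feasible_def)

lemma feasible_cmd:
  assumes "feasible m f" "m \<le> d"
  obtains c B where "quasi B" "\<And>r s. ok r d s \<Longrightarrow> f s \<le> B r"
    "\<And>r s. ok r d s \<Longrightarrow> runs c (layout s) (B r) (layout (setv d (f s) s))"
  using assms unfolding feasible_def by blast

lemma qbounded_obtain:
  assumes "qbounded m f"
  obtains B where "quasi B" "\<And>r d s. ok r d s \<Longrightarrow> m \<le> d \<Longrightarrow> f s \<le> B r"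
  using assms ok_restrict unfolding qbounded_def by blast

lemma qbounded_comp: assumes "feasible m f" shows "qbounded m f"
proof -
  obtain c B where B: "quasi B" "\<And>r s. ok r m s \<Longrightarrow> f s \<le> B r" using feasible_cmd[OF assms order_refl] by metis
  have "f s \<le> B r" if "ok r m (restrict m s)" for r s
    using B(2)[OF that] feasible_restrict[OF assms order_refl] by simp
  with B(1) show ?thesis unfolding qbounded_def by blast
qed

lemma qbounded_add: "qbounded m f \<Longrightarrow> qbounded m g \<Longrightarrow> qbounded m (\<lambda>s. f s + g s)"
  unfolding qbounded_def using quasi_add by (fast intro: add_mono)

lemma qbounded_mult: "qbounded m f \<Longrightarrow> qbounded m g \<Longrightarrow> qbounded m (\<lambda>s. f s * g s)"
  unfolding qbounded_def using quasi_mult by (fast intro: mult_le_mono)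

lemma feasible_zero: "feasible m (\<lambda>s. 0)"
  unfolding feasible_def
proof (intro conjI allI impI)
  fix d
  have "layout (setv d 0 s) = layout s" if "ok r d s" for r s
    using that by (intro arg_cong[of _ _ layout] store_eqI) (auto simp: ok_def fun_eq_iff)
  then show "\<exists>c B. quasi B \<and> (\<forall>r s. ok r d s \<longrightarrow> 0 \<le> B r \<and> runs c (layout s) (B r) (layout (setv d 0 s)))"
    by (intro exI[of _ "Mv 0 Stay"] exI[of _ "\<lambda>_. 1"]) (use quasi_const runs_skip in auto)
qed (simp add: depends_def)

lemma feasible_Suc: assumes "feasible m f" shows "feasible m (\<lambda>s. Suc (f s))"
  unfolding feasible_def
proof (intro conjI allI impI)
  show "depends m (\<lambda>s. Suc (f s))" using feasible_dep[OF assms] by (simp add: depends_def)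
  fix d assume "m \<le> d"
  then obtain c B where c: "quasi B" "\<And>r s. ok r d s \<Longrightarrow> f s \<le> B r"
    "\<And>r s. ok r d s \<Longrightarrow> runs c (layout s) (B r) (layout (setv d (f s) s))" using feasible_cmd[OF assms] by metis
  have "Suc (f s) \<le> B r + 2 \<and> runs (Seq c (Mv (vtape d) MoveRight)) (layout s) (B r + 2) (layout (setv d (Suc (f s)) s))"
    if "ok r d s" for r s
  proof -
    show ?thesis
      using runs_Seq[OF c(3)[OF that] runs_inc_var[of d]] c(2)[OF that] by simp
  qed
  moreover have "quasi (\<lambda>r. B r + 2)" by (intro quasi_intros c)
  ultimately show "\<exists>c B. quasi B \<and> (\<forall>r s. ok r d s \<longrightarrow> Suc (f s) \<le> B r \<and> runs c (layout s) (B r) (layout (setv d (Suc (f s)) s)))"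
    by blast
qed

text \<open>Copying has to preserve the original, so it is moved into two counters and moved back from one.\<close>

lemma feasible_var: assumes "i < m" shows "feasible m (\<lambda>s. var s i)"
  unfolding feasible_def
proof (intro conjI allI impI)
  show "depends m (\<lambda>s. var s i)" using assms by (simp add: depends_def)
  fix d assume "m \<le> d"
  with assms have id: "i < d" by simp
  let ?c = "Seq (countdown (vtape i) (Seq (Mv (vtape (Suc d)) MoveRight) (Mv (vtape d) MoveRight)))
                (countdown (vtape (Suc d)) (Mv (vtape i) MoveRight))"
  have "runs ?c (layout s) (10 * 2 ^ r + 3) (layout (setv d (var s i) s))" if "ok r d s" for r s
  proof -
    let ?v = "var s i"
    have v: "?v \<le> 2 ^ r" "var s d = 0" "var s (Suc d) = 0" using that id by (auto simp: ok_def)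
    \<comment> \<open>The trajectory of the first loop, which moves variable \<open>i\<close> to \<open>d\<close> and \<open>Suc d\<close>.\<close>
    let ?u = "\<lambda>j. setv (Suc d) j (setv d j (setv i (?v - j) s))"
    have "runs (countdown (vtape i) (Seq (Mv (vtape (Suc d)) MoveRight) (Mv (vtape d) MoveRight)))
        (layout (?u 0)) (?v * ((1 + 1 + 1) + 3) + 1) (layout (?u ?v))"
    proof (rule runs_countdown)
      fix j assume "j < ?v"
      let ?a = "setv i (?v - Suc j) (?u j)"
      let ?b = "setv (Suc d) (Suc (var ?a (Suc d))) ?a"
      have "setv d (Suc (var ?b d)) ?b = ?u (Suc j)" using id by (intro store_eqI) (auto simp: fun_eq_iff)
      then show "runs (Seq (Mv (vtape (Suc d)) MoveRight) (Mv (vtape d) MoveRight))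
          ((layout (?u j))(vtape i := numtape (?v - Suc j))) (1 + 1 + 1) (layout (?u (Suc j)))"
        using runs_Seq[OF runs_inc_var[of "Suc d" ?a] runs_inc_var[of d ?b]] by (simp add: layout_setv)
    qed (use id in auto)
    moreover have "?u 0 = s" using v by (intro store_eqI) (auto simp: fun_eq_iff)
    moreover have "runs (countdown (vtape (Suc d)) (Mv (vtape i) MoveRight)) (layout (?u ?v)) (4 * ?v + 1)
        (layout (setv i (var (?u ?v) i + var (?u ?v) (Suc d)) (setv (Suc d) 0 (?u ?v))))"
      using runs_move_var[of "Suc d" i "?u ?v"] id by simp
    moreover have "setv i (var (?u ?v) i + var (?u ?v) (Suc d)) (setv (Suc d) 0 (?u ?v)) = setv d ?v s"
      using v id by (intro store_eqI) (auto simp: fun_eq_iff)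
    ultimately have "runs ?c (layout s) ((?v * ((1 + 1 + 1) + 3) + 1) + (4 * ?v + 1) + 1) (layout (setv d ?v s))"
      by (metis runs_Seq)
    then show ?thesis by (rule runs_mono) (use v in simp)
  qed
  moreover have "var s i \<le> 10 * 2 ^ r + 3" if "ok r d s" for r s
  proof -
    have "var s i \<le> 2 ^ r" using that id by (auto simp: ok_def)
    then show ?thesis by linarith
  qed
  moreover have "quasi (\<lambda>r. 10 * 2 ^ r + 3)" by (intro quasi_intros)
  ultimately show "\<exists>c B. quasi B \<and> (\<forall>r s. ok r d s \<longrightarrow> var s i \<le> B r \<and> runs c (layout s) (B r) (layout (setv d (var s i) s)))"
    by blast
qed

text \<open>Primitive recursion, provided that the intermediate values stay below a quasipolynomial bound \<open>b\<close>. At stack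
height \<open>d\<close> the accumulator is variable \<open>d\<close>, the number of remaining rounds variable \<open>d + 1\<close>, and the index
of the round variable \<open>d + 2\<close>; the step function is computed above them. Arithmetic, logic and searching are
all obtained from this rule.\<close>

lemma feasible_rec:
  assumes a: "feasible m a" and n: "feasible m n"
    and f: "\<And>d. m \<le> d \<Longrightarrow> feasible (d + 3) (\<lambda>s. f (var s (d + 2)) (var s d) s)"
    and fd: "\<And>i x. depends m (f i x)"
    and b: "qbounded m b" "\<And>s i. i \<le> n s \<Longrightarrow> rec_nat (a s) (\<lambda>i x. f i x s) i \<le> b s"
  shows "feasible m (\<lambda>s. rec_nat (a s) (\<lambda>i x. f i x s) (n s))"
  unfolding feasible_def
proof (intro conjI allI impI)
  show "depends m (\<lambda>s. rec_nat (a s) (\<lambda>i x. f i x s) (n s))"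
    using feasible_dep[OF a] feasible_dep[OF n] fd by (simp add: depends_def)
  fix d assume md: "m \<le> d"
  obtain ca Ba where ca: "quasi Ba" "\<And>r s. ok r d s \<Longrightarrow> a s \<le> Ba r"
    "\<And>r s. ok r d s \<Longrightarrow> runs ca (layout s) (Ba r) (layout (setv d (a s) s))" using feasible_cmd[OF a md] by metis
  have "m \<le> d + 1" using md by simp
  then obtain cn Bn where cn: "quasi Bn" "\<And>r s. ok r (d + 1) s \<Longrightarrow> n s \<le> Bn r"
    "\<And>r s. ok r (d + 1) s \<Longrightarrow> runs cn (layout s) (Bn r) (layout (setv (d + 1) (n s) s))"
    using feasible_cmd[OF n] by metis
  obtain cf Bf where cf: "quasi Bf" "\<And>r s. ok r (d + 3) s \<Longrightarrow> f (var s (d + 2)) (var s d) s \<le> Bf r"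
    "\<And>r s. ok r (d + 3) s \<Longrightarrow> runs cf (layout s) (Bf r) (layout (setv (d + 3) (f (var s (d + 2)) (var s d) s) s))"
    using feasible_cmd[OF f[OF md] order_refl] by metis
  obtain Bb where Bb: "quasi Bb" "\<And>r d s. ok r d s \<Longrightarrow> m \<le> d \<Longrightarrow> b s \<le> Bb r" using qbounded_obtain[OF b(1)] by metis
  obtain Bq where Bq: "quasi Bq" "\<And>r d s. ok r d s \<Longrightarrow> m \<le> d \<Longrightarrow> n s \<le> Bq r"
    using qbounded_obtain[OF qbounded_comp[OF n]] by metis
  have "quasi (\<lambda>r. 2 ^ r + Ba r + Bb r + Bq r)" by (intro quasi_intros ca Bb Bq)
  then obtain e where e: "\<And>r. r \<ge> 2 \<Longrightarrow> 2 ^ r + Ba r + Bb r + Bq r \<le> 2 ^ (r ^ Suc e)" using quasi_Suc by blast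
  let ?body = "Seq cf (Seq (countdown (vtape d) (Mv 0 Stay)) (Seq (countdown (vtape (d + 3)) (Mv (vtape d) MoveRight))
     (Mv (vtape (d + 2)) MoveRight)))"
  let ?c = "Seq ca (Seq cn (Seq (countdown (vtape (d + 1)) ?body) (countdown (vtape (d + 2)) (Mv 0 Stay))))"
  let ?T = "\<lambda>r. Bf (r ^ Suc e) + 8 * 2 ^ (r ^ Suc e) + 6"
  let ?B = "\<lambda>r. 2 ^ (r ^ Suc e) + (Ba r + (Bn (r ^ Suc e) + (2 ^ (r ^ Suc e) * (?T r + 3) + 1 + (4 * 2 ^ (r ^ Suc e) + 1) + 1) + 1) + 1)"
  have qB: "quasi ?B"
    by (intro quasi_intros ca quasi_comp[OF cf(1)] quasi_comp[OF cn(1)] quasi_pow)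
  have "rec_nat (a s) (\<lambda>i x. f i x s) (n s) \<le> ?B r \<and>
      runs ?c (layout s) (?B r) (layout (setv d (rec_nat (a s) (\<lambda>i x. f i x s) (n s)) s))" if o: "ok r d s" for r s
  proof -
    define R where "R = r ^ Suc e"
    define N where "N = n s"
    define F where "F j = rec_nat (a s) (\<lambda>i x. f i x s) j" for j
    have r2: "2 \<le> r" using o by (simp add: ok_def)
    have "r ^ 1 \<le> R" unfolding R_def using r2 by (intro power_increasing) auto
    then have R2: "2 \<le> R" using r2 by (simp only: power_one_right)
    have bounds: "2 ^ r \<le> (2::nat) ^ R" "a s \<le> 2 ^ R" "b s \<le> 2 ^ R" "N \<le> 2 ^ R"
      using e[OF r2] ca(2)[OF o] Bb(2)[OF o md] Bq(2)[OF o md] unfolding R_def N_def by linarith+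
    have F: "F j \<le> 2 ^ R" if "j \<le> N" for j
      using b(2)[of j s] that bounds(3) unfolding F_def N_def by linarith
    have bs: "var s i \<le> 2 ^ R" for i
    proof (cases "i < d")
      case True then show ?thesis using o bounds(1) unfolding ok_def using le_trans by blast
    qed (use o in \<open>simp add: ok_def\<close>)
    have bi: "length (inp s) \<le> 2 ^ R" using o bounds(1) unfolding ok_def using le_trans by blast
    \<comment> \<open>The store after \<open>j\<close> rounds, with \<open>k\<close> rounds to go.\<close>
    define u where "u j k = setv d (F j) (setv (d + 1) k (setv (d + 2) j s))" for j k
    have restrict_u: "restrict m (u j k) = restrict m s" for j k using md by (simp add: u_def)
    have f_u: "f i x (u j k) = f i x s" for i x j k using dependsD[OF fd restrict_u] .
    have ok_u: "ok R (d + 3) (u j k)" if "j \<le> N" "k \<le> N" for j k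
      using o R2 bs bi F that bounds(4) unfolding ok_def u_def by auto
    have body: "runs ?body (layout (u j k)) (?T r) (layout (u (Suc j) k))" if jk: "Suc j \<le> N" "k \<le> N" for j k
    proof -
      let ?u1 = "setv (d + 3) (F (Suc j)) (u j k)"
      have "f (var (u j k) (d + 2)) (var (u j k) d) (u j k) = F (Suc j)"
        unfolding f_u by (simp add: u_def F_def)
      with cf(3)[of R "u j k"] ok_u[of j k] jk
      have 1: "runs cf (layout (u j k)) (Bf R) (layout ?u1)" by simp
      have "var ?u1 d \<le> 2 ^ R" using F[of j] jk by (simp add: u_def)
      then have 2: "runs (countdown (vtape d) (Mv 0 Stay)) (layout ?u1) (4 * 2 ^ R + 1) (layout (setv d 0 ?u1))"
        by (intro runs_mono[OF runs_clear_var]) simp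
      let ?u2 = "setv d 0 ?u1"
      have "runs (countdown (vtape (d + 3)) (Mv (vtape d) MoveRight)) (layout ?u2) (4 * var ?u2 (d + 3) + 1)
         (layout (setv d (var ?u2 d + var ?u2 (d + 3)) (setv (d + 3) 0 ?u2)))"
        by (rule runs_move_var) simp
      moreover have "setv d (var ?u2 d + var ?u2 (d + 3)) (setv (d + 3) 0 ?u2) = setv d (F (Suc j)) (u j k)"
        using o by (intro store_eqI) (auto simp: fun_eq_iff u_def ok_def)
      moreover have "var ?u2 (d + 3) = F (Suc j)" by simp
      ultimately have 3: "runs (countdown (vtape (d + 3)) (Mv (vtape d) MoveRight)) (layout ?u2) (4 * 2 ^ R + 1)
          (layout (setv d (F (Suc j)) (u j k)))" using F[OF jk(1)] by (metis (no_types, lifting) add_le_mono1 mult_le_mono2 runs_mono)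
      let ?u3 = "setv d (F (Suc j)) (u j k)"
      have "setv (d + 2) (Suc (var ?u3 (d + 2))) ?u3 = u (Suc j) k"
        by (intro store_eqI) (auto simp: fun_eq_iff u_def)
      then have 4: "runs (Mv (vtape (d + 2)) MoveRight) (layout ?u3) 1 (layout (u (Suc j) k))"
        using runs_inc_var[of "d + 2" ?u3] by simp
      show ?thesis
        by (rule runs_mono[OF runs_Seq[OF 1 runs_Seq[OF 2 runs_Seq[OF 3 4]]]]) (simp add: R_def)
    qed
    have loop: "runs (countdown (vtape (d + 1)) ?body) (layout (u 0 (N - 0))) (N * (?T r + 3) + 1) (layout (u N (N - N)))"
    proof (rule runs_countdown)
      fix j assume j: "j < N"
      have "setv (d + 1) (N - Suc j) (u j (N - j)) = u j (N - Suc j)"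
        by (intro store_eqI) (auto simp: fun_eq_iff u_def)
      then show "runs ?body ((layout (u j (N - j)))(vtape (d + 1) := numtape (N - Suc j))) (?T r) (layout (u (Suc j) (N - Suc j)))"
        unfolding layout_setv using body[of j "N - Suc j"] j by simp
    qed (simp add: u_def)
    have s1: "runs ca (layout s) (Ba r) (layout (setv d (a s) s))" by (rule ca(3)[OF o])
    have ok1: "ok R (d + 1) (setv d (a s) s)" using o R2 bs bi bounds(2) by (auto simp: ok_def)
    have "n (setv d (a s) s) = N" unfolding N_def by (rule dependsD[OF feasible_dep[OF n]]) (use md in simp)
    then have s2: "runs cn (layout (setv d (a s) s)) (Bn R) (layout (setv (d + 1) N (setv d (a s) s)))"
      using cn(3)[OF ok1] by simp
    have "setv (d + 1) N (setv d (a s) s) = u 0 N"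
      using o by (intro store_eqI) (auto simp: fun_eq_iff u_def F_def ok_def)
    with s2 have s2: "runs cn (layout (setv d (a s) s)) (Bn R) (layout (u 0 N))" by simp
    have s3: "runs (countdown (vtape (d + 1)) ?body) (layout (u 0 N)) (N * (?T r + 3) + 1) (layout (u N 0))"
      using loop by simp
    have "setv (d + 2) 0 (u N 0) = setv d (F N) s"
      using o by (intro store_eqI) (auto simp: fun_eq_iff u_def ok_def)
    then have s4: "runs (countdown (vtape (d + 2)) (Mv 0 Stay)) (layout (u N 0)) (4 * N + 1) (layout (setv d (F N) s))"
      using runs_clear_var[of "d + 2" "u N 0"] by (simp add: u_def)
    have "runs ?c (layout s) (Ba r + (Bn R + (N * (?T r + 3) + 1 + (4 * N + 1) + 1) + 1) + 1) (layout (setv d (F N) s))"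
      by (intro runs_Seq[OF s1 runs_Seq[OF s2 runs_Seq[OF s3 s4]]])
    moreover have "Ba r + (Bn R + (N * (?T r + 3) + 1 + (4 * N + 1) + 1) + 1) + 1 \<le> ?B r"
      unfolding R_def[symmetric] using bounds(4) mult_le_mono1[OF bounds(4), of "?T r + 3"]
      by (simp only: R_def)
    moreover have "F N \<le> ?B r" using F[of N] by (simp add: R_def)
    ultimately show ?thesis unfolding F_def N_def by (blast intro: runs_mono)
  qed
  with qB show "\<exists>c B. quasi B \<and> (\<forall>r s. ok r d s \<longrightarrow> rec_nat (a s) (\<lambda>i x. f i x s) (n s) \<le> B r \<and>
      runs c (layout s) (B r) (layout (setv d (rec_nat (a s) (\<lambda>i x. f i x s) (n s)) s)))"
    by blast
qed


text \<open>Indexed reading is the same for the input word and for arrays: \<open>F s\<close> is the content of tape \<open>q\<close>.\<close>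

lemma feasible_test:
  assumes t: "feasible m t" and dX: "depends m X" and q: "q = 0 \<or> (\<exists>i. q = atape i)"
    and F: "\<And>s. layout s q = (F s, 0)" and X: "\<And>s. X s \<longleftrightarrow> P (F s (int (t s)))"
  shows "feasible m (\<lambda>s. of_bool (X s))"
  unfolding feasible_def
proof (intro conjI allI impI)
  show "depends m (\<lambda>s. of_bool (X s))" using dX by (simp add: depends_def)
  fix d assume md: "m \<le> d"
  then have "m \<le> d + 1" by simp
  then obtain c B where c: "quasi B" "\<And>r s. ok r (d + 1) s \<Longrightarrow> t s \<le> B r"
    "\<And>r s. ok r (d + 1) s \<Longrightarrow> runs c (layout s) (B r) (layout (setv (d + 1) (t s) s))" using feasible_cmd[OF t] by metis
  let ?c = "Seq c (Seq (test_at q (vtape (d + 1)) (vtape (d + 2)) P (vtape d)) (countdown (vtape (d + 1)) (Mv 0 Stay)))"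
  let ?B = "\<lambda>r. 17 * B r + 17"
  have "runs ?c (layout s) (?B r) (layout (setv d (of_bool (X s)) s))" if o: "ok r d s" for r s
  proof -
    have z: "var s d = 0" "var s (Suc d) = 0" "var s (Suc (Suc d)) = 0" using o by (auto simp: ok_def)
    have o1: "ok r (d + 1) s" using o by (auto simp: ok_def less_Suc_eq)
    let ?u = "setv (d + 1) (t s) s"
    have 1: "runs c (layout s) (B r) (layout ?u)" by (rule c(3)[OF o1])
    have "t ?u = t s" by (rule dependsD[OF feasible_dep[OF t]]) (use md in simp)
    moreover have "X ?u = X s" by (rule dependsD[OF dX]) (use md in simp)
    ultimately have PX: "P (F ?u (int (t s))) = X s" using X[of ?u] by simp
    have "runs (test_at q (vtape (d + 1)) (vtape (d + 2)) P (vtape d)) (layout ?u) (12 * t s + 6)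
        ((layout ?u)(vtape d := numtape (of_bool (P (F ?u (int (t s)))))))"
      by (rule runs_test_at) (use q F[of ?u] z in auto)
    then have 2: "runs (test_at q (vtape (d + 1)) (vtape (d + 2)) P (vtape d)) (layout ?u) (12 * t s + 6)
        (layout (setv d (of_bool (X s)) ?u))"
      unfolding layout_setv PX .
    let ?w = "setv d (of_bool (X s)) ?u"
    have "runs (countdown (vtape (d + 1)) (Mv 0 Stay)) (layout ?w) (4 * var ?w (d + 1) + 1) (layout (setv (d + 1) 0 ?w))"
      by (rule runs_clear_var)
    moreover have "setv (d + 1) 0 ?w = setv d (of_bool (X s)) s"
      using z by (intro store_eqI) (auto simp: fun_eq_iff)
    ultimately have 3: "runs (countdown (vtape (d + 1)) (Mv 0 Stay)) (layout ?w) (4 * t s + 1) (layout (setv d (of_bool (X s)) s))"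
      by simp
    show ?thesis
      by (rule runs_mono[OF runs_Seq[OF 1 runs_Seq[OF 2 3]]]) (use c(2)[OF o1] in simp)
  qed
  moreover have "quasi ?B" by (intro quasi_intros c)
  ultimately show "\<exists>c B. quasi B \<and> (\<forall>r s. ok r d s \<longrightarrow> of_bool (X s) \<le> B r \<and> runs c (layout s) (B r) (layout (setv d (of_bool (X s)) s)))"
    by (intro exI[of _ ?c] exI[of _ ?B]) auto
qed

definition letter_at :: "letter list \<Rightarrow> nat \<Rightarrow> letter \<Rightarrow> bool" where
  "letter_at w p a \<longleftrightarrow> p < length w \<and> w ! p = a"

lemma feasible_letter_at:
  assumes "feasible m t" shows "feasible m (\<lambda>s. of_bool (letter_at (inp s) (t s) a))"
proof (rule feasible_test[OF assms, of _ 0 "\<lambda>s. fst (input_tape (inp s))" "\<lambda>x. x = Input a"])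
  show "depends m (\<lambda>s. letter_at (inp s) (t s) a)" using feasible_dep[OF assms] by (simp add: depends_def)
qed (auto simp: input_tape_def letter_at_def)

lemma feasible_mem:
  assumes "feasible m t" "i < m" shows "feasible m (\<lambda>s. of_bool (t s \<in> arr s i))"
proof (rule feasible_test[OF assms(1), of _ "atape i" "\<lambda>s. fst (settape (arr s i))" "\<lambda>x. x = Work 1"])
  show "depends m (\<lambda>s. t s \<in> arr s i)" using feasible_dep[OF assms(1)] assms(2) by (simp add: depends_def)
qed (auto simp: settape_def)

text \<open>The input is followed by a blank. The head walks there and back; the way back does the counting.\<close>

lemma feasible_length: "feasible m (\<lambda>s. length (inp s))"
  unfolding feasible_def
proof (intro conjI allI impI)
  show "depends m (\<lambda>s. length (inp s))" by (simp add: depends_def)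
  fix d
  let ?walk = "Seq (Mv 0 MoveRight) (Mv (vtape (d + 1)) MoveRight)"
  let ?c = "Seq (While 0 (\<lambda>x. x \<noteq> Blank) ?walk) (rewind 0 (vtape d) (vtape (d + 1)))"
  let ?B = "\<lambda>r. 10 * 2 ^ r + 3"
  have "length (inp s) \<le> ?B r \<and> runs ?c (layout s) (?B r) (layout (setv d (length (inp s)) s))" if o: "ok r d s" for r s
  proof -
    define N where "N = length (inp s)"
    have z: "var s d = 0" "var s (d + 1) = 0" and N: "N \<le> 2 ^ r" using o by (auto simp: ok_def N_def)
    obtain f where f: "input_tape (inp s) = (f, 0)" "\<And>i. f (int i) \<noteq> Blank \<longleftrightarrow> i < N"
      by (auto simp: input_tape_def N_def)
    let ?u = "\<lambda>j. (layout s)(0 := (f, int j), vtape (d + 1) := numtape j)"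
    have u0: "?u 0 = layout s" using f z by (auto simp: fun_eq_iff)
    have "runs (While 0 (\<lambda>x. x \<noteq> Blank) ?walk) (?u 0) (N * ((1 + 1 + 1) + 1) + 1) (?u N)"
    proof (rule runs_While)
      fix j assume "j < N"
      then show "read_tape (?u j 0) \<noteq> Blank" using f by simp
      let ?v = "(?u j)(0 := (f, int j + 1))"
      have "runs (Mv 0 MoveRight) (?u j) 1 ((?u j)(0 := (f, move_head MoveRight (int j))))"
        by (rule runs_Mv) simp
      then have 1: "runs (Mv 0 MoveRight) (?u j) 1 ?v" by simp
      have 2: "runs (Mv (vtape (d + 1)) MoveRight) ?v 1 (?v(vtape (d + 1) := numtape (Suc j)))"
        by (rule runs_inc) simp
      have "?v(vtape (d + 1) := numtape (Suc j)) = ?u (Suc j)" by (auto simp: fun_eq_iff)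
      with runs_Seq[OF 1 2] show "runs ?walk (?u j) (1 + 1 + 1) (?u (Suc j))" by simp
    next
      show "\<not> read_tape (?u N 0) \<noteq> Blank" using f(2)[of N] by simp
    qed
    then have 1: "runs (While 0 (\<lambda>x. x \<noteq> Blank) ?walk) (layout s) (4 * N + 1) (?u N)"
      unfolding u0 by (rule runs_mono) simp
    have "runs (rewind 0 (vtape d) (vtape (d + 1))) (?u N) (6 * N + 1)
       ((?u N)(vtape (d + 1) := numtape 0, vtape d := numtape (0 + N), 0 := (f, int N + (-1) * int N)))"
      unfolding rewind_def by (rule runs_transfer) (use z in auto)
    moreover have "(?u N)(vtape (d + 1) := numtape 0, vtape d := numtape (0 + N), 0 := (f, int N + (-1) * int N)) =
        (layout s)(vtape d := numtape N)"
      using f z by (auto simp: fun_eq_iff)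
    ultimately have 2: "runs (rewind 0 (vtape d) (vtape (d + 1))) (?u N) (6 * N + 1) (layout (setv d N s))"
      unfolding layout_setv by simp
    show ?thesis
      unfolding N_def[symmetric] using runs_mono[OF runs_Seq[OF 1 2]] N by simp
  qed
  moreover have "quasi ?B" by (intro quasi_intros)
  ultimately show "\<exists>c B. quasi B \<and> (\<forall>r s. ok r d s \<longrightarrow> length (inp s) \<le> B r \<and> runs c (layout s) (B r) (layout (setv d (length (inp s)) s)))"
    by blast
qed

section \<open>Tables of bits\<close>

text \<open>A table of bits filled in increasing order of the index; entry \<open>y\<close> may look at the entries before it.\<close>

definition table :: "(nat set \<Rightarrow> nat \<Rightarrow> bool) \<Rightarrow> nat \<Rightarrow> nat set" where
  "table P n = rec_nat {} (\<lambda>y A. if P A y then insert y A else A) n"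

lemma table_simps [simp]: "table P 0 = {}"
    "table P (Suc n) = (if P (table P n) n then insert n (table P n) else table P n)"
  by (simp_all add: table_def)

lemma table_bound: "table P n \<subseteq> {..<n}"
  by (induction n) auto

text \<open>The table lives in array \<open>d\<close> while it is filled and queried, and is erased afterwards. Where
recursion carries a single number from round to round, a table remembers one bit per round; this is what
makes reachability feasible.\<close>

lemma feasible_table:
  assumes t: "feasible m t" and n: "feasible m n"
    and P: "\<And>d. m \<le> d \<Longrightarrow> feasible (d + 2) (\<lambda>s. of_bool (P (arr s d) (var s (d + 1)) s))"
    and Pd: "\<And>A y. depends m (P A y)"
  shows "feasible m (\<lambda>s. of_bool (t s \<in> table (\<lambda>A y. P A y s) (n s)))"
  unfolding feasible_def
proof (intro conjI allI impI)
  show "depends m (\<lambda>s. of_bool (t s \<in> table (\<lambda>A y. P A y s) (n s)))"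
    using feasible_dep[OF t] feasible_dep[OF n] Pd by (simp add: depends_def)
  fix d assume md: "m \<le> d"
  have md1: "m \<le> d + 1" using md by simp
  obtain cn Bn where cn: "quasi Bn" "\<And>r s. ok r d s \<Longrightarrow> n s \<le> Bn r"
    "\<And>r s. ok r d s \<Longrightarrow> runs cn (layout s) (Bn r) (layout (setv d (n s) s))" using feasible_cmd[OF n md] by metis
  obtain cm Bm where cm: "quasi Bm" "\<And>r s. ok r (d + 1) s \<Longrightarrow> n s \<le> Bm r"
    "\<And>r s. ok r (d + 1) s \<Longrightarrow> runs cm (layout s) (Bm r) (layout (setv (d + 1) (n s) s))" using feasible_cmd[OF n md1] by metis
  obtain cf Bf where cf: "quasi Bf"
    "\<And>r s. ok r (d + 2) s \<Longrightarrow> runs cf (layout s) (Bf r) (layout (setv (d + 2) (of_bool (P (arr s d) (var s (d + 1)) s)) s))"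
    using feasible_cmd[OF P[OF md] order_refl] by metis
  have mem: "feasible (d + 1) (\<lambda>s. of_bool (t s \<in> arr s d))" by (rule feasible_mem[OF feasible_mono[OF t]]) (use md in auto)
  obtain ct Bt where ct: "quasi Bt"
    "\<And>r s. ok r (d + 1) s \<Longrightarrow> runs ct (layout s) (Bt r) (layout (setv (d + 1) (of_bool (t s \<in> arr s d)) s))"
    using feasible_cmd[OF mem order_refl] by metis
  have "quasi (\<lambda>r. 2 ^ r + Bn r)" by (intro quasi_intros cn)
  then obtain e where e: "\<And>r. r \<ge> 2 \<Longrightarrow> 2 ^ r + Bn r \<le> 2 ^ (r ^ Suc e)" using quasi_Suc by blast
  let ?put = "Seq (Mv (vtape (d + 2)) MoveLeft) (write_at (atape d) (vtape (d + 1)) (vtape (d + 2)) (Work 1))"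
  let ?fill = "Seq cf (Seq (If (vtape (d + 2)) positive ?put (Mv 0 Stay)) (Mv (vtape (d + 1)) MoveRight))"
  let ?erase = "write_at (atape d) (vtape (d + 1)) (vtape (d + 2)) Blank"
  let ?c = "Seq cn (Seq (countdown (vtape d) ?fill) (Seq (countdown (vtape (d + 1)) (Mv 0 Stay))
     (Seq ct (Seq (countdown (vtape (d + 1)) (Mv (vtape d) MoveRight)) (Seq cm (countdown (vtape (d + 1)) ?erase))))))"
  let ?T = "\<lambda>r. Bf (r ^ Suc e) + 12 * 2 ^ (r ^ Suc e) + 11"
  let ?B = "\<lambda>r. Bn r + (2 ^ (r ^ Suc e) * (?T r + 3) + 1 + (4 * 2 ^ (r ^ Suc e) + 1 + (Bt (r ^ Suc e) + (5 +
     (Bm (r ^ Suc e) + (2 ^ (r ^ Suc e) * (12 * 2 ^ (r ^ Suc e) + 5 + 3) + 1) + 1) + 1) + 1) + 1) + 1) + 1"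
  have qB: "quasi ?B"
    by (intro quasi_intros cn(1) quasi_comp[OF cf(1)] quasi_comp[OF ct(1)] quasi_comp[OF cm(1)] quasi_pow)
  have "runs ?c (layout s) (?B r) (layout (setv d (of_bool (t s \<in> table (\<lambda>A y. P A y s) (n s))) s))"
    if o: "ok r d s" for r s
  proof -
    define R where "R = r ^ Suc e"
    define N where "N = n s"
    define A where "A j = table (\<lambda>A y. P A y s) j" for j
    define b where "b = (of_bool (t s \<in> A N) :: nat)"
    have r2: "2 \<le> r" using o by (simp add: ok_def)
    have "r ^ 1 \<le> R" unfolding R_def using r2 by (intro power_increasing) auto
    then have R2: "2 \<le> R" using r2 by (simp only: power_one_right)
    have bounds: "2 ^ r \<le> (2::nat) ^ R" "N \<le> 2 ^ R"
      using e[OF r2] cn(2)[OF o] unfolding R_def N_def by linarith+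
    have bs: "var s i \<le> 2 ^ R" for i
    proof (cases "i < d")
      case True then show ?thesis using o bounds(1) unfolding ok_def using le_trans by blast
    qed (use o in \<open>simp add: ok_def\<close>)
    have bi: "length (inp s) \<le> 2 ^ R" using o bounds(1) unfolding ok_def using le_trans by blast
    have z: "var s d = 0" "var s (Suc d) = 0" "var s (Suc (Suc d)) = 0" "arr s d = {}" using o by (auto simp: ok_def)
    \<comment> \<open>The store with \<open>k\<close> entries to go, the current index \<open>j\<close>, and the set \<open>S\<close> in the array.\<close>
    define u where "u k j S = seta d S (setv d k (setv (d + 1) j s))" for k j S
    have restrict_u: "restrict m (u k j S) = restrict m s" for k j S using md by (simp add: u_def)
    have P_u: "P S' y (u k j S) = P S' y s" for S' y k j S using dependsD[OF Pd restrict_u] .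
    have n_u: "n (u k j S) = N" for k j S unfolding N_def using dependsD[OF feasible_dep[OF n] restrict_u] .
    have t_u: "t (u k j S) = t s" for k j S using dependsD[OF feasible_dep[OF t] restrict_u] .
    have ok_u: "ok R (d + 2) (u k j S)" if "j \<le> 2 ^ R" "k \<le> 2 ^ R" for j k S
      using o R2 bs bi that unfolding ok_def u_def by auto
    have ok_u1: "ok R (d + 1) (u k 0 S)" if "k \<le> 2 ^ R" for k S
      using o R2 bs bi that unfolding ok_def u_def by auto
    have setv_u: "setv d k' (u k j S) = u k' j S" "setv (d + 1) j' (u k j S) = u k j' S"
      "seta d S' (u k j S) = u k j S'" for k j S k' j' S'
      by (intro store_eqI; auto simp: fun_eq_iff u_def)+
    have poke: "runs (write_at (atape d) (vtape (d + 1)) (vtape (d + 2)) x) (layout (u k j S)) (12 * 2 ^ R + 5)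
        (layout (u k j S'))"
      if "j \<le> 2 ^ R" "settape S' = ((fst (settape S :: letter tape))(int j := x), 0)" for k j S S' x
    proof -
      have "runs (write_at (atape d) (vtape (d + 1)) (vtape (d + 2)) x) (layout (u k j S)) (12 * j + 5)
          ((layout (u k j S))(atape d := ((fst (settape S))(int j := x), 0)))"
        by (rule runs_write_at) (use z in \<open>auto simp: u_def settape_def\<close>)
      then show ?thesis unfolding that(2)[symmetric] layout_seta setv_u
        by (rule runs_mono) (use that(1) in simp)
    qed
    have fill: "runs ?fill (layout (u k j (A j))) (?T r) (layout (u k (Suc j) (A (Suc j))))"
      if jk: "j \<le> 2 ^ R" "k \<le> 2 ^ R" for j k
    proof -
      let ?u = "u k j (A j)"
      define p where "p = (of_bool (P (A j) j s) :: nat)"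
      have "P (arr ?u d) (var ?u (d + 1)) ?u = P (A j) j s" unfolding P_u by (simp add: u_def)
      with cf(2)[OF ok_u[OF jk, of "A j"]] have 1: "runs cf (layout ?u) (Bf R) (layout (setv (d + 2) p ?u))"
        unfolding p_def by (simp only:)
      have 2: "runs (If (vtape (d + 2)) positive ?put (Mv 0 Stay)) (layout (setv (d + 2) p ?u)) (12 * 2 ^ R + 8)
          (layout (u k j (A (Suc j))))"
      proof (cases "P (A j) j s")
        case True
        have "setv (d + 2) 0 (setv (d + 2) p ?u) = ?u"
          using z by (intro store_eqI) (auto simp: fun_eq_iff u_def)
        then have "runs (Mv (vtape (d + 2)) MoveLeft) (layout (setv (d + 2) p ?u)) 1 (layout ?u)"
          using runs_dec_var[of "setv (d + 2) p ?u" "d + 2" 0] True by (simp add: p_def)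
        moreover have "runs (write_at (atape d) (vtape (d + 1)) (vtape (d + 2)) (Work 1)) (layout ?u) (12 * 2 ^ R + 5)
            (layout (u k j (A (Suc j))))"
          by (rule poke) (use jk True in \<open>simp_all add: A_def settape_insert\<close>)
        ultimately have "runs ?put (layout (setv (d + 2) p ?u)) (1 + (12 * 2 ^ R + 5) + 1) (layout (u k j (A (Suc j))))"
          by (rule runs_Seq)
        moreover have "positive (read_tape (layout (setv (d + 2) p ?u) (vtape (d + 2))))"
          using True by (simp only: layout_simps read_numtape) (simp add: p_def)
        ultimately show ?thesis by (intro runs_mono[OF runs_If[where T = "1 + (12 * 2 ^ R + 5) + 1"]]) simp_all
      next
        case False
        have "setv (d + 2) p ?u = u k j (A (Suc j))"
          using z False by (intro store_eqI) (auto simp: fun_eq_iff u_def p_def A_def)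
        moreover have "\<not> positive (read_tape (layout (setv (d + 2) p ?u) (vtape (d + 2))))"
          using False by (simp only: layout_simps read_numtape) (simp add: p_def)
        ultimately show ?thesis
          using runs_skip by (intro runs_mono[OF runs_If[where T = 1]]) simp_all
      qed
      have 3: "runs (Mv (vtape (d + 1)) MoveRight) (layout (u k j (A (Suc j)))) 1 (layout (u k (Suc j) (A (Suc j))))"
        using runs_inc_var[of "d + 1" "u k j (A (Suc j))"] unfolding setv_u by (simp add: u_def)
      show ?thesis
        by (rule runs_mono[OF runs_Seq[OF 1 runs_Seq[OF 2 3]]]) (simp add: R_def)
    qed
    have "u N 0 {} = setv d N s" using z by (intro store_eqI) (auto simp: fun_eq_iff u_def)
    with cn(3)[OF o] have s1: "runs cn (layout s) (Bn r) (layout (u N 0 {}))" by (simp add: N_def)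
    have "runs (countdown (vtape d) ?fill) (layout (u (N - 0) 0 (A 0))) (N * (?T r + 3) + 1) (layout (u (N - N) N (A N)))"
    proof (rule runs_countdown)
      fix j assume "j < N"
      then have "j \<le> 2 ^ R" "N - Suc j \<le> 2 ^ R" using bounds by linarith+
      then show "runs ?fill ((layout (u (N - j) j (A j)))(vtape d := numtape (N - Suc j))) (?T r)
          (layout (u (N - Suc j) (Suc j) (A (Suc j))))"
        unfolding layout_setv setv_u by (rule fill)
    qed (simp add: u_def)
    moreover have "A 0 = {}" by (simp add: A_def)
    ultimately have "runs (countdown (vtape d) ?fill) (layout (u N 0 {})) (N * (?T r + 3) + 1) (layout (u 0 N (A N)))"
      by (simp only: diff_zero diff_self_eq_0)
    from runs_mono[OF this add_le_mono1[OF mult_le_mono1[OF bounds(2)]]]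
    have s2: "runs (countdown (vtape d) ?fill) (layout (u N 0 {})) (2 ^ R * (?T r + 3) + 1) (layout (u 0 N (A N)))" .
    have "runs (countdown (vtape (d + 1)) (Mv 0 Stay)) (layout (u 0 N (A N))) (4 * N + 1) (layout (u 0 0 (A N)))"
      using runs_clear_var[of "d + 1" "u 0 N (A N)"] unfolding setv_u by (simp add: u_def)
    then have s3: "runs (countdown (vtape (d + 1)) (Mv 0 Stay)) (layout (u 0 N (A N))) (4 * 2 ^ R + 1) (layout (u 0 0 (A N)))"
      by (rule runs_mono) (use bounds in simp)
    have "arr (u 0 0 (A N)) d = A N" by (simp add: u_def)
    then have s4: "runs ct (layout (u 0 0 (A N))) (Bt R) (layout (u 0 b (A N)))"
      using ct(2)[OF ok_u1[of 0 "A N"]] unfolding t_u setv_u by (simp add: b_def)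
    have "b \<le> 1" by (simp add: b_def)
    have "runs (countdown (vtape (d + 1)) (Mv (vtape d) MoveRight)) (layout (u 0 b (A N))) (4 * b + 1) (layout (u b 0 (A N)))"
      using runs_move_var[of "d + 1" d "u 0 b (A N)"] unfolding setv_u by (simp add: u_def)
    then have s5: "runs (countdown (vtape (d + 1)) (Mv (vtape d) MoveRight)) (layout (u 0 b (A N))) 5 (layout (u b 0 (A N)))"
      by (rule runs_mono) (use \<open>b \<le> 1\<close> in simp)
    have "b \<le> 2 ^ R" using \<open>b \<le> 1\<close> one_le_power[of "2::nat" R] by linarith
    then have s6: "runs cm (layout (u b 0 (A N))) (Bm R) (layout (u b N (A N)))"
      using cm(3)[OF ok_u1] unfolding n_u setv_u by blast
    \<comment> \<open>Erasing from the highest index down to 0, with the countdown itself as the index.\<close>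
    have "runs (countdown (vtape (d + 1)) ?erase) (layout (u b (N - 0) (A N \<inter> {..<N - 0}))) (N * ((12 * 2 ^ R + 5) + 3) + 1)
        (layout (u b (N - N) (A N \<inter> {..<N - N})))"
    proof (rule runs_countdown)
      fix j assume j: "j < N"
      then have "{..<N - Suc j} = {..<N - j} - {N - Suc j}" by auto
      then have "A N \<inter> {..<N - Suc j} = (A N \<inter> {..<N - j}) - {N - Suc j}" by auto
      then have "settape (A N \<inter> {..<N - Suc j}) = ((fst (settape (A N \<inter> {..<N - j}) :: letter tape))(int (N - Suc j) := Blank), 0)"
        by (simp only: settape_remove)
      moreover have "N - Suc j \<le> 2 ^ R" using bounds(2) by linarith
      ultimately show "runs ?erase ((layout (u b (N - j) (A N \<inter> {..<N - j})))(vtape (d + 1) := numtape (N - Suc j)))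
          (12 * 2 ^ R + 5) (layout (u b (N - Suc j) (A N \<inter> {..<N - Suc j})))"
        unfolding layout_setv setv_u by (intro poke)
    qed (simp add: u_def)
    moreover have "A N \<inter> {..<N - 0} = A N" using table_bound[of "\<lambda>A y. P A y s" N] by (auto simp: A_def)
    moreover have "u b (N - N) (A N \<inter> {..<N - N}) = setv d b s"
      using z by (intro store_eqI) (auto simp: fun_eq_iff u_def)
    ultimately have "runs (countdown (vtape (d + 1)) ?erase) (layout (u b N (A N))) (N * ((12 * 2 ^ R + 5) + 3) + 1) (layout (setv d b s))"
      by (simp only: diff_zero)
    from runs_mono[OF this add_le_mono1[OF mult_le_mono1[OF bounds(2)]]]
    have s7: "runs (countdown (vtape (d + 1)) ?erase) (layout (u b N (A N))) (2 ^ R * ((12 * 2 ^ R + 5) + 3) + 1) (layout (setv d b s))" .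
    have "runs ?c (layout s) (?B r) (layout (setv d b s))"
      by (rule runs_mono[OF runs_Seq[OF s1 runs_Seq[OF s2 runs_Seq[OF s3 runs_Seq[OF s4
          runs_Seq[OF s5 runs_Seq[OF s6 s7]]]]]]]) (simp add: R_def)
    then show ?thesis by (simp add: b_def A_def N_def)
  qed
  with qB show "\<exists>c B. quasi B \<and> (\<forall>r s. ok r d s \<longrightarrow> of_bool (t s \<in> table (\<lambda>A y. P A y s) (n s)) \<le> B r \<and>
      runs c (layout s) (B r) (layout (setv d (of_bool (t s \<in> table (\<lambda>A y. P A y s) (n s))) s)))"
    by (intro exI[of _ ?c] exI[of _ ?B]) auto
qed


section \<open>Arithmetic, logic and reachability\<close>

lemma depends_restrict: "depends m f \<Longrightarrow> m \<le> d \<Longrightarrow> f (restrict d s) = f s"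
  using depends_mono[of m f d] by (simp add: depends_def)

lemma feasible_const: "feasible m (\<lambda>s. k)"
  by (induction k) (auto intro: feasible_zero feasible_Suc)

lemma feasible_add:
  assumes f: "feasible m f" and g: "feasible m g" shows "feasible m (\<lambda>s. f s + g s)"
proof -
  have eq: "rec_nat a (\<lambda>i x. Suc x) k = a + k" for a k :: nat by (induction k) auto
  have "feasible m (\<lambda>s. rec_nat (f s) (\<lambda>i x. Suc x) (g s))"
    by (rule feasible_rec[OF f g, where b = "\<lambda>s. f s + g s"])
      (auto intro!: feasible_Suc feasible_var qbounded_add[OF qbounded_comp[OF f] qbounded_comp[OF g]] simp: depends_def eq)
  then show ?thesis by (simp add: eq)
qed

lemma feasible_mult:
  assumes f: "feasible m f" and g: "feasible m g" shows "feasible m (\<lambda>s. f s * g s)"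
proof -
  have eq: "rec_nat 0 (\<lambda>i x. x + a) k = a * k" for a k :: nat by (induction k) auto
  have "feasible m (\<lambda>s. rec_nat 0 (\<lambda>i x. x + f s) (g s))"
    by (rule feasible_rec[OF feasible_zero g, where b = "\<lambda>s. f s * g s"])
      (auto intro!: feasible_add feasible_var qbounded_mult[OF qbounded_comp[OF f] qbounded_comp[OF g]] feasible_mono[OF f] simp: depends_def eq feasible_restrict[OF f])
  then show ?thesis by (simp add: eq)
qed

lemma feasible_pred:
  assumes g: "feasible m g" shows "feasible m (\<lambda>s. g s - 1)"
proof -
  have eq: "rec_nat 0 (\<lambda>i x. i) k = k - 1" for k :: nat by (cases k) auto
  have "feasible m (\<lambda>s. rec_nat 0 (\<lambda>i x. i) (g s))"
    by (rule feasible_rec[OF feasible_zero g, where b = g])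
      (auto intro!: feasible_var qbounded_comp g simp: depends_def eq)
  then show ?thesis by (simp add: eq)
qed

lemma feasible_diff:
  assumes f: "feasible m f" and g: "feasible m g" shows "feasible m (\<lambda>s. f s - g s)"
proof -
  have eq: "rec_nat a (\<lambda>i x. x - 1) k = a - k" for a k :: nat by (induction k) auto
  have "feasible m (\<lambda>s. rec_nat (f s) (\<lambda>i x. x - 1) (g s))"
    by (rule feasible_rec[OF f g, where b = f])
      (auto intro!: feasible_pred[simplified] feasible_var qbounded_comp f simp: depends_def eq[simplified])
  then show ?thesis by (simp add: eq[simplified])
qed

text \<open>A conditional is a recursion of length zero or one.\<close>

lemma feasible_if:
  assumes P: "feasible m (\<lambda>s. of_bool (P s))" and f: "feasible m f" and g: "feasible m g"
  shows "feasible m (\<lambda>s. if P s then f s else g s)"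
proof -
  have eq: "rec_nat (g s) (\<lambda>i x. f s) (of_bool (P s)) = (if P s then f s else g s)" for s by simp
  have "feasible m (\<lambda>s. rec_nat (g s) (\<lambda>i x. f s) (of_bool (P s)))"
  proof (rule feasible_rec[OF g P, where b = "\<lambda>s. f s + g s"])
    show "rec_nat (g s) (\<lambda>i x. f s) i \<le> f s + g s" for s i by (cases i) auto
  qed (auto intro!: qbounded_add[OF qbounded_comp[OF f] qbounded_comp[OF g]] feasible_mono[OF f] simp: depends_def feasible_restrict[OF f])
  then show ?thesis by (simp add: eq)
qed

lemma feasible_not:
  assumes P: "feasible m (\<lambda>s. of_bool (P s))" shows "feasible m (\<lambda>s. of_bool (\<not> P s))"
proof -
  have eq: "1 - of_bool (P s) = (of_bool (\<not> P s) :: nat)" for s by simp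
  show ?thesis using feasible_diff[OF feasible_const[of m 1] P] unfolding eq .
qed

lemma feasible_conj:
  assumes "feasible m (\<lambda>s. of_bool (P s))" "feasible m (\<lambda>s. of_bool (Q s))"
  shows "feasible m (\<lambda>s. of_bool (P s \<and> Q s))"
  using feasible_mult[OF assms] by (simp add: of_bool_conj)

lemma feasible_disj:
  assumes "feasible m (\<lambda>s. of_bool (P s))" "feasible m (\<lambda>s. of_bool (Q s))"
  shows "feasible m (\<lambda>s. of_bool (P s \<or> Q s))"
  using feasible_not[OF feasible_conj[OF assms[THEN feasible_not]]] by simp

lemma feasible_imp:
  assumes "feasible m (\<lambda>s. of_bool (P s))" "feasible m (\<lambda>s. of_bool (Q s))"
  shows "feasible m (\<lambda>s. of_bool (P s \<longrightarrow> Q s))"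
  using feasible_disj[OF feasible_not[OF assms(1)] assms(2)] by (simp only: imp_conv_disj)

lemma feasible_if_bool:
  assumes "feasible m (\<lambda>s. of_bool (P s))" "feasible m (\<lambda>s. of_bool (Q s))" "feasible m (\<lambda>s. of_bool (R s))"
  shows "feasible m (\<lambda>s. of_bool (if P s then Q s else R s))"
proof -
  have eq: "(if P s then of_bool (Q s) else of_bool (R s)) = (of_bool (if P s then Q s else R s) :: nat)" for s
    by simp
  show ?thesis using feasible_if[OF assms] unfolding eq .
qed

lemma feasible_le:
  assumes "feasible m f" "feasible m g" shows "feasible m (\<lambda>s. of_bool (f s \<le> g s))"
proof -
  have eq: "1 - (f s - g s) = (of_bool (f s \<le> g s) :: nat)" for s by simp
  show ?thesis using feasible_diff[OF feasible_const[of m 1] feasible_diff[OF assms]] unfolding eq .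
qed

lemma feasible_less:
  assumes "feasible m f" "feasible m g" shows "feasible m (\<lambda>s. of_bool (f s < g s))"
  using feasible_le[OF feasible_Suc[OF assms(1)] assms(2)] by (simp add: Suc_le_eq)

lemma feasible_eq:
  assumes "feasible m f" "feasible m g" shows "feasible m (\<lambda>s. of_bool (f s = g s))"
  using feasible_conj[OF feasible_le[OF assms] feasible_le[OF assms(2,1)]] by (simp add: eq_iff)

text \<open>Searching with an accumulator that advances as long as it is not a solution; after \<open>b s\<close> rounds it has
reached the least solution.\<close>

lemma feasible_Least:
  assumes b: "feasible m b" and P: "\<And>d. m \<le> d \<Longrightarrow> feasible (Suc d) (\<lambda>s. of_bool (P (var s d) s))"
    and Pd: "\<And>x. depends m (P x)" and ex: "\<And>s. \<exists>x\<le>b s. P x s"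
  shows "feasible m (\<lambda>s. LEAST x. P x s)"
proof -
  let ?F = "\<lambda>s. rec_nat 0 (\<lambda>i x. if P x s then x else Suc x)"
  have eq: "?F s k = min k (LEAST x. P x s)" for s k
  proof (induction k)
    case (Suc k)
    have L: "P (LEAST x. P x s) s" using ex[of s] by (metis LeastI)
    show ?case
    proof (cases "k < (LEAST x. P x s)")
      case True
      then have "\<not> P k s" by (rule not_less_Least)
      with True Suc show ?thesis by simp
    next
      case False with Suc L show ?thesis by simp
    qed
  qed simp
  have le: "(LEAST x. P x s) \<le> b s" for s using ex[of s] by (meson Least_le le_trans)
  have "feasible m (\<lambda>s. ?F s (b s))"
  proof (rule feasible_rec[OF feasible_zero b, where b = b])
    fix d assume "m \<le> d"
    then show "feasible (d + 3) (\<lambda>s. if P (var s d) s then var s d else Suc (var s d))"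
      by (intro feasible_if feasible_Suc feasible_var feasible_mono[OF P]) auto
  qed (use le in \<open>auto intro: qbounded_comp b simp: eq min_def depends_def depends_restrict[OF Pd]\<close>)
  then show ?thesis using le by (simp add: eq min_absorb2)
qed

lemma feasible_ex:
  assumes b: "feasible m b" and P: "\<And>d. m \<le> d \<Longrightarrow> feasible (Suc d) (\<lambda>s. of_bool (P (var s d) s))"
    and Pd: "\<And>x. depends m (P x)"
  shows "feasible m (\<lambda>s. of_bool (\<exists>x<b s. P x s))"
proof -
  let ?F = "\<lambda>s. rec_nat 0 (\<lambda>i x. if P i s then 1 else x)"
  have eq: "?F s k = of_bool (\<exists>x<k. P x s)" for s k
    by (induction k) (auto simp: less_Suc_eq)
  have "feasible m (\<lambda>s. ?F s (b s))"
  proof (rule feasible_rec[OF feasible_zero b, where b = "\<lambda>s. 1"])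
    fix d assume "m \<le> d"
    then have "feasible (Suc (d + 2)) (\<lambda>s. of_bool (P (var s (d + 2)) s))" by (intro P) simp
    then show "feasible (d + 3) (\<lambda>s. if P (var s (d + 2)) s then 1 else var s d)"
      by (intro feasible_if feasible_const feasible_var) (auto simp: numeral_3_eq_3)
  qed (auto intro: qbounded_comp feasible_const[of m 1, simplified] simp: eq[simplified] depends_def depends_restrict[OF Pd])
  then show ?thesis unfolding eq .
qed

lemma feasible_ex_le:
  assumes "feasible m b" "\<And>d. m \<le> d \<Longrightarrow> feasible (Suc d) (\<lambda>s. of_bool (P (var s d) s))" "\<And>x. depends m (P x)"
  shows "feasible m (\<lambda>s. of_bool (\<exists>x\<le>b s. P x s))"
  using feasible_ex[OF feasible_Suc[OF assms(1)] assms(2,3)] by (simp add: less_Suc_eq_le)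

lemma feasible_all:
  assumes "feasible m b" "\<And>d. m \<le> d \<Longrightarrow> feasible (Suc d) (\<lambda>s. of_bool (P (var s d) s))" "\<And>x. depends m (P x)"
  shows "feasible m (\<lambda>s. of_bool (\<forall>x<b s. P x s))"
proof -
  have "depends m (\<lambda>s. \<not> P x s)" for x using assms(3)[of x] by (simp add: depends_def)
  then have "feasible m (\<lambda>s. of_bool (\<not> (\<exists>x<b s. \<not> P x s)))"
    by (intro feasible_not feasible_ex assms(1,2))
  then show ?thesis by simp
qed

lemma feasible_all_le:
  assumes "feasible m b" "\<And>d. m \<le> d \<Longrightarrow> feasible (Suc d) (\<lambda>s. of_bool (P (var s d) s))" "\<And>x. depends m (P x)"
  shows "feasible m (\<lambda>s. of_bool (\<forall>x\<le>b s. P x s))"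
  using feasible_all[OF feasible_Suc[OF assms(1)] assms(2,3)] by (simp add: less_Suc_eq_le)

lemma feasible_mod:
  assumes f: "feasible m f" and g: "feasible m g" shows "feasible m (\<lambda>s. f s mod g s)"
proof -
  have eq: "rec_nat 0 (\<lambda>i x. if Suc x = b then 0 else Suc x) k = k mod b" for k b :: nat
    by (induction k) (auto simp: mod_Suc)
  have "feasible m (\<lambda>s. rec_nat 0 (\<lambda>i x. if Suc x = g s then 0 else Suc x) (f s))"
  proof (rule feasible_rec[OF feasible_zero f, where b = f])
    show "feasible (d + 3) (\<lambda>s. if Suc (var s d) = g s then 0 else Suc (var s d))" if "m \<le> d" for d
      using that by (intro feasible_if feasible_eq feasible_Suc feasible_var feasible_zero feasible_mono[OF g]) auto
    show "rec_nat 0 (\<lambda>i x. if Suc x = g s then 0 else Suc x) i \<le> f s" if "i \<le> f s" for i s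
      unfolding eq using that by (meson le_trans mod_less_eq_dividend)
  qed (auto intro: qbounded_comp f simp: depends_def feasible_restrict[OF g])
  then show ?thesis unfolding eq .
qed

lemma feasible_div:
  assumes f: "feasible m f" and g: "feasible m g" shows "feasible m (\<lambda>s. f s div g s)"
proof -
  have eq: "rec_nat 0 (\<lambda>i x. if Suc i mod b = 0 then Suc x else x) k = k div b" for k b :: nat
    by (induction k) (auto simp: div_Suc)
  have "feasible m (\<lambda>s. rec_nat 0 (\<lambda>i x. if Suc i mod g s = 0 then Suc x else x) (f s))"
  proof (rule feasible_rec[OF feasible_zero f, where b = f])
    show "feasible (d + 3) (\<lambda>s. if Suc (var s (d + 2)) mod g s = 0 then Suc (var s d) else var s d)" if "m \<le> d" for d
      using that by (intro feasible_if feasible_eq feasible_Suc feasible_mod feasible_var feasible_zero feasible_mono[OF g]) auto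
    show "rec_nat 0 (\<lambda>i x. if Suc i mod g s = 0 then Suc x else x) i \<le> f s" if "i \<le> f s" for i s
      unfolding eq using that by (meson le_trans div_le_dividend)
  qed (auto intro: qbounded_comp f simp: depends_def feasible_restrict[OF g])
  then show ?thesis unfolding eq .
qed

text \<open>The power itself may be far beyond any quasipolynomial bound, but repeated division never leaves the
range of the dividend.\<close>

lemma feasible_div_power:
  assumes f: "feasible m f" and b: "feasible m b" and g: "feasible m g" shows "feasible m (\<lambda>s. f s div b s ^ g s)"
proof -
  have eq: "rec_nat a (\<lambda>i x. x div c) k = a div c ^ k" for a c k :: nat
    by (induction k) (auto simp: div_mult2_eq[symmetric] mult.commute)
  have "feasible m (\<lambda>s. rec_nat (f s) (\<lambda>i x. x div b s) (g s))"
    by (rule feasible_rec[OF f g, where b = f])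
      (auto intro!: qbounded_comp f feasible_div feasible_var feasible_mono[OF b] simp: eq depends_def feasible_restrict[OF b])
  then show ?thesis unfolding eq .
qed

lemma feasible_exp:
  assumes f: "feasible m f" and q: "qbounded m (\<lambda>s. 2 ^ f s)" shows "feasible m (\<lambda>s. 2 ^ f s)"
proof -
  have eq: "rec_nat (1::nat) (\<lambda>i x. x + x) k = 2 ^ k" for k :: nat by (induction k) auto
  have "feasible m (\<lambda>s. rec_nat 1 (\<lambda>i x. x + x) (f s))"
  proof (rule feasible_rec[OF feasible_const f, where b = "\<lambda>s. 2 ^ f s"])
    show "rec_nat (1::nat) (\<lambda>i x. x + x) i \<le> 2 ^ f s" if "i \<le> f s" for i s
      unfolding eq using that by (intro power_increasing) auto
  qed (auto intro!: q feasible_add feasible_var simp: depends_def)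
  then show ?thesis unfolding eq .
qed

lemma mem_table: "y \<in> table P n \<longleftrightarrow> y < n \<and> P (table P y) y"
  using table_bound[of P] by (induction n) (auto simp: less_Suc_eq)

text \<open>The vertices reachable after \<open>c\<close> steps in a graph on \<open>{..<X}\<close> whose edges depend on the number of the
step. Parsing as well as coloring are phrased as such walks.\<close>

primrec layer :: "nat \<Rightarrow> (nat \<Rightarrow> bool) \<Rightarrow> (nat \<Rightarrow> nat \<Rightarrow> nat \<Rightarrow> bool) \<Rightarrow> nat \<Rightarrow> nat set" where
  "layer X I R 0 = {x. x < X \<and> I x}"
| "layer X I R (Suc c) = {y. y < X \<and> (\<exists>x<X. x \<in> layer X I R c \<and> R c x y)}"

lemma layer_bound: "x \<in> layer X I R c \<Longrightarrow> x < X"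
  by (cases c) auto

text \<open>All layers are stored in one table, vertex \<open>x\<close> of layer \<open>c\<close> at index \<open>c * X + x\<close>, so that each layer only
refers to smaller indices.\<close>

lemma layer_table:
  fixes X :: nat and I :: "nat \<Rightarrow> bool" and R :: "nat \<Rightarrow> nat \<Rightarrow> nat \<Rightarrow> bool"
  defines "P \<equiv> \<lambda>A y. if y div X = 0 then I (y mod X)
    else \<exists>x<X. (y div X - 1) * X + x \<in> A \<and> R (y div X - 1) x (y mod X)"
  shows "x < X \<Longrightarrow> c * X + x \<in> table P n \<longleftrightarrow> c * X + x < n \<and> x \<in> layer X I R c"
proof (induction c arbitrary: x n)
  case 0 then show ?case by (simp add: mem_table P_def)
next
  case (Suc c)
  let ?y = "Suc c * X + x"
  have y: "?y div X = Suc c" "?y mod X = x" using Suc.prems by (simp_all del: mult_Suc)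
  have "c * X + x' < ?y" if "x' < X" for x' using that by simp
  then have "(\<exists>x'<X. c * X + x' \<in> table P ?y \<and> R c x' x) \<longleftrightarrow> (\<exists>x'<X. x' \<in> layer X I R c \<and> R c x' x)"
    using Suc.IH by blast
  moreover have "P (table P ?y) ?y \<longleftrightarrow> (\<exists>x'<X. c * X + x' \<in> table P ?y \<and> R c x' x)"
    unfolding P_def y by simp
  ultimately show ?case using Suc.prems mem_table[of ?y P n] by simp
qed

lemma feasible_layer:
  assumes X: "feasible m X"
    and I: "\<And>d x. m \<le> d \<Longrightarrow> feasible d x \<Longrightarrow> feasible d (\<lambda>s. of_bool (I (x s) s))" and Id: "\<And>x. depends m (I x)"
    and R: "\<And>d c x y. m \<le> d \<Longrightarrow> feasible d c \<Longrightarrow> feasible d x \<Longrightarrow> feasible d y \<Longrightarrow>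
         feasible d (\<lambda>s. of_bool (R (c s) (x s) (y s) s))" and Rd: "\<And>c x y. depends m (R c x y)"
    and t: "feasible m t" and k: "feasible m k"
  shows "feasible m (\<lambda>s. of_bool (t s \<in> layer (X s) (\<lambda>x. I x s) (\<lambda>c x y. R c x y s) (k s)))"
proof -
  let ?P = "\<lambda>A y s. if y div X s = 0 then I (y mod X s) s
    else \<exists>x<X s. (y div X s - 1) * X s + x \<in> A \<and> R (y div X s - 1) x (y mod X s) s"
  let ?n = "\<lambda>s. Suc (k s) * X s"
  have eq: "t s < X s \<and> k s * X s + t s \<in> table (\<lambda>A y. ?P A y s) (?n s) \<longleftrightarrow>
      t s \<in> layer (X s) (\<lambda>x. I x s) (\<lambda>c x y. R c x y s) (k s)" for s
  proof (cases "t s < X s")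
    case True
    then have "k s * X s + t s < ?n s" by simp
    with True show ?thesis
      using layer_table[OF True, of "k s" "\<lambda>x. I x s" "\<lambda>c x y. R c x y s" "?n s"] by (simp only: simp_thms)
  qed (use layer_bound in blast)
  have "feasible m (\<lambda>s. of_bool (t s < X s \<and> k s * X s + t s \<in> table (\<lambda>A y. ?P A y s) (?n s)))"
  proof (intro feasible_conj feasible_less feasible_table feasible_add feasible_mult feasible_Suc t X k)
    show "depends m (?P A y)" for A y
      by (simp add: depends_def feasible_restrict[OF X] depends_restrict[OF Id] depends_restrict[OF Rd])
    fix d assume "m \<le> d"
    then show "feasible (d + 2) (\<lambda>s. of_bool (?P (arr s d) (var s (d + 1)) s))"
      by (intro feasible_if_bool feasible_conj feasible_eq feasible_div feasible_mod feasible_ex feasible_mem feasible_add feasible_mult feasible_diff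
          feasible_var feasible_const I R feasible_mono[OF X])
        (auto simp: depends_def feasible_restrict[OF X] depends_restrict[OF Rd])
  qed
  then show ?thesis unfolding eq .
qed


section \<open>Conflict-free colorings of intervals\<close>

text \<open>The ruler sequence 1, 2, 1, 3, 1, 2, 1, 4, ...; on positive numbers it is one plus the exponent of two.\<close>

fun ruler :: "nat \<Rightarrow> nat" where
  "ruler v = (if v = 0 then 0 else if odd v then 1 else Suc (ruler (v div 2)))"

declare ruler.simps [simp del]

lemma ruler_le: "v < 2 ^ l \<Longrightarrow> ruler v \<le> l"
proof (induction l arbitrary: v)
  case 0 then show ?case by (simp add: ruler.simps)
next
  case (Suc l)
  have "v div 2 < 2 ^ l" using Suc.prems by simp
  from Suc.IH[OF this] show ?case by (subst ruler.simps) auto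
qed

text \<open>Unless the interval is a point, it contains even numbers, and these form a copy of a smaller interval
with all colors raised by one. Odd numbers have color 1, which is not the successor of a positive color,
so they do not interfere.\<close>

lemma ruler_unique:
  assumes "1 \<le> s" "s \<le> t"
  shows "\<exists>i>0. card {v \<in> {s..t}. ruler v = i} = 1"
  using assms
proof (induction t arbitrary: s rule: less_induct)
  case (less t)
  show ?case
  proof (cases "s = t")
    case True
    have "{v \<in> {s..t}. ruler v = ruler t} = {t}" using True by auto
    moreover have "ruler t > 0" using less.prems by (subst ruler.simps) auto
    ultimately show ?thesis by (intro exI[of _ "ruler t"]) simp
  next
    case False
    define s' where "s' = Suc s div 2"
    have "t div 2 < t" "1 \<le> s'" "s' \<le> t div 2" using False less.prems by (auto simp: s'_def)
    from less.IH[OF this] obtain i where i: "i > 0" "card {v \<in> {s'..t div 2}. ruler v = i} = 1" by blast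
    have "{v \<in> {s..t}. ruler v = Suc i} = (\<lambda>v. 2 * v) ` {v \<in> {s'..t div 2}. ruler v = i}" (is "?L = ?R")
    proof (intro equalityI subsetI)
      fix v assume v: "v \<in> ?L"
      then have "even v \<and> ruler (v div 2) = i" using i(1) by (subst (asm) ruler.simps) (auto split: if_splits)
      then obtain x where x: "v = 2 * x" "ruler x = i" by (auto elim: evenE)
      moreover have "s' \<le> x" "x \<le> t div 2" using v x(1) by (auto simp: s'_def)
      ultimately show "v \<in> ?R" by auto
    next
      fix v assume "v \<in> ?R"
      then obtain x where x: "v = 2 * x" "s' \<le> x" "x \<le> t div 2" "ruler x = i" by auto
      then have "ruler v = Suc i" using \<open>1 \<le> s'\<close> by (subst ruler.simps) auto
      moreover have "s \<le> v" "v \<le> t" using x by (auto simp: s'_def)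
      ultimately show "v \<in> ?L" by simp
    qed
    then have "card {v \<in> {s..t}. ruler v = Suc i} = 1" using i(2) by (simp add: card_image inj_on_def)
    then show ?thesis by blast
  qed
qed

lemma intervals_iff: "S \<in> intervals n \<longleftrightarrow> (\<exists>s t. S = {s..t} \<and> 1 \<le> s \<and> s \<le> t \<and> t \<le> n)"
  by (auto simp: intervals_def)

lemma cf_coloring_intervals:
  assumes "I \<subseteq> intervals n"
  shows "cf_coloring {1..n} I C \<longleftrightarrow>
    (\<forall>t\<in>{1..n}. \<forall>s\<in>{1..t}. {s..t} \<in> I \<longrightarrow> (\<exists>i>0. card {v \<in> {s..t}. C v = i} = 1))"
proof -
  have eq: "{s..t} \<inter> {v \<in> {1..n}. C v = i} = {v \<in> {s..t}. C v = i}" if "1 \<le> s" "t \<le> n" for s t i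
    using that by auto
  show ?thesis
  proof
    assume L: "cf_coloring {1..n} I C"
    show "\<forall>t\<in>{1..n}. \<forall>s\<in>{1..t}. {s..t} \<in> I \<longrightarrow> (\<exists>i>0. card {v \<in> {s..t}. C v = i} = 1)"
    proof (intro ballI impI)
      fix t s assume st: "t \<in> {1..n}" "s \<in> {1..t}" "{s..t} \<in> I"
      then have "\<exists>i>0. card ({s..t} \<inter> {v \<in> {1..n}. C v = i}) = 1" using L unfolding cf_coloring_def by blast
      moreover have "1 \<le> s" "t \<le> n" using st by auto
      ultimately show "\<exists>i>0. card {v \<in> {s..t}. C v = i} = 1" by (simp only: eq)
    qed
  next
    assume R: "\<forall>t\<in>{1..n}. \<forall>s\<in>{1..t}. {s..t} \<in> I \<longrightarrow> (\<exists>i>0. card {v \<in> {s..t}. C v = i} = 1)"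
    show "cf_coloring {1..n} I C"
      unfolding cf_coloring_def
    proof
      fix S assume S: "S \<in> I"
      then have "S \<in> intervals n" using assms by blast
      then obtain s t where "S = {s..t}" "1 \<le> s" "s \<le> t" "t \<le> n" unfolding intervals_iff by blast
      moreover from this S R have "\<exists>i>0. card {v \<in> {s..t}. C v = i} = 1" by auto
      ultimately show "\<exists>i>0. card (S \<inter> {v \<in> {1..n}. C v = i}) = 1" by (simp only: eq)
    qed
  qed
qed

definition colorable :: "nat \<Rightarrow> nat set set \<Rightarrow> nat \<Rightarrow> bool" where
  "colorable n I k \<longleftrightarrow> (\<exists>C. cf_coloring {1..n} I C \<and> C ` {1..n} \<subseteq> {0..k})"

lemma colorable_log:
  assumes "I \<subseteq> intervals n" "n < 2 ^ l" shows "colorable n I l"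
  unfolding colorable_def
proof (intro exI conjI)
  show "cf_coloring {1..n} I ruler"
    unfolding cf_coloring_intervals[OF assms(1)] using ruler_unique by auto
  show "ruler ` {1..n} \<subseteq> {0..l}" using assms(2) by (auto intro!: ruler_le)
qed

text \<open>Since \<open>l\<close> colors suffice in any case, only numbers of colors up to \<open>l\<close> need to be tried, however large \<open>k\<close>
is.\<close>

lemma chi_cf_le_iff:
  assumes "I \<subseteq> intervals n" "n < 2 ^ l"
  shows "chi_cf {1..n} I \<le> k \<longleftrightarrow> (\<exists>j\<le>l. j \<le> k \<and> colorable n I j)"
proof -
  have chi: "chi_cf {1..n} I = (LEAST k. colorable n I k)" by (simp add: chi_cf_def colorable_def)
  have c: "colorable n I (LEAST k. colorable n I k)" "(LEAST k. colorable n I k) \<le> l"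
    using colorable_log[OF assms] by (auto intro: LeastI Least_le)
  show ?thesis unfolding chi using c by (meson Least_le le_trans)
qed

text \<open>Positions start at 1, so 0 serves for a missing occurrence.\<close>

primrec last_occ :: "(nat \<Rightarrow> nat) \<Rightarrow> nat \<Rightarrow> nat \<Rightarrow> nat" where
  "last_occ C i 0 = 0"
| "last_occ C i (Suc t) = (if C (Suc t) = i then Suc t else last_occ C i t)"

primrec prev_occ :: "(nat \<Rightarrow> nat) \<Rightarrow> nat \<Rightarrow> nat \<Rightarrow> nat" where
  "prev_occ C i 0 = 0"
| "prev_occ C i (Suc t) = (if C (Suc t) = i then last_occ C i t else prev_occ C i t)"

lemma last_occ_le: "last_occ C i t \<le> t"
  by (induction t) auto

lemma occ_le: "last_occ C i t \<le> t" "prev_occ C i t \<le> t"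
  using last_occ_le by (induction t) (auto intro: le_SucI)

lemma occ_cong: "(\<And>v. v \<le> t \<Longrightarrow> C v = C' v) \<Longrightarrow>
    last_occ C i t = last_occ C' i t \<and> prev_occ C i t = prev_occ C' i t"
  by (induction t) auto

text \<open>The last occurrence lies in the interval iff there is at least one, and the previous one iff there
are at least two.\<close>

lemma occ_card:
  assumes "1 \<le> s"
  shows "(s \<le> last_occ C i t \<longleftrightarrow> 1 \<le> card {v \<in> {s..t}. C v = i}) \<and>
    (s \<le> prev_occ C i t \<longleftrightarrow> 2 \<le> card {v \<in> {s..t}. C v = i})"
proof (induction t)
  case 0
  have "{v \<in> {s..0}. C v = i} = {}" using assms by auto
  with assms show ?case by (metis card.empty last_occ.simps(1) not_one_le_zero not_numeral_le_zero prev_occ.simps(1) le_zero_eq)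
next
  case (Suc t)
  define a where "a = card {v \<in> {s..t}. C v = i}"
  define b where "b = card {v \<in> {s..Suc t}. C v = i}"
  have IH: "s \<le> last_occ C i t \<longleftrightarrow> 1 \<le> a" "s \<le> prev_occ C i t \<longleftrightarrow> 2 \<le> a" using Suc by (simp_all add: a_def)
  have b: "b = (if s \<le> Suc t \<and> C (Suc t) = i then Suc a else a)"
  proof (cases "s \<le> Suc t \<and> C (Suc t) = i")
    case True
    then have "{v \<in> {s..Suc t}. C v = i} = insert (Suc t) {v \<in> {s..t}. C v = i}" by auto
    moreover have "card (insert (Suc t) {v \<in> {s..t}. C v = i}) = Suc a"
      unfolding a_def by (subst card_insert_disjoint) auto
    ultimately have "b = Suc a" by (simp only: b_def)
    with True show ?thesis by simp
  next
    case False
    then have "{v \<in> {s..Suc t}. C v = i} = {v \<in> {s..t}. C v = i}" by (auto simp: le_Suc_eq)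
    then have "b = a" by (simp only: a_def b_def)
    with False show ?thesis by simp
  qed
  show ?case unfolding b_def[symmetric] b using IH occ_le[of C i t] by auto
qed

lemma unique_occ_iff:
  "1 \<le> s \<Longrightarrow> card {v \<in> {s..t}. C v = i} = 1 \<longleftrightarrow> s \<le> last_occ C i t \<and> prev_occ C i t < s"
  using occ_card[of s C i t] by auto

text \<open>The state of the search, two positions for each of \<open>k\<close> colors, is coded as a number with \<open>2 * k\<close> digits
in base \<open>D\<close>.\<close>

definition digit :: "nat \<Rightarrow> nat \<Rightarrow> nat \<Rightarrow> nat" where
  "digit D x j = x div D ^ j mod D"

lemma digits_exist: "(\<And>j. j < l \<Longrightarrow> f j < D) \<Longrightarrow> \<exists>x<D ^ l. \<forall>j<l. digit D x j = f j"
proof (induction l arbitrary: f)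
  case (Suc l)
  obtain x where x: "x < D ^ l" "\<And>j. j < l \<Longrightarrow> digit D x j = f (Suc j)"
    using Suc.IH[of "\<lambda>j. f (Suc j)"] Suc.prems by auto
  have f0: "f 0 < D" using Suc.prems by simp
  have "digit D (f 0 + D * x) j = f j" if "j < Suc l" for j
  proof (cases j)
    case (Suc i)
    have "(f 0 + D * x) div D = x" using f0 by simp
    then show ?thesis using Suc that x(2)[of i] by (simp add: digit_def div_mult2_eq)
  qed (use f0 in \<open>simp add: digit_def\<close>)
  moreover have "f 0 + D * x < D ^ Suc l"
  proof -
    have "f 0 + D * x < D * Suc x" using f0 by simp
    also have "D * Suc x \<le> D * D ^ l" using x(1) by (intro mult_le_mono2) simp
    finally show ?thesis by simp
  qed
  ultimately show ?case by blast
qed (simp add: digit_def)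

text \<open>Point \<open>Suc t\<close> receives some color \<open>c \<le> k\<close>, where \<open>c = 0\<close> leaves all digits alone. Color \<open>Suc i\<close> owns the digits
\<open>2 * i\<close> (last occurrence) and \<open>2 * i + 1\<close> (previous occurrence).\<close>

definition recolor :: "nat \<Rightarrow> nat \<Rightarrow> nat \<Rightarrow> nat \<Rightarrow> nat \<Rightarrow> bool" where
  "recolor D k t x y \<longleftrightarrow> (\<exists>c\<le>k. \<forall>i<k. if Suc i = c
      then digit D y (2 * i) = Suc t \<and> digit D y (2 * i + 1) = digit D x (2 * i)
      else digit D y (2 * i) = digit D x (2 * i) \<and> digit D y (2 * i + 1) = digit D x (2 * i + 1))"

definition satisfied :: "nat \<Rightarrow> nat \<Rightarrow> nat \<Rightarrow> nat \<Rightarrow> bool" where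
  "satisfied D k s x \<longleftrightarrow> (\<exists>i<k. s \<le> digit D x (2 * i) \<and> digit D x (2 * i + 1) < s)"

definition represents :: "nat \<Rightarrow> nat \<Rightarrow> nat \<Rightarrow> (nat \<Rightarrow> nat) \<Rightarrow> nat \<Rightarrow> bool" where
  "represents D k x C t \<longleftrightarrow> (\<forall>i<k. digit D x (2 * i) = last_occ C (Suc i) t \<and>
     digit D x (2 * i + 1) = prev_occ C (Suc i) t)"

lemma satisfied_iff:
  assumes "represents D k x C t" "1 \<le> s"
  shows "satisfied D k s x \<longleftrightarrow> (\<exists>i\<in>{1..k}. card {v \<in> {s..t}. C v = i} = 1)"
proof -
  have "satisfied D k s x \<longleftrightarrow> (\<exists>i<k. card {v \<in> {s..t}. C v = Suc i} = 1)"
    using assms(1) unfolding satisfied_def represents_def unique_occ_iff[OF assms(2)] by auto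
  also have "\<dots> \<longleftrightarrow> (\<exists>i\<in>{1..k}. card {v \<in> {s..t}. C v = i} = 1)"
  proof
    assume "\<exists>i\<in>{1..k}. card {v \<in> {s..t}. C v = i} = 1"
    then obtain i where "i \<in> {1..k}" "card {v \<in> {s..t}. C v = i} = 1" by blast
    then show "\<exists>i<k. card {v \<in> {s..t}. C v = Suc i} = 1" by (intro exI[of _ "i - 1"]) auto
  qed auto
  finally show ?thesis .
qed

text \<open>Walks through the graph of states correspond to colorings. From a walk, the color of each point is read
off the step that enters its layer. Conversely, the positions determined by a coloring are smaller than
\<open>D\<close> and so are the digits of some state below \<open>D ^ (2 * k)\<close>. The hyperedges ending at \<open>t\<close> are checked as soon
as point \<open>t\<close> is colored.\<close>

lemma layer_coloring:
  fixes E :: "nat \<Rightarrow> nat \<Rightarrow> bool"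
  defines "R \<equiv> \<lambda>k D t x y. recolor D k t x y \<and> (\<forall>s\<le>Suc t. 1 \<le> s \<and> E s (Suc t) \<longrightarrow> satisfied D k s y)"
  assumes n: "n < D" and X: "D ^ (2 * k) \<le> X"
  shows "(\<exists>x. x \<in> layer X (\<lambda>x. x = 0) (R k D) n) \<longleftrightarrow>
    (\<exists>C. (\<forall>v\<in>{1..n}. C v \<le> k) \<and> (\<forall>t\<in>{1..n}. \<forall>s\<in>{1..t}. E s t \<longrightarrow> (\<exists>i>0. card {v \<in> {s..t}. C v = i} = 1)))"
    (is "?L \<longleftrightarrow> (\<exists>C. ?ok C)")
proof
  have fwd: "\<exists>C. (\<forall>v. C v \<le> k) \<and> represents D k x C t \<and>
      (\<forall>t'\<in>{1..t}. \<forall>s\<in>{1..t'}. E s t' \<longrightarrow> (\<exists>i\<in>{1..k}. card {v \<in> {s..t'}. C v = i} = 1))"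
    if "x \<in> layer X (\<lambda>x. x = 0) (R k D) t" for t x
    using that
  proof (induction t arbitrary: x)
    case 0
    then show ?case by (intro exI[of _ "\<lambda>_. 0"]) (auto simp: represents_def digit_def)
  next
    case (Suc t)
    then obtain y where y: "y \<in> layer X (\<lambda>x. x = 0) (R k D) t" "R k D t y x" by auto
    then obtain C where C: "\<And>v. C v \<le> k" "represents D k y C t"
      "\<And>t' s. t' \<in> {1..t} \<Longrightarrow> s \<in> {1..t'} \<Longrightarrow> E s t' \<Longrightarrow> \<exists>i\<in>{1..k}. card {v \<in> {s..t'}. C v = i} = 1"
      using Suc.IH by blast
    obtain c where c: "c \<le> k" "\<And>i. i < k \<Longrightarrow> if Suc i = c
      then digit D x (2 * i) = Suc t \<and> digit D x (2 * i + 1) = digit D y (2 * i)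
      else digit D x (2 * i) = digit D y (2 * i) \<and> digit D x (2 * i + 1) = digit D y (2 * i + 1)"
      using y(2) by (auto simp: R_def recolor_def)
    define C' where "C' = C(Suc t := c)"
    have occ: "last_occ C' i t = last_occ C i t" "prev_occ C' i t = prev_occ C i t" for i
      using occ_cong[of t C' C i] by (auto simp: C'_def)
    have rep: "represents D k x C' (Suc t)"
      unfolding represents_def
    proof (intro allI impI)
      fix i assume i: "i < k"
      have "C' (Suc t) = c" by (simp add: C'_def)
      then show "digit D x (2 * i) = last_occ C' (Suc i) (Suc t) \<and>
          digit D x (2 * i + 1) = prev_occ C' (Suc i) (Suc t)"
        using c(2)[OF i] C(2) i by (auto simp: occ represents_def split: if_splits)
    qed
    have "\<exists>i\<in>{1..k}. card {v \<in> {s..t'}. C' v = i} = 1" if t': "t' \<in> {1..Suc t}" "s \<in> {1..t'}" "E s t'" for t' s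
    proof (cases "t' = Suc t")
      case True
      then have "satisfied D k s x" using y(2) t' by (auto simp: R_def)
      then show ?thesis using satisfied_iff[OF rep] t' True by auto
    next
      case False
      then have "t' \<in> {1..t}" using t' by auto
      moreover have "{v \<in> {s..t'}. C' v = i} = {v \<in> {s..t'}. C v = i}" for i
        using calculation by (auto simp: C'_def)
      ultimately show ?thesis using C(3) t' by simp
    qed
    moreover have "C' v \<le> k" for v using C(1) c(1) by (simp add: C'_def)
    ultimately show ?case using rep by blast
  qed
  assume ?L
  then obtain x where "x \<in> layer X (\<lambda>x. x = 0) (R k D) n" by blast
  from fwd[OF this] obtain C where C: "\<forall>v. C v \<le> k"
    "\<forall>t'\<in>{1..n}. \<forall>s\<in>{1..t'}. E s t' \<longrightarrow> (\<exists>i\<in>{1..k}. card {v \<in> {s..t'}. C v = i} = 1)" by blast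
  show "\<exists>C. ?ok C"
  proof (rule exI[of _ C], intro conjI ballI impI)
    fix v show "C v \<le> k" using C(1) by (rule spec)
  next
    fix t s assume "t \<in> {1..n}" "s \<in> {1..t}" "E s t"
    then obtain i where i: "i \<in> {1..k}" "card {v \<in> {s..t}. C v = i} = 1" using C(2) by blast
    then have "i > 0" by simp
    with i(2) show "\<exists>i>0. card {v \<in> {s..t}. C v = i} = 1" by (intro exI conjI)
  qed
next
  assume "\<exists>C. ?ok C"
  then obtain C where C: "\<And>v. v \<in> {1..n} \<Longrightarrow> C v \<le> k"
    "\<And>t s. t \<in> {1..n} \<Longrightarrow> s \<in> {1..t} \<Longrightarrow> E s t \<Longrightarrow> \<exists>i>0. card {v \<in> {s..t}. C v = i} = 1" by blast
  have ex: "\<exists>x<X. represents D k x C t" if "t \<le> n" for t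
  proof -
    let ?f = "\<lambda>j. if even j then last_occ C (Suc (j div 2)) t else prev_occ C (Suc (j div 2)) t"
    have "?f j < D" for j using occ_le[of C "Suc (j div 2)" t] that n by simp
    then obtain x where "x < D ^ (2 * k)" "\<forall>j<2 * k. digit D x j = ?f j"
      using digits_exist[of "2 * k" ?f D] by blast
    then show ?thesis using X by (intro exI[of _ x]) (auto simp: represents_def)
  qed
  have "\<exists>x. x \<in> layer X (\<lambda>x. x = 0) (R k D) t \<and> represents D k x C t" if "t \<le> n" for t
    using that
  proof (induction t)
    case 0
    have "0 < X" using X n by (metis gr0I le_zero_eq not_less0 power_eq_0_iff)
    then show ?case by (intro exI[of _ 0]) (auto simp: represents_def digit_def)
  next
    case (Suc t)
    then obtain x where x: "x \<in> layer X (\<lambda>x. x = 0) (R k D) t" "represents D k x C t" by auto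
    obtain y where y: "y < X" "represents D k y C (Suc t)" using ex[OF Suc.prems] by blast
    have "recolor D k t x y"
      unfolding recolor_def using x(2) y(2) C(1)[of "Suc t"] Suc.prems
      by (intro exI[of _ "C (Suc t)"]) (auto simp: represents_def)
    moreover have "satisfied D k s y" if s: "s \<le> Suc t" "1 \<le> s" "E s (Suc t)" for s
    proof -
      have "Suc t \<in> {1..n}" "s \<in> {1..Suc t}" using s Suc.prems by auto
      from C(2)[OF this s(3)] obtain i where i: "i > 0" "card {v \<in> {s..Suc t}. C v = i} = 1" by blast
      then have "{v \<in> {s..Suc t}. C v = i} \<noteq> {}" by (metis card.empty zero_neq_one)
      then obtain v where "v \<in> {s..Suc t}" "C v = i" by blast
      then have "i \<in> {1..k}" using C(1)[of v] s Suc.prems i(1) by auto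
      with i(2) show ?thesis unfolding satisfied_iff[OF y(2) s(2)] by (rule bexI)
    qed
    ultimately have "R k D t x y" by (simp add: R_def)
    then have "y \<in> layer X (\<lambda>x. x = 0) (R k D) (Suc t)"
      using x(1) y(1) layer_bound[OF x(1)] by auto
    with y(2) show ?case by blast
  qed
  from this[of n] show ?L by auto
qed


section \<open>Reading the encoding\<close>

text \<open>The factor of \<open>w\<close> from position \<open>p\<close> up to, but excluding, position \<open>q\<close> is \<open>u\<close>. Concatenation of words
becomes composition of relations on positions, so that grammars turn into walks.\<close>

definition seg :: "letter list \<Rightarrow> nat \<Rightarrow> nat \<Rightarrow> letter list \<Rightarrow> bool" where
  "seg w p q u \<longleftrightarrow> (\<exists>x y. w = x @ u @ y \<and> length x = p \<and> q = p + length u)"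

lemma seg_le: "seg w p q u \<Longrightarrow> p \<le> q \<and> q \<le> length w"
  by (auto simp: seg_def)

lemma seg_append: "seg w p q (u @ v) \<longleftrightarrow> (\<exists>r. seg w p r u \<and> seg w r q v)"
proof
  assume "seg w p q (u @ v)"
  then obtain x y where "w = x @ (u @ v) @ y" "length x = p" "q = p + length (u @ v)" by (auto simp: seg_def)
  then have "seg w p (p + length u) u" "seg w (p + length u) q v"
    unfolding seg_def by (metis append_assoc, metis append_assoc length_append add.assoc)
  then show "\<exists>r. seg w p r u \<and> seg w r q v" by blast
next
  assume "\<exists>r. seg w p r u \<and> seg w r q v"
  then obtain r where r: "seg w p r u" "seg w r q v" by blast
  obtain x y where x: "w = x @ u @ y" "length x = p" "r = p + length u" using r(1) by (auto simp: seg_def)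
  obtain x' y' where "w = x' @ v @ y'" "length x' = r" "q = r + length v" using r(2) by (auto simp: seg_def)
  with x have *: "w = x @ u @ y" "length x = p" "w = x' @ v @ y'" "length x' = p + length u"
    "q = p + length u + length v" by simp_all
  then have "y = v @ y'" using append_eq_append_conv[of "x @ u" x' y "v @ y'"] by simp
  with * have "w = x @ (u @ v) @ y'" "length x = p" "q = p + length (u @ v)" by simp_all
  then show "seg w p q (u @ v)" unfolding seg_def by blast
qed

lemma seg_Nil: "seg w p q [] \<longleftrightarrow> p = q \<and> q \<le> length w"
proof
  assume "p = q \<and> q \<le> length w"
  then show "seg w p q []" unfolding seg_def by (intro exI[of _ "take p w"] exI[of _ "drop p w"]) simp
qed (auto simp: seg_def)

lemma seg_single: "seg w p q [a] \<longleftrightarrow> q = Suc p \<and> letter_at w p a"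
proof
  assume "q = Suc p \<and> letter_at w p a"
  then show "seg w p q [a]" unfolding seg_def letter_at_def
    by (intro exI[of _ "take p w"] exI[of _ "drop (Suc p) w"]) (auto simp: Cons_nth_drop_Suc)
qed (auto simp: seg_def letter_at_def)

text \<open>A description of numerals by divisions of the coded number, each of which stays in its range. The
second disjunct excludes leading zeros.\<close>

lemma seg_binary: "seg w p q (binary k) \<longleftrightarrow> p < q \<and> k div 2 ^ (q - p) = 0 \<and>
    (q = Suc p \<or> k div 2 ^ (q - p - 1) \<noteq> 0) \<and>
    (\<forall>i<q - p. letter_at w (q - 1 - i) (Bit (odd (k div 2 ^ i))))"
proof (induction k arbitrary: q rule: binary.induct)
  case (1 k)
  show ?case
  proof (cases "k < 2")
    case True
    have "k div 2 ^ (q - p - 1) = 0" if "p < q" "q \<noteq> Suc p"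
    proof -
      have "2 ^ 1 \<le> (2::nat) ^ (q - p - 1)" using that by (intro power_increasing) auto
      with True show ?thesis by simp
    qed
    then have "q \<noteq> Suc p \<Longrightarrow> \<not> (p < q \<and> k div 2 ^ (q - p - 1) \<noteq> 0)" by metis
    moreover have "(k = 1) = odd k" using True by (auto simp: less_2_cases_iff)
    moreover have "binary k = [Bit (k = 1)]" using True by (subst binary.simps) simp
    ultimately show ?thesis using True by (cases "q = Suc p") (auto simp: seg_single)
  next
    case False
    have gt: "q \<noteq> Suc p" "p < q" if "p < q" "k div 2 ^ (q - p) = 0"
      using that False by auto
    have "seg w p q (binary k) \<longleftrightarrow>
        (\<exists>r. seg w p r (binary (k div 2)) \<and> q = Suc r \<and> letter_at w r (Bit (odd k)))"
      using False by (subst binary.simps) (simp add: seg_append seg_single)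
    also have "\<dots> \<longleftrightarrow> p < q \<and> k div 2 ^ (q - p) = 0 \<and> (q = Suc p \<or> k div 2 ^ (q - p - 1) \<noteq> 0) \<and>
        (\<forall>i<q - p. letter_at w (q - 1 - i) (Bit (odd (k div 2 ^ i))))" (is "_ \<longleftrightarrow> ?R q")
    proof (cases "\<exists>r. q = Suc r \<and> p < r")
      case True
      then obtain r where r: "q = Suc r" "p < r" by blast
      then obtain c where c: "r = Suc (p + c)" by (metis less_imp_Suc_add)
      have "(\<forall>i<q - p. letter_at w (q - 1 - i) (Bit (odd (k div 2 ^ i)))) \<longleftrightarrow>
          letter_at w r (Bit (odd k)) \<and> (\<forall>i<r - p. letter_at w (r - 1 - i) (Bit (odd (k div 2 div 2 ^ i))))"
        by (simp add: r(1) c All_less_Suc2 div_mult2_eq)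
      moreover have "r = Suc p \<or> k div 2 div 2 ^ (r - p - 1) \<noteq> 0 \<longleftrightarrow> k div 2 ^ (q - p - 1) \<noteq> 0"
        using False by (cases "c = 0") (auto simp: r(1) c div_mult2_eq)
      moreover have "k div 2 div 2 ^ (r - p) = 0 \<longleftrightarrow> k div 2 ^ (q - p) = 0"
        by (simp add: r(1) c flip: div_mult2_eq)
      ultimately show ?thesis using "1.IH"[OF False, of r] r by auto
    next
      case F: False
      have "\<not> ?R q" using gt F by (metis Suc_lessI less_imp_Suc_add less_Suc_eq)
      moreover have "\<not> (\<exists>r. seg w p r (binary (k div 2)) \<and> q = Suc r \<and> letter_at w r (Bit (odd k)))"
        using "1.IH"[OF False] F by blast
      ultimately show ?thesis by blast
    qed
    finally show ?thesis .
  qed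
qed

fun value_of :: "nat \<Rightarrow> letter \<Rightarrow> nat" where
  "value_of a (Bit b) = 2 * a + of_bool b"
| "value_of a _ = 2 * a"

lemma value_binary: "foldl value_of 0 (binary k) = k"
  by (induction k rule: binary.induct) (subst binary.simps, auto simp: less_2_cases_iff)

lemma binary_inj: "binary k = binary l \<longleftrightarrow> k = l"
  by (metis value_binary)

lemma set_binary: "set (binary k) \<subseteq> range Bit"
  by (induction k rule: binary.induct) (subst binary.simps, auto)

lemma binary_ne: "binary k \<noteq> []"
  by (subst binary.simps) simp

lemma numeral_iff: "(\<exists>k. u = binary k) \<longleftrightarrow> u \<noteq> [] \<and> set u \<subseteq> range Bit \<and> (length u = 1 \<or> hd u = Bit True)"
proof
  have "binary k \<noteq> [] \<and> (length (binary k) = 1 \<or> hd (binary k) = Bit True)" for k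
  proof (induction k rule: binary.induct)
    case (1 k)
    show ?case
    proof (cases "k < 2")
      case True then show ?thesis by (subst (1 2 3) binary.simps) simp
    next
      case False
      then have b: "binary k = binary (k div 2) @ [Bit (odd k)]" by (subst binary.simps) simp
      have "hd (binary (k div 2)) = Bit True"
      proof (cases "length (binary (k div 2)) = 1")
        case True
        have "k div 2 < 2"
        proof (rule ccontr)
          assume "\<not> k div 2 < 2"
          then have "binary (k div 2) = binary (k div 2 div 2) @ [Bit (odd (k div 2))]" by (subst binary.simps) simp
          with True show False by (simp add: binary_ne)
        qed
        then have "k div 2 = 1" using False by (auto simp: less_2_cases_iff)
        then show ?thesis by (simp add: binary.simps)
      qed (use "1.IH"[OF False] in simp)
      with "1.IH"[OF False] show ?thesis unfolding b by simp
    qed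
  qed
  then show "u \<noteq> [] \<and> set u \<subseteq> range Bit \<and> (length u = 1 \<or> hd u = Bit True)" if "\<exists>k. u = binary k"
    using that set_binary by metis
next
  show "u \<noteq> [] \<and> set u \<subseteq> range Bit \<and> (length u = 1 \<or> hd u = Bit True) \<Longrightarrow> \<exists>k. u = binary k"
  proof (induction u rule: rev_induct)
    case (snoc a u)
    obtain b where a: "a = Bit b" using snoc.prems by auto
    show ?case
    proof (cases "u = []")
      case True
      then have "u @ [a] = binary (of_bool b)" by (subst binary.simps) (simp add: a)
      then show ?thesis by blast
    next
      case False
      then have hd: "hd u = Bit True" using snoc.prems by (cases u) auto
      then obtain k where k: "u = binary k" using snoc False by auto
      have "k \<noteq> 0"
      proof
        assume "k = 0"
        then have "binary k = [Bit False]" by (subst binary.simps) simp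
        then show False using hd k by simp
      qed
      then have "u @ [a] = binary (2 * k + of_bool b)"
        by (subst binary.simps) (auto simp: a k)
      then show ?thesis by blast
    qed
  qed simp
qed

text \<open>The number \<open>k\<close> at the beginning of the input may be exponentially large, so that its numeral has to be
recognised without computing its value.\<close>

definition is_numeral :: "letter list \<Rightarrow> nat \<Rightarrow> bool" where
  "is_numeral w p \<longleftrightarrow> 0 < p \<and> (\<forall>i<p. letter_at w i (Bit True) \<or> letter_at w i (Bit False)) \<and>
     (p = 1 \<or> letter_at w 0 (Bit True))"

lemma is_numeral_iff: "is_numeral w p \<longleftrightarrow> (\<exists>k. seg w 0 p (binary k))"
proof -
  have seg0: "seg w 0 p u \<longleftrightarrow> p \<le> length w \<and> u = take p w" for u
    by (auto simp: seg_def) (metis append_take_drop_id length_take min.absorb2)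
  have "(\<exists>k. seg w 0 p (binary k)) \<longleftrightarrow> p \<le> length w \<and> (\<exists>k. take p w = binary k)"
    unfolding seg0 by metis
  also have "\<dots> \<longleftrightarrow> p \<le> length w \<and> take p w \<noteq> [] \<and> set (take p w) \<subseteq> range Bit \<and>
      (length (take p w) = 1 \<or> hd (take p w) = Bit True)"
    unfolding numeral_iff ..
  also have "\<dots> \<longleftrightarrow> is_numeral w p"
  proof (cases "p \<le> length w \<and> 0 < p")
    case True
    have "set (take p w) \<subseteq> range Bit \<longleftrightarrow> (\<forall>i<p. w ! i \<in> range Bit)"
      using True by (auto simp: set_conv_nth subset_iff)
    also have "\<dots> \<longleftrightarrow> (\<forall>i<p. letter_at w i (Bit True) \<or> letter_at w i (Bit False))"
      using True by (auto simp: letter_at_def)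
    finally show ?thesis using True by (auto simp: is_numeral_def letter_at_def hd_conv_nth)
  next
    case False
    then have "\<not> is_numeral w p"
      by (auto simp: is_numeral_def letter_at_def not_le)
    with False show ?thesis by auto
  qed
  finally show ?thesis ..
qed

definition tokens :: "nat \<Rightarrow> nat \<Rightarrow> letter list" where
  "tokens s c = concat (map (\<lambda>v. binary v @ [Comma]) [s..<s + c])"

definition token :: "letter list \<Rightarrow> nat \<Rightarrow> nat \<Rightarrow> nat \<Rightarrow> bool" where
  "token w v p q \<longleftrightarrow> (\<exists>r\<le>length w. seg w p r (binary v) \<and> letter_at w r Comma \<and> q = Suc r)"

text \<open>A list of vertices \<open>s, ..., t\<close> between positions \<open>p\<close> and \<open>q\<close>, read by a walk through positions whose
\<open>c\<close>-th step consumes the vertex \<open>s + c\<close>.\<close>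

definition block :: "letter list \<Rightarrow> nat \<Rightarrow> nat \<Rightarrow> nat \<Rightarrow> nat \<Rightarrow> bool" where
  "block w p q s t \<longleftrightarrow> (\<exists>r\<le>length w. r \<in> layer (Suc (length w)) (\<lambda>x. x = p) (\<lambda>c x y. token w (s + c) x y) (Suc t - s) \<and>
     letter_at w r Semicolon \<and> q = Suc r)"

lemma token_iff: "token w v p q \<longleftrightarrow> seg w p q (binary v @ [Comma])"
  unfolding token_def seg_append seg_single using seg_le by blast

lemma layer_tokens:
  assumes "p \<le> length w"
  shows "q \<in> layer (Suc (length w)) (\<lambda>x. x = p) (\<lambda>c x y. token w (s + c) x y) c \<longleftrightarrow> seg w p q (tokens s c)"
proof (induction c arbitrary: q)
  case 0 then show ?case using assms by (auto simp: tokens_def seg_Nil)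
next
  case (Suc c)
  have "tokens s (Suc c) = tokens s c @ binary (s + c) @ [Comma]" by (simp add: tokens_def)
  then have "seg w p q (tokens s (Suc c)) \<longleftrightarrow> (\<exists>r. seg w p r (tokens s c) \<and> token w (s + c) r q)"
    by (simp only: seg_append[of w p q "tokens s c"] token_iff)
  moreover have "token w (s + c) r q \<Longrightarrow> r < Suc (length w) \<and> q < Suc (length w)" for r
    unfolding token_iff using seg_le by fastforce
  ultimately show ?case unfolding layer.simps mem_Collect_eq Suc.IH by blast
qed

lemma block_iff:
  assumes "p \<le> length w" "s \<le> Suc t"
  shows "block w p q s t \<longleftrightarrow> seg w p q (encode_vertices [s..<Suc t])"
proof -
  have "encode_vertices [s..<Suc t] = tokens s (Suc t - s) @ [Semicolon]"
    using assms(2) by (simp add: encode_vertices_def tokens_def)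
  then show ?thesis unfolding block_def layer_tokens[OF assms(1)] by (auto simp: seg_append seg_single dest: seg_le)
qed

definition edge_code :: "nat set \<Rightarrow> letter list" where
  "edge_code S = encode_vertices (sorted_list_of_set S)"

definition edge_codes :: "nat set list \<Rightarrow> letter list" where
  "edge_codes Is = concat (map edge_code Is)"

lemma encode_eq: "encode n Is k = binary k @ [Semicolon] @ encode_vertices [1..<Suc n] @ edge_codes Is"
  by (simp add: encode_def edge_codes_def edge_code_def[abs_def])

lemma edge_code_interval: "s \<le> t \<Longrightarrow> edge_code {s..t} = encode_vertices [s..<Suc t]"
  by (metis atLeastLessThanSuc_atLeastAtMost edge_code_def sorted_list_of_set_range)

text \<open>Encoded lists of vertices form a prefix code: numerals contain neither commas nor semicolons, and the
semicolon ends the list.\<close>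

lemma vertices_prefix_free:
  "encode_vertices vs @ u = encode_vertices vs' @ u' \<Longrightarrow> vs = vs' \<and> u = u'"
proof (induction vs arbitrary: vs')
  case Nil
  show ?case
  proof (cases vs')
    case (Cons v vs'')
    have "binary v \<noteq> []" "hd (binary v) \<noteq> Semicolon"
      using set_binary[of v] numeral_iff[of "binary v"] by (auto dest: hd_in_set)
    with Nil Cons show ?thesis by (cases "binary v") (auto simp: encode_vertices_def)
  qed (use Nil in \<open>simp add: encode_vertices_def\<close>)
next
  case (Cons v vs)
  have cons: "encode_vertices (v # vs) = binary v @ Comma # encode_vertices vs" for v vs
    by (simp add: encode_vertices_def)
  have tw: "takeWhile (\<lambda>x. x \<noteq> Comma) (binary v @ Comma # z) = binary v" for v z
    using set_binary[of v] by (subst takeWhile_append2) auto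
  show ?case
  proof (cases vs')
    case Nil
    have "binary v \<noteq> []" "hd (binary v) \<noteq> Semicolon"
      using set_binary[of v] numeral_iff[of "binary v"] by (auto dest: hd_in_set)
    with Cons Nil show ?thesis by (cases "binary v") (auto simp: encode_vertices_def)
  next
    case (Cons v' vs'')
    have eq: "binary v @ Comma # encode_vertices vs @ u = binary v' @ Comma # encode_vertices vs'' @ u'"
      using Cons.prems unfolding Cons cons by simp
    have "binary v = binary v'" using arg_cong[OF eq, of "takeWhile (\<lambda>x. x \<noteq> Comma)"] unfolding tw .
    then show ?thesis using eq Cons.IH[of vs''] by (simp add: binary_inj Cons)
  qed
qed

lemma edge_codes_prefix:
  assumes "finite (\<Union> (set Js \<union> set Is))"
  shows "edge_codes Js @ y = edge_codes Is \<Longrightarrow> set Js \<subseteq> set Is"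
  using assms
proof (induction Js arbitrary: Is)
  case (Cons J Js)
  obtain I Is' where Is: "Is = I # Is'" using Cons.prems(1) by (cases Is) (auto simp: edge_codes_def edge_code_def encode_vertices_def)
  have eq: "edge_code J @ (edge_codes Js @ y) = edge_code I @ edge_codes Is'"
    using Cons.prems(1) by (simp add: Is edge_codes_def)
  have "finite J" "finite I" using Cons.prems(2) by (auto simp: Is)
  then have "J = I" "edge_codes Js @ y = edge_codes Is'"
    using vertices_prefix_free[OF eq[unfolded edge_code_def]] by (metis sorted_list_of_set(1)) (use vertices_prefix_free[OF eq[unfolded edge_code_def]] in simp)
  then show ?case using Cons.IH[of Is'] Cons.prems(2) by (auto simp: Is)
qed simp

text \<open>Position \<open>q\<close> is reached from \<open>p\<close> by reading \<open>c\<close> hyperedges.\<close>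

definition boundary :: "letter list \<Rightarrow> nat \<Rightarrow> nat \<Rightarrow> nat \<Rightarrow> nat \<Rightarrow> bool" where
  "boundary w n p c q \<longleftrightarrow> q \<in> layer (Suc (length w)) (\<lambda>x. x = p)
     (\<lambda>c x y. \<exists>s\<le>n. \<exists>t\<le>n. 1 \<le> s \<and> s \<le> t \<and> block w x y s t) c"

definition edge :: "letter list \<Rightarrow> nat \<Rightarrow> nat \<Rightarrow> nat \<Rightarrow> nat \<Rightarrow> bool" where
  "edge w n p s t \<longleftrightarrow> (\<exists>c\<le>length w. \<exists>x\<le>length w. \<exists>y\<le>length w. boundary w n p c x \<and> block w x y s t)"

lemma boundary_iff:
  assumes "p \<le> length w"
  shows "boundary w n p c q \<longleftrightarrow> (\<exists>Is. length Is = c \<and> set Is \<subseteq> intervals n \<and> seg w p q (edge_codes Is))"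
proof (induction c arbitrary: q)
  case 0 then show ?case using assms by (auto simp: boundary_def edge_codes_def seg_Nil)
next
  case (Suc c)
  have step: "(\<exists>s\<le>n. \<exists>t\<le>n. 1 \<le> s \<and> s \<le> t \<and> block w x q s t) \<longleftrightarrow> (\<exists>S\<in>intervals n. seg w x q (edge_code S))"
    if "x \<le> length w" for x
  proof
    assume "\<exists>s\<le>n. \<exists>t\<le>n. 1 \<le> s \<and> s \<le> t \<and> block w x q s t"
    then obtain s t where st: "1 \<le> s" "s \<le> t" "t \<le> n" "block w x q s t" by blast
    then have "seg w x q (edge_code {s..t})" using block_iff[OF that, of s t q] by (simp add: edge_code_interval)
    moreover have "{s..t} \<in> intervals n" using st by (auto simp: intervals_iff)
    ultimately show "\<exists>S\<in>intervals n. seg w x q (edge_code S)" by blast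
  next
    assume "\<exists>S\<in>intervals n. seg w x q (edge_code S)"
    then obtain S where S: "S \<in> intervals n" "seg w x q (edge_code S)" by blast
    then obtain s t where "S = {s..t}" "1 \<le> s" "s \<le> t" "t \<le> n" by (auto simp only: intervals_iff)
    with S(2) have st: "1 \<le> s" "s \<le> t" "t \<le> n" "seg w x q (edge_code {s..t})" by simp_all
    then have "block w x q s t" using block_iff[OF that, of s t q] by (simp add: edge_code_interval)
    with st show "\<exists>s\<le>n. \<exists>t\<le>n. 1 \<le> s \<and> s \<le> t \<and> block w x q s t" by (meson le_trans)
  qed
  have "boundary w n p (Suc c) q \<longleftrightarrow> q \<le> length w \<and> (\<exists>x\<le>length w. boundary w n p c x \<and>
      (\<exists>s\<le>n. \<exists>t\<le>n. 1 \<le> s \<and> s \<le> t \<and> block w x q s t))"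
    unfolding boundary_def layer.simps mem_Collect_eq less_Suc_eq_le ..
  also have "\<dots> \<longleftrightarrow> (\<exists>x. \<exists>Is. length Is = c \<and> set Is \<subseteq> intervals n \<and> seg w p x (edge_codes Is) \<and>
      (\<exists>S\<in>intervals n. seg w x q (edge_code S)))"
  proof
    assume "q \<le> length w \<and> (\<exists>x\<le>length w. boundary w n p c x \<and>
      (\<exists>s\<le>n. \<exists>t\<le>n. 1 \<le> s \<and> s \<le> t \<and> block w x q s t))"
    then obtain x where "x \<le> length w" "boundary w n p c x"
      "\<exists>s\<le>n. \<exists>t\<le>n. 1 \<le> s \<and> s \<le> t \<and> block w x q s t" by blast
    then show "\<exists>x. \<exists>Is. length Is = c \<and> set Is \<subseteq> intervals n \<and> seg w p x (edge_codes Is) \<and>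
      (\<exists>S\<in>intervals n. seg w x q (edge_code S))"
      using step[of x] Suc.IH[of x] by blast
  next
    assume "\<exists>x. \<exists>Is. length Is = c \<and> set Is \<subseteq> intervals n \<and> seg w p x (edge_codes Is) \<and>
      (\<exists>S\<in>intervals n. seg w x q (edge_code S))"
    then obtain x Is S where x: "length Is = c" "set Is \<subseteq> intervals n" "seg w p x (edge_codes Is)"
      "S \<in> intervals n" "seg w x q (edge_code S)" by blast
    then have "x \<le> length w" "q \<le> length w" using seg_le[of w p x] seg_le[of w x q] by auto
    moreover have "boundary w n p c x" using Suc.IH[of x] x by blast
    moreover have "\<exists>s\<le>n. \<exists>t\<le>n. 1 \<le> s \<and> s \<le> t \<and> block w x q s t"
      unfolding step[OF calculation(1)] using x by blast
    ultimately show "q \<le> length w \<and> (\<exists>x\<le>length w. boundary w n p c x \<and>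
      (\<exists>s\<le>n. \<exists>t\<le>n. 1 \<le> s \<and> s \<le> t \<and> block w x q s t))" by blast
  qed
  also have "\<dots> \<longleftrightarrow> (\<exists>Is S. length Is = c \<and> set Is \<subseteq> intervals n \<and> S \<in> intervals n \<and> seg w p q (edge_codes (Is @ [S])))"
    by (simp add: edge_codes_def seg_append) blast
  also have "\<dots> \<longleftrightarrow> (\<exists>Is. length Is = Suc c \<and> set Is \<subseteq> intervals n \<and> seg w p q (edge_codes Is))"
  proof
    assume "\<exists>Is. length Is = Suc c \<and> set Is \<subseteq> intervals n \<and> seg w p q (edge_codes Is)"
    then obtain Is where Is: "length Is = Suc c" "set Is \<subseteq> intervals n" "seg w p q (edge_codes Is)" by blast
    then have ne: "Is \<noteq> []" by auto
    then have "Is = butlast Is @ [last Is]" by simp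
    moreover have "last Is \<in> intervals n" using Is(2) ne by auto
    moreover have "set (butlast Is) \<subseteq> intervals n" using Is(2) by (meson in_set_butlastD subset_iff)
    ultimately show "\<exists>Is S. length Is = c \<and> set Is \<subseteq> intervals n \<and> S \<in> intervals n \<and> seg w p q (edge_codes (Is @ [S]))"
      using Is by (intro exI[of _ "butlast Is"] exI[of _ "last Is"]) simp
  next
    assume "\<exists>Is S. length Is = c \<and> set Is \<subseteq> intervals n \<and> S \<in> intervals n \<and> seg w p q (edge_codes (Is @ [S]))"
    then obtain Is S where "length Is = c" "set Is \<subseteq> intervals n" "S \<in> intervals n" "seg w p q (edge_codes (Is @ [S]))" by blast
    then show "\<exists>Is. length Is = Suc c \<and> set Is \<subseteq> intervals n \<and> seg w p q (edge_codes Is)"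
      by (intro exI[of _ "Is @ [S]"]) simp
  qed
  finally show ?case .
qed

lemma length_edge_codes: "length Is \<le> length (edge_codes Is)"
  by (induction Is) (auto simp: edge_codes_def edge_code_def encode_vertices_def)

text \<open>Which hyperedges occur is decided by walks from the beginning of the list of hyperedges. Such a walk might
a priori follow a different decomposition of the word; the prefix code property excludes this.\<close>

lemma edge_iff:
  assumes w: "seg w p (length w) (edge_codes Is)" and Is: "set Is \<subseteq> intervals n"
    and st: "1 \<le> s" "s \<le> t" "t \<le> n"
  shows "edge w n p s t \<longleftrightarrow> {s..t} \<in> set Is"
proof
  have p: "p \<le> length w" using seg_le[OF w] by simp
  assume "edge w n p s t"
  then obtain c x y where "x \<le> length w" "boundary w n p c x" "block w x y s t" unfolding edge_def by blast
  then obtain Js where Js: "set Js \<subseteq> intervals n" "seg w p x (edge_codes Js)" "seg w x y (edge_code {s..t})"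
    using boundary_iff[OF p] block_iff[of x w s t y] st by (auto simp: edge_code_interval)
  then have "seg w p y (edge_codes (Js @ [{s..t}]))" by (auto simp: edge_codes_def seg_append)
  then obtain a b where ab: "w = a @ edge_codes (Js @ [{s..t}]) @ b" "length a = p" by (auto simp: seg_def)
  obtain a' b' where a': "w = a' @ edge_codes Is @ b'" "length a' = p" "length w = p + length (edge_codes Is)"
    using w by (auto simp: seg_def)
  then have "b' = []" by simp
  then have "edge_codes (Js @ [{s..t}]) @ b = edge_codes Is" using ab a' by simp
  moreover have "finite (\<Union> (set (Js @ [{s..t}]) \<union> set Is))"
  proof -
    have "\<forall>S\<in>set (Js @ [{s..t}]) \<union> set Is. finite S" using Js(1) Is by (auto simp: intervals_def)
    then show ?thesis by auto
  qed
  ultimately have "set (Js @ [{s..t}]) \<subseteq> set Is" by (rule edge_codes_prefix[rotated])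
  then show "{s..t} \<in> set Is" by simp
next
  have p: "p \<le> length w" using seg_le[OF w] by simp
  assume "{s..t} \<in> set Is"
  then obtain Js Ks where Js: "Is = Js @ {s..t} # Ks" by (meson split_list)
  then have "edge_codes Is = edge_codes Js @ edge_code {s..t} @ edge_codes Ks" by (simp add: edge_codes_def)
  with w have "seg w p (length w) (edge_codes Js @ edge_code {s..t} @ edge_codes Ks)" by simp
  then obtain x y where xy: "seg w p x (edge_codes Js)" "seg w x y (edge_code {s..t})"
    unfolding seg_append by blast
  have "length Is \<le> length w" using w length_edge_codes[of Is] by (auto simp: seg_def)
  then have "length Js \<le> length w" by (simp add: Js)
  moreover have "boundary w n p (length Js) x" using boundary_iff[OF p] xy(1) Is Js by auto
  moreover have "x \<le> length w" "y \<le> length w" using seg_le xy by blast+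
  moreover have "block w x y s t" using block_iff[of x w s t y] calculation(3) xy(2) st by (simp add: edge_code_interval)
  ultimately show "edge w n p s t" unfolding edge_def by blast
qed

section \<open>The decision procedure\<close>

text \<open>The binary length of \<open>N\<close> (and 0 for 0), in a form that only divides.\<close>

definition log_bound :: "nat \<Rightarrow> nat" where
  "log_bound N = (LEAST l. N div 2 ^ l = 0)"

lemma less_log_bound: "N < 2 ^ log_bound N"
proof -
  have "N div 2 ^ N = 0" by (simp add: less_exp)
  then have "N div 2 ^ log_bound N = 0" unfolding log_bound_def by (rule LeastI)
  then show ?thesis by (simp add: div_eq_0_iff)
qed

lemma log_bound_le: "N < 2 ^ l \<Longrightarrow> log_bound N \<le> l"
  unfolding log_bound_def by (rule Least_le) simp

text \<open>The base of the digits is \<open>Suc (length w)\<close>, which exceeds all vertices as they are written out in \<open>w\<close>; the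
number of states is a power of two that is at least the \<open>2 * k\<close>-th power of this base for all \<open>k \<le> log_bound (length w)\<close>.\<close>

definition well_colored :: "letter list \<Rightarrow> nat \<Rightarrow> nat \<Rightarrow> nat \<Rightarrow> bool" where
  "well_colored w n p k \<longleftrightarrow> (\<exists>x<2 ^ (2 * log_bound (length w) * log_bound (length w)).
     x \<in> layer (2 ^ (2 * log_bound (length w) * log_bound (length w))) (\<lambda>x. x = 0)
       (\<lambda>t x y. recolor (Suc (length w)) k t x y \<and>
          (\<forall>s\<le>Suc t. 1 \<le> s \<and> edge w n p s (Suc t) \<longrightarrow> satisfied (Suc (length w)) k s y)) n)"

text \<open>In the order of the quantifiers, \<open>p\<close> is the end of the numeral of the number of colors, \<open>n\<close> the number of
vertices, \<open>q\<close> the end of the list of vertices, and \<open>j\<close> a sufficient number of colors. A number of colors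
exceeding \<open>length w\<close> imposes no condition on \<open>j\<close>, which is at most logarithmic.\<close>

definition decision :: "letter list \<Rightarrow> bool" where
  "decision w \<longleftrightarrow> (\<exists>p\<le>length w. \<exists>n\<le>length w. \<exists>q\<le>length w. is_numeral w p \<and> letter_at w p Semicolon \<and>
     block w (Suc p) q 1 n \<and> (\<exists>c\<le>length w. boundary w n q c (length w)) \<and>
     (\<exists>j\<le>log_bound (length w). (\<forall>k\<le>length w. seg w 0 p (binary k) \<longrightarrow> j \<le> k) \<and> well_colored w n q j))"

lemma well_colored_iff:
  assumes w: "seg w p (length w) (edge_codes Is)" and Is: "set Is \<subseteq> intervals n"
    and n: "n \<le> length w" and k: "k \<le> log_bound (length w)"
  shows "well_colored w n p k \<longleftrightarrow> colorable n (set Is) k"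
proof -
  let ?N = "length w" and ?X = "2 ^ (2 * log_bound (length w) * log_bound (length w)) :: nat"
  have "Suc ?N \<le> 2 ^ log_bound ?N" using less_log_bound[of ?N] by simp
  then have "Suc ?N ^ (2 * k) \<le> (2 ^ log_bound ?N) ^ (2 * k)" by (rule power_mono) simp
  also have "\<dots> \<le> (2 ^ log_bound ?N) ^ (2 * log_bound ?N)" using k by (intro power_increasing) auto
  also have "\<dots> = ?X" by (simp flip: power_mult add: mult.commute mult.left_commute)
  finally have X: "Suc ?N ^ (2 * k) \<le> ?X" .
  have "well_colored w n p k \<longleftrightarrow> (\<exists>C. (\<forall>v\<in>{1..n}. C v \<le> k) \<and>
      (\<forall>t\<in>{1..n}. \<forall>s\<in>{1..t}. edge w n p s t \<longrightarrow> (\<exists>i>0. card {v \<in> {s..t}. C v = i} = 1)))"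
  proof -
    have "n < Suc ?N" using n by simp
    note L = layer_coloring[OF this X, of "edge w n p"]
    show ?thesis unfolding well_colored_def L[symmetric] using layer_bound by blast
  qed
  also have "\<dots> \<longleftrightarrow> (\<exists>C. (\<forall>v\<in>{1..n}. C v \<le> k) \<and>
      (\<forall>t\<in>{1..n}. \<forall>s\<in>{1..t}. {s..t} \<in> set Is \<longrightarrow> (\<exists>i>0. card {v \<in> {s..t}. C v = i} = 1)))"
    using edge_iff[OF w Is] by (auto cong: ex_cong ball_cong)
  also have "\<dots> \<longleftrightarrow> colorable n (set Is) k"
    unfolding colorable_def cf_coloring_intervals[OF Is] by (auto simp: image_subset_iff)
  finally show ?thesis .
qed

theorem decision_iff: "decision w \<longleftrightarrow> w \<in> CFSubsetIntervals"
proof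
  assume "decision w"
  then obtain p n q c j where a: "p \<le> length w" "n \<le> length w" "q \<le> length w" "is_numeral w p"
    "letter_at w p Semicolon" "block w (Suc p) q 1 n" "boundary w n q c (length w)"
    "j \<le> log_bound (length w)" "\<And>k. k \<le> length w \<Longrightarrow> seg w 0 p (binary k) \<Longrightarrow> j \<le> k" "well_colored w n q j"
    unfolding decision_def by blast
  obtain k where k: "seg w 0 p (binary k)" using a(4) is_numeral_iff by blast
  have "p < length w" using a(5) by (simp add: letter_at_def)
  then have b: "seg w (Suc p) q (encode_vertices [1..<Suc n])" using a(6) block_iff[of "Suc p" w 1 n q] by simp
  obtain Is where Is: "set Is \<subseteq> intervals n" "seg w q (length w) (edge_codes Is)"
    using a(7) boundary_iff[OF a(3)] by blast
  have "seg w p (Suc p) [Semicolon]" using a(5) by (simp add: seg_single)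
  then have "seg w 0 (length w) (encode n Is k)" unfolding encode_eq seg_append using k b Is(2) by blast
  then have "w = encode n Is k" by (auto simp: seg_def)
  moreover have "j \<le> k"
  proof (cases "k \<le> length w")
    case False
    have "length w < 2 ^ length w" by (rule less_exp)
    then have "log_bound (length w) \<le> length w" by (rule log_bound_le)
    with a(8) False show ?thesis by simp
  qed (use a(9) k in blast)
  moreover have "colorable n (set Is) j" using well_colored_iff[OF Is(2,1) a(2,8)] a(10) by simp
  moreover have "n < 2 ^ log_bound (length w)" using a(2) less_log_bound[of "length w"] by simp
  ultimately show "w \<in> CFSubsetIntervals"
    unfolding CFSubsetIntervals_def using Is(1) a(8) chi_cf_le_iff[OF Is(1), of "log_bound (length w)" k] by blast
next
  assume "w \<in> CFSubsetIntervals"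
  then obtain n Is k where w: "w = encode n Is k" and Is: "set Is \<subseteq> intervals n" and chi: "chi_cf {1..n} (set Is) \<le> k"
    unfolding CFSubsetIntervals_def by blast
  have "seg w 0 (length w) (encode n Is k)" by (auto simp: seg_def w)
  then obtain p q where k: "seg w 0 p (binary k)" and s: "letter_at w p Semicolon"
    and b: "seg w (Suc p) q (encode_vertices [1..<Suc n])" and e: "seg w q (length w) (edge_codes Is)"
    unfolding encode_eq seg_append seg_single by blast
  have le: "p \<le> length w" "Suc p \<le> length w" "q \<le> length w" using seg_le[OF k] seg_le[OF b] by auto
  have "length vs \<le> length (encode_vertices vs)" for vs by (induction vs) (auto simp: encode_vertices_def)
  from this[of "[1..<Suc n]"] have n: "n \<le> length w" using b by (auto simp: seg_def)
  then have "n < 2 ^ log_bound (length w)" using less_log_bound[of "length w"] by simp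
  then obtain j where j: "j \<le> log_bound (length w)" "j \<le> k" "colorable n (set Is) j"
    using chi chi_cf_le_iff[OF Is] by blast
  have "is_numeral w p" using k is_numeral_iff by blast
  moreover have "block w (Suc p) q 1 n" using b block_iff[OF le(2), of 1 n q] by simp
  moreover have "boundary w n q (length Is) (length w)" using boundary_iff[OF le(3)] Is e by blast
  moreover have "length Is \<le> length w" using e length_edge_codes[of Is] by (auto simp: seg_def)
  moreover have "j \<le> k'" if "seg w 0 p (binary k')" for k'
  proof -
    have "binary k' = binary k" using k that by (auto simp: seg_def)
    then show ?thesis using j(2) by (simp add: binary_inj)
  qed
  moreover have "well_colored w n q j" using well_colored_iff[OF e Is n j(1)] j(3) by simp
  ultimately show "decision w" unfolding decision_def using le n s j(1) by blast
qed


section \<open>The decision procedure is feasible\<close>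

lemmas feasible_intros = feasible_conj feasible_disj feasible_imp feasible_not feasible_if_bool feasible_less feasible_le feasible_eq
  feasible_ex feasible_ex_le feasible_all feasible_all_le feasible_div_power feasible_mod feasible_diff feasible_add feasible_mult feasible_Suc
  feasible_var feasible_const feasible_letter_at feasible_length

text \<open>Letters are tested against constants only.\<close>

lemma letter_at_odd: "letter_at w i (Bit (odd k)) \<longleftrightarrow>
    (if k mod 2 = 1 then letter_at w i (Bit True) else letter_at w i (Bit False))"
  by (cases "odd k") (auto simp: odd_iff_mod_2_eq_one)

lemma feasible_seg_binary:
  assumes p: "feasible m p" and q: "feasible m q" and k: "feasible m k"
  shows "feasible m (\<lambda>s. of_bool (seg (inp s) (p s) (q s) (binary (k s))))"
  unfolding seg_binary letter_at_odd
  by (intro feasible_intros feasible_mono[OF p] feasible_mono[OF q] feasible_mono[OF k])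
    (simp_all add: depends_def feasible_restrict[OF p] feasible_restrict[OF q] feasible_restrict[OF k])

lemma feasible_token:
  assumes v: "feasible m v" and p: "feasible m p" and q: "feasible m q"
  shows "feasible m (\<lambda>s. of_bool (token (inp s) (v s) (p s) (q s)))"
  unfolding token_def
  by (intro feasible_intros feasible_seg_binary feasible_mono[OF v] feasible_mono[OF p] feasible_mono[OF q])
    (simp_all add: depends_def feasible_restrict[OF v] feasible_restrict[OF p] feasible_restrict[OF q])

lemma feasible_block:
  assumes p: "feasible m p" and q: "feasible m q" and s: "feasible m a" and t: "feasible m b"
  shows "feasible m (\<lambda>s. of_bool (block (inp s) (p s) (q s) (a s) (b s)))"
  unfolding block_def
  by (intro feasible_intros feasible_layer feasible_token feasible_mono[OF p] feasible_mono[OF q] feasible_mono[OF s] feasible_mono[OF t])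
    (simp_all add: depends_def feasible_restrict[OF p] feasible_restrict[OF q] feasible_restrict[OF s] feasible_restrict[OF t])

lemma feasible_boundary:
  assumes n: "feasible m n" and p: "feasible m p" and c: "feasible m c" and q: "feasible m q"
  shows "feasible m (\<lambda>s. of_bool (boundary (inp s) (n s) (p s) (c s) (q s)))"
  unfolding boundary_def
  by (intro feasible_intros feasible_layer feasible_block feasible_mono[OF n] feasible_mono[OF p] feasible_mono[OF c] feasible_mono[OF q])
    (auto simp: depends_def feasible_restrict[OF n] feasible_restrict[OF p] feasible_restrict[OF c] feasible_restrict[OF q] feasible_restrict
      intro: feasible_mono)

lemma feasible_edge:
  assumes n: "feasible m n" and p: "feasible m p" and a: "feasible m a" and b: "feasible m b"
  shows "feasible m (\<lambda>s. of_bool (edge (inp s) (n s) (p s) (a s) (b s)))"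
  unfolding edge_def
  by (intro feasible_intros feasible_block feasible_boundary feasible_mono[OF n] feasible_mono[OF p] feasible_mono[OF a] feasible_mono[OF b])
    (simp_all add: depends_def feasible_restrict[OF n] feasible_restrict[OF p] feasible_restrict[OF a] feasible_restrict[OF b])

lemma feasible_digit:
  assumes "feasible m b" "feasible m x" "feasible m j"
  shows "feasible m (\<lambda>s. digit (b s) (x s) (j s))"
  unfolding digit_def by (intro feasible_intros assms)

lemma feasible_recolor:
  assumes b: "feasible m b" and k: "feasible m k" and t: "feasible m t" and x: "feasible m x" and y: "feasible m y"
  shows "feasible m (\<lambda>s. of_bool (recolor (b s) (k s) (t s) (x s) (y s)))"
  unfolding recolor_def
  by (intro feasible_intros feasible_digit feasible_mono[OF b] feasible_mono[OF k] feasible_mono[OF t] feasible_mono[OF x] feasible_mono[OF y])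
    (simp_all add: depends_def feasible_restrict[OF b] feasible_restrict[OF k] feasible_restrict[OF t] feasible_restrict[OF x] feasible_restrict[OF y])

lemma feasible_satisfied:
  assumes b: "feasible m b" and k: "feasible m k" and a: "feasible m a" and x: "feasible m x"
  shows "feasible m (\<lambda>s. of_bool (satisfied (b s) (k s) (a s) (x s)))"
  unfolding satisfied_def
  by (intro feasible_intros feasible_digit feasible_mono[OF b] feasible_mono[OF k] feasible_mono[OF a] feasible_mono[OF x])
    (simp_all add: depends_def feasible_restrict[OF b] feasible_restrict[OF k] feasible_restrict[OF a] feasible_restrict[OF x])

lemma feasible_log_bound: "feasible m (\<lambda>s. log_bound (length (inp s)))"
  unfolding log_bound_def
proof (rule feasible_Least[where b = "\<lambda>s. length (inp s)"])
  show "\<exists>l\<le>length (inp s). length (inp s) div 2 ^ l = 0" for s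
    by (intro exI[of _ "length (inp s)"]) (simp add: less_exp)
qed (intro feasible_intros | simp add: depends_def)+

definition state_bound :: "nat \<Rightarrow> nat" where
  "state_bound N = 2 ^ (2 * log_bound N * log_bound N)"

text \<open>The only place where the computation leaves the polynomial range: \<open>log_bound (length w) \<le> Suc r \<le> r\<^sup>2\<close>, so
that the exponent is at most \<open>2 * r ^ 4 \<le> r ^ 5\<close>.\<close>

lemma feasible_state_bound: "feasible m (\<lambda>s. state_bound (length (inp s)))"
  unfolding state_bound_def
proof (rule feasible_exp)
  have "2 ^ (2 * log_bound (length (inp s)) * log_bound (length (inp s))) \<le> (2::nat) ^ (r ^ 5)"
    if o: "ok r m (restrict m s)" for r s
  proof -
    have r: "2 \<le> r" "length (inp s) \<le> 2 ^ r" using o by (simp_all add: ok_def)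
    then have "length (inp s) < 2 ^ Suc r" using less_le_trans[of "length (inp s)" "Suc (2 ^ r)" "2 ^ Suc r"] by simp
    then have "log_bound (length (inp s)) \<le> Suc r" by (rule log_bound_le)
    also have "Suc r \<le> r * r" using r(1) mult_le_mono1[OF r(1), of r] by linarith
    finally have l: "log_bound (length (inp s)) \<le> r * r" .
    have "2 * log_bound (length (inp s)) * log_bound (length (inp s)) \<le> r * (r * r) * (r * r)"
      by (intro mult_le_mono r l)
    also have "\<dots> = r ^ 5" by (simp add: numeral_eq_Suc)
    finally show ?thesis by (rule power_increasing) simp
  qed
  then show "qbounded m (\<lambda>s. 2 ^ (2 * log_bound (length (inp s)) * log_bound (length (inp s))))"
    unfolding qbounded_def using quasi_pow[of 5] by blast
qed (intro feasible_intros feasible_log_bound)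

lemma feasible_well_colored:
  assumes n: "feasible m n" and p: "feasible m p" and k: "feasible m k"
  shows "feasible m (\<lambda>s. of_bool (well_colored (inp s) (n s) (p s) (k s)))"
  unfolding well_colored_def state_bound_def[symmetric]
  by (intro feasible_intros feasible_layer feasible_edge feasible_recolor feasible_satisfied feasible_state_bound
      feasible_mono[OF n] feasible_mono[OF p] feasible_mono[OF k])
    (auto simp: depends_def feasible_restrict[OF n] feasible_restrict[OF p] feasible_restrict[OF k] feasible_restrict intro: feasible_mono)

lemma feasible_decision: "feasible 0 (\<lambda>s. of_bool (decision (inp s)))"
  unfolding decision_def is_numeral_def
  by (intro feasible_intros feasible_seg_binary feasible_block feasible_boundary feasible_well_colored feasible_log_bound)
    (simp_all add: depends_def)

section \<open>The machine\<close>

text \<open>A program cannot tell whether the counters beyond its \<open>tape_bound\<close> have their markers, so it is enough to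
set up finitely many of them.\<close>

lemma run_frame:
  assumes "run c \<sigma> t \<sigma>'" "tape_bound c \<le> K" "\<And>i. i < K \<Longrightarrow> \<sigma> i = \<tau> i"
  shows "\<exists>\<tau>'. run c \<tau> t \<tau>' \<and> (\<forall>i<K. \<sigma>' i = \<tau>' i)"
  using assms
proof (induction arbitrary: \<tau> rule: run.induct)
  case (Mv i d \<sigma>)
  then show ?case using run.Mv[of i d \<tau>] by fastforce
next
  case (Wr i x \<sigma>)
  then show ?case using run.Wr[of i x \<tau>] by fastforce
next
  case (Seq a \<sigma> t \<sigma>' b u \<sigma>'')
  obtain \<tau>1 where 1: "run a \<tau> t \<tau>1" "\<forall>i<K. \<sigma>' i = \<tau>1 i" using Seq.IH(1)[of \<tau>] Seq.prems by auto
  obtain \<tau>2 where "run b \<tau>1 u \<tau>2" "\<forall>i<K. \<sigma>'' i = \<tau>2 i" using Seq.IH(2)[of \<tau>1] Seq.prems 1 by auto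
  with 1 show ?case using run.Seq by blast
next
  case (IfT P \<sigma> i a t \<sigma>' b)
  obtain \<tau>1 where 1: "run a \<tau> t \<tau>1" "\<forall>i<K. \<sigma>' i = \<tau>1 i" using IfT.IH[of \<tau>] IfT.prems by auto
  then show ?case using run.IfT[of P \<tau> i a] IfT.hyps(1) IfT.prems by (metis Suc_le_lessD max.bounded_iff tape_bound.simps(4))
next
  case (IfF P \<sigma> i b t \<sigma>' a)
  obtain \<tau>1 where 1: "run b \<tau> t \<tau>1" "\<forall>i<K. \<sigma>' i = \<tau>1 i" using IfF.IH[of \<tau>] IfF.prems by auto
  then show ?case using run.IfF[of P \<tau> i b] IfF.hyps(1) IfF.prems by (metis Suc_le_lessD max.bounded_iff tape_bound.simps(4))
next
  case (WhileF P \<sigma> i a)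
  then show ?case using run.WhileF[of P \<tau> i a] by (metis Suc_le_lessD max.bounded_iff tape_bound.simps(5))
next
  case (WhileT P \<sigma> i a t \<sigma>' u \<sigma>'')
  obtain \<tau>1 where 1: "run a \<tau> t \<tau>1" "\<forall>i<K. \<sigma>' i = \<tau>1 i" using WhileT.IH(1)[of \<tau>] WhileT.prems by auto
  obtain \<tau>2 where 2: "run (While i P a) \<tau>1 u \<tau>2" "\<forall>i<K. \<sigma>'' i = \<tau>2 i"
    using WhileT.IH(2)[of \<tau>1] WhileT.prems 1 by auto
  have "P (read_tape (\<tau> i))" using WhileT.hyps(1) WhileT.prems by simp
  from run.WhileT[OF this 1(1) 2(1)] 2(2) show ?case by blast
qed

text \<open>A machine starts with blank tapes, which represent empty arrays; counters need their markers first.\<close>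

primrec markers :: "nat \<Rightarrow> letter com" where
  "markers 0 = Mv 0 Stay"
| "markers (Suc n) = Seq (markers n) (Wr (vtape n) (Work 0))"

lemma runs_markers:
  assumes "\<And>i. i > 0 \<Longrightarrow> \<sigma> i = blank_tape"
  shows "runs (markers n) \<sigma> (2 * n + 1) (\<lambda>i. if i \<in> vtape ` {..<n} then numtape 0 else \<sigma> i)"
proof (induction n)
  case 0 then show ?case using runs_skip[of \<sigma>] by simp
next
  case (Suc n)
  let ?u = "\<lambda>n i. if i \<in> vtape ` {..<n} then numtape 0 else \<sigma> i"
  have "?u n (vtape n) = ((\<lambda>_. Blank), 0)" using assms[of "vtape n"] by (auto simp: blank_tape_def)
  from runs_Wr[of "?u n" "vtape n", OF this]
  have "runs (Wr (vtape n) (Work 0)) (?u n) 1 ((?u n)(vtape n := numtape 0))" by (simp add: numtape_def)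
  moreover have "(?u n)(vtape n := numtape 0) = ?u (Suc n)" by (auto simp: fun_eq_iff less_Suc_eq)
  ultimately have "runs (Wr (vtape n) (Work 0)) (?u n) 1 (?u (Suc n))" by (simp only:)
  from runs_Seq[OF Suc this] show ?case by simp
qed

instance letter :: finite
proof
  have "(UNIV :: letter set) \<subseteq> range Bit \<union> {Comma, Semicolon}"
  proof
    fix x :: letter show "x \<in> range Bit \<union> {Comma, Semicolon}" by (cases x) auto
  qed
  then show "finite (UNIV :: letter set)" by (rule finite_subset) simp
qed

theorem feasible_decides:
  assumes "feasible 0 (\<lambda>s. of_bool (inp s \<in> L))"
  shows "\<exists>(M :: letter tm) a e. wf_tm M \<and> decides_in_time M L (\<lambda>N. a + 2 ^ ((log_bound N + 2) ^ e))"
proof -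
  obtain c B where B: "quasi B" "\<And>r s. ok r 0 s \<Longrightarrow> runs c (layout s) (B r) (layout (setv 0 (of_bool (inp s \<in> L)) s))"
    using feasible_cmd[OF assms order_refl] by metis
  obtain e where e: "\<And>r. r \<ge> 2 \<Longrightarrow> B r \<le> 2 ^ (r ^ e)" using B(1) unfolding quasi_def by blast
  define K where "K = max (tape_bound c) 2"
  let ?T = "\<lambda>N. (2 * K + 3) + 2 ^ ((log_bound N + 2) ^ e)"
  have "\<exists>t \<sigma>. t < ?T (length w) \<and>
      run (Seq (markers K) c) (\<lambda>i. if i = 0 then input_tape w else blank_tape) t \<sigma> \<and>
      (positive (read_tape (\<sigma> (vtape 0))) \<longleftrightarrow> w \<in> L)" for w
  proof -
    define s :: store where "s = \<lparr>inp = w, var = \<lambda>_. 0, arr = \<lambda>_. {}\<rparr>"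
    let ?r = "log_bound (length w) + 2"
    let ?i = "\<lambda>i. if i = 0 then input_tape w else blank_tape"
    let ?m = "\<lambda>i. if i \<in> vtape ` {..<K} then numtape 0 else ?i i"
    have "length w \<le> 2 ^ ?r" using less_log_bound[of "length w"] by simp
    then have "ok ?r 0 s" by (simp add: ok_def s_def)
    from B(2)[OF this] obtain t \<sigma> where t: "t \<le> B ?r" "run c (layout s) t \<sigma>" "\<sigma> = layout (setv 0 (of_bool (w \<in> L)) s)"
      unfolding runs_def by (auto simp: s_def)
    have eq: "layout s i = ?m i" if "i < K" for i
    proof -
      consider "i = 0" | j where "i = vtape j" | j where "i = atape j"
        unfolding vtape_def atape_def by (metis add.commute add_2_eq_Suc' evenE mult_Suc_right not0_implies_Suc oddE mult_0_right)
      then show ?thesis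
      proof cases
        case (2 j)
        then have "j < K" using that by (simp add: vtape_def)
        with 2 show ?thesis by (auto simp: s_def)
      qed (auto simp: s_def settape_def blank_tape_def)
    qed
    have "tape_bound c \<le> K" by (simp add: K_def)
    from run_frame[OF t(2) this eq] obtain \<tau> where \<tau>: "run c ?m t \<tau>" "\<forall>i<K. \<sigma> i = \<tau> i" by blast
    obtain u where u: "u \<le> 2 * K + 1" "run (markers K) ?i u ?m" using runs_markers[of ?i K] unfolding runs_def by auto
    have "\<tau> (vtape 0) = numtape (of_bool (w \<in> L))" using \<tau>(2)[rule_format, of "vtape 0"] t(3) by (simp add: K_def vtape_def[of 0] layout_def)
    then have "positive (read_tape (\<tau> (vtape 0))) \<longleftrightarrow> w \<in> L" by (simp only: read_numtape) simp
    moreover have "Suc (u + t) < ?T (length w)" using u(1) t(1) e[of ?r] by simp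
    ultimately show ?thesis using run.Seq[OF u(2) \<tau>(1)] by blast
  qed
  from run_decides[where T = ?T and c = "Seq (markers K) c" and i = "vtape 0" and P = positive and L = L, OF this] show ?thesis by blast
qed

lemma log_bound_log:
  assumes "N \<ge> 1" shows "real (log_bound N) \<le> log 2 (real N) + 1"
proof (cases "log_bound N")
  case (Suc l)
  then have "\<not> N < 2 ^ l" using log_bound_le[of N l] by auto
  then have "real (2 ^ l) \<le> real N" by linarith
  then have "log 2 (2 ^ l) \<le> log 2 (real N)" using assms by (subst log_le_cancel_iff) auto
  then show ?thesis by (simp add: Suc)
qed (use assms in simp)

text \<open>With \<open>x = log 2 N\<close> large enough, \<open>log_bound N + 2 \<le> x + 3 \<le> x\<^sup>2\<close>, and one more factor \<open>x\<close> in the exponent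
absorbs the additive constant.\<close>

lemma quasipolynomial_log_bound: "quasipolynomial (\<lambda>N. a + 2 ^ ((log_bound N + 2) ^ e))"
  unfolding quasipolynomial_def
proof (intro exI eventually_sequentiallyI)
  fix N :: nat assume N: "2 ^ (a + 5) \<le> N"
  define x where "x = log 2 (real N)"
  have "real (2 ^ (a + 5)) \<le> real N" using N by (rule of_nat_mono)
  moreover have "0 < real N" using N by (metis gr0I le_zero_eq of_nat_0_less_iff power_eq_0_iff zero_neq_numeral)
  ultimately have "log 2 (2 ^ (a + 5)) \<le> x" unfolding x_def by (subst log_le_cancel_iff) auto
  then have x: "real a + 5 \<le> x" by simp
  let ?y = "(log_bound N + 2) ^ e"
  have "N \<ge> 1" using N by (metis One_nat_def Suc_leI gr0I le_zero_eq power_eq_0_iff zero_neq_numeral)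
  from log_bound_log[OF this] have "real (log_bound N + 2) \<le> x + 3" by (simp add: x_def)
  also have "\<dots> \<le> x * x" using x mult_right_mono[of 2 x x] by linarith
  finally have "real (log_bound N + 2) ^ e \<le> (x * x) ^ e" by (rule power_mono) simp
  also have "(x * x) ^ e = x ^ (2 * e)" by (simp add: power_mult power2_eq_square)
  finally have y: "real ?y \<le> x ^ (2 * e)" by simp
  have "a + 2 ^ ?y \<le> 2 ^ a * (2::nat) ^ ?y"
  proof -
    have "a * 1 \<le> a * (2::nat) ^ ?y" by (intro mult_le_mono2) simp
    moreover have "Suc a * 2 ^ ?y \<le> 2 ^ a * (2::nat) ^ ?y" by (intro mult_le_mono1) (simp add: Suc_leI less_exp)
    ultimately show ?thesis by (simp only: mult_Suc mult_1_right)
  qed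
  then have "real (a + 2 ^ ?y) \<le> real (2 ^ (a + ?y))" unfolding power_add by (rule of_nat_mono)
  also have "\<dots> = 2 powr real (a + ?y)" by (subst powr_realpow) simp_all
  also have "\<dots> \<le> 2 powr (x ^ Suc (2 * e))"
  proof (rule powr_mono)
    have "1 \<le> x ^ (2 * e)" using x by (intro one_le_power) simp
    then have "real a * 1 \<le> real a * x ^ (2 * e)" by (intro mult_left_mono) auto
    moreover have "(real a + 1) * x ^ (2 * e) \<le> x * x ^ (2 * e)" using x by (intro mult_right_mono) auto
    ultimately show "real (a + ?y) \<le> x ^ Suc (2 * e)" using y by (simp add: algebra_simps)
  qed simp
  finally show "real (a + 2 ^ ?y) \<le> 2 powr (log 2 (real N) ^ Suc (2 * e))" by (simp add: x_def)
qed

theorem corollary5p2: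
  "\<exists>(M :: letter tm) T. wf_tm M \<and> decides_in_time M CFSubsetIntervals T \<and> quasipolynomial T"
proof -
  have "feasible 0 (\<lambda>s. of_bool (inp s \<in> CFSubsetIntervals))" using feasible_decision by (simp only: decision_iff)
  from feasible_decides[OF this] show ?thesis using quasipolynomial_log_bound by blast
qed

end
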